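(* Let $p_1,p_2,p_3>0$ with $p_1+p_2+p_3=1$. For $0<\alpha,\beta,\gamma<1$ with $\max\{\alpha,\beta\}+\gamma<1$, let $\nu_{\alpha,\beta,\gamma}$ be the self-similar measure of the iterated function system $\mathcal{S}_{\alpha,\beta,\gamma}=\{S_1(x)=\alpha x,\ S_2(x)=\beta x,\ S_3(x)=\gamma x+1-\gamma\}$ on $\mathbb{R}$ with probability vector $(p_1,p_2,p_3)$. Then for every $0<\beta,\gamma<1/9$ and for Lebesgue almost every $\alpha\in(0,\beta)$, $$\dim_H(\nu_{\alpha,\beta,\gamma})=\frac{-(p_1\log p_1+p_2\log p_2+p_3\log p_3)+\Phi(p_1,p_2,p_3)}{-(p_1\log\alpha+p_2\log\beta+p_3\log\gamma)},$$ where $$\Phi(p_1,p_2,p_3)=\sum_{k=1}^\infty\sum_{m=1}^{k}\binom{k-1}{m-1}\,p_3\,\log\left(\frac{m}{k}\right)\left(p_1^m p_2^{k-m}+p_1^{k-m}p_2^m\right).$$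
   Context: The self-similar measure of an IFS $\{S_1,\dots,S_m\}$ of contracting similarities of $\mathbb{R}$ with probability vector $(p_1,\dots,p_m)$ is the unique compactly supported Borel probability measure $\nu$ on $\mathbb{R}$ with $\nu=\sum_{i=1}^m p_i\,(S_i)_*\nu$. For a Borel probability measure $\mu$ on $\mathbb{R}$, the lower and upper local dimensions at $x$ are $\underline{d}_\mu(x)=\liminf_{r\to0}\frac{\log\mu(B(x,r))}{\log r}$ and $\overline{d}_\mu(x)=\limsup_{r\to0}\frac{\log\mu(B(x,r))}{\log r}$. The measure $\mu$ is exact dimensional if there is a constant $c$ with $\underline{d}_\mu(x)=\overline{d}_\mu(x)=c$ for $\mu$-almost every $x$; then $\dim_H\mu$ denotes this $c$, which equals both $\inf\{\dim_H A:A\text{ Borel},\ \mu(A)>0\}$ and $\inf\{\dim_H A:A\text{ Borel},\ \mu(\mathbb{R}\setminus A)=0\}$. Every self-similar measure on $\mathbb{R}$ is exact dimensional (Feng and Hu). *)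

theory Defs
  imports "HOL-Probability.Probability"
begin

text \<open>The IFS and its probability vector are given as lists of equal length.  Measures
  have no pointwise sum in the library, so the identity
  \<open>\<nu> = (\<Sum>i. p\<^sub>i (S\<^sub>i)\<^sub>* \<nu>)\<close> is stated on Borel sets.\<close>

definition is_self_similar_measure ::
    "(real \<Rightarrow> real) list \<Rightarrow> real list \<Rightarrow> real measure \<Rightarrow> bool" where
  "is_self_similar_measure S p \<nu> \<longleftrightarrow>
     prob_space \<nu> \<and> sets \<nu> = sets borel \<and>
     (\<exists>K. compact K \<and> emeasure \<nu> (- K) = 0) \<and>
     (\<forall>A \<in> sets borel. emeasure \<nu> A =
        (\<Sum>i<length S. ennreal (p ! i) * emeasure (distr \<nu> borel (S ! i)) A))"

text \<open>The definite description is well defined when \<open>S\<close> is a nonempty list of contracting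
  similarities and \<open>p\<close> is a probability vector (Hutchinson).\<close>

definition self_similar_measure ::
    "(real \<Rightarrow> real) list \<Rightarrow> real list \<Rightarrow> real measure" where
  "self_similar_measure S p = (THE \<nu>. is_self_similar_measure S p \<nu>)"

text \<open>The value \<open>\<infinity>\<close> implements the convention \<open>log 0 = -\<infinity>\<close> for \<open>0 < r < 1\<close>; the library
  has \<open>ln 0 = 0\<close>.\<close>

definition log_ratio :: "real measure \<Rightarrow> real \<Rightarrow> real \<Rightarrow> ereal" where
  "log_ratio \<mu> x r =
     (if measure \<mu> (cball x r) = 0 then \<infinity> else ereal (ln (measure \<mu> (cball x r)) / ln r))"

definition lower_local_dim :: "real measure \<Rightarrow> real \<Rightarrow> ereal" where
  "lower_local_dim \<mu> x = Liminf (at_right 0) (log_ratio \<mu> x)"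

definition upper_local_dim :: "real measure \<Rightarrow> real \<Rightarrow> ereal" where
  "upper_local_dim \<mu> x = Limsup (at_right 0) (log_ratio \<mu> x)"

definition has_exact_dim :: "real measure \<Rightarrow> real \<Rightarrow> bool" where
  "has_exact_dim \<mu> c \<longleftrightarrow>
     (AE x in \<mu>. lower_local_dim \<mu> x = ereal c \<and> upper_local_dim \<mu> x = ereal c)"

definition exact_dimensional :: "real measure \<Rightarrow> bool" where
  "exact_dimensional \<mu> \<longleftrightarrow> (\<exists>c. has_exact_dim \<mu> c)"

text \<open>Meaningful for exact dimensional probability measures only.\<close>

definition dim_H :: "real measure \<Rightarrow> real" where
  "dim_H \<mu> = (THE c. has_exact_dim \<mu> c)"

definition ifs :: "real \<Rightarrow> real \<Rightarrow> real \<Rightarrow> (real \<Rightarrow> real) list" where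
  "ifs \<alpha> \<beta> \<gamma> = [\<lambda>x. \<alpha> * x, \<lambda>x. \<beta> * x, \<lambda>x. \<gamma> * x + 1 - \<gamma>]"

definition nu :: "real \<Rightarrow> real \<Rightarrow> real \<Rightarrow> real \<Rightarrow> real \<Rightarrow> real \<Rightarrow> real measure" where
  "nu p1 p2 p3 \<alpha> \<beta> \<gamma> = self_similar_measure (ifs \<alpha> \<beta> \<gamma>) [p1, p2, p3]"

text \<open>The summand for \<open>k = 0\<close> is an empty sum, so the series effectively starts at \<open>k = 1\<close>.\<close>

definition Phi :: "real \<Rightarrow> real \<Rightarrow> real \<Rightarrow> real" where
  "Phi p1 p2 p3 =
     (\<Sum>k. \<Sum>m=1..k. real ((k - 1) choose (m - 1)) * p3 * ln (real m / real k) *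
        (p1 ^ m * p2 ^ (k - m) + p1 ^ (k - m) * p2 ^ m))"

end

theory Submission
  imports Defs
begin

text \<open>The maps \<open>S\<^sub>1\<close> and \<open>S\<^sub>2\<close> fix the point \<open>0\<close> and commute, so a word of
\<open>a\<close> letters 1 and \<open>b\<close> letters 2, in any order, followed by a letter 3 acts as the single map
\<open>x \<mapsto> \<alpha>\<^sup>a \<beta>\<^sup>b (\<gamma> x + 1 - \<gamma>)\<close>.  An infinite word is thus read as a
sequence of independent blocks \<open>(a, b)\<close>, each with probability
\<open>q(a, b) = (a + b choose a) p\<^sub>1\<^sup>a p\<^sub>2\<^sup>b p\<^sub>3\<close>, and \<open>\<nu>\<close> is the law of the
corresponding coding map (\<open>nu_eq_distr_coding\<close>).  The exact overlaps have been absorbed in the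
binomial coefficient, which makes the dimension equal to the entropy of a block divided by its mean
logarithmic contraction.  The entropy of \<open>q\<close> is
\<open>(- \<Sum> p\<^sub>i log p\<^sub>i + \<Phi>) / p\<^sub>3\<close> (\<open>block_entropy_eq\<close>): the logarithms
\<open>log (m / k)\<close> in \<open>\<Phi>\<close> are differences of logarithms of binomial coefficients, and the
series telescopes.  The mean contraction is
\<open>- (p\<^sub>1 log \<alpha> + p\<^sub>2 log \<beta> + p\<^sub>3 log \<gamma>) / p\<^sub>3\<close>
(\<open>lyapunov_eq\<close>).

By the strong law of large numbers, a cylinder of \<open>n\<close> blocks has mass about
\<open>exp (- n H)\<close> and length about \<open>exp (- n L)\<close>, with \<open>H\<close> the entropy and \<open>L\<close> the
mean contraction.  A ball about a coded point that is longer than the cylinder contains it, which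
bounds the local dimension by \<open>H / L\<close> from above, for every \<open>\<alpha>\<close>.

The lower bound holds for almost every \<open>\<alpha>\<close>, by transversality.  If two sequences start with
different blocks, the logarithms of their coded points differ by \<open>(a - a') log \<alpha>\<close> plus terms
that move slowly with \<open>\<alpha>\<close>, because all the points \<open>\<gamma> x + 1 - \<gamma>\<close> lie in
\<open>[8/9, 1]\<close> and are Lipschitz in \<open>\<alpha>\<close> with a small constant; if \<open>a = a'\<close>, then
\<open>b \<noteq> b'\<close> and the points are far apart relative to their size.  Hence two such points are
within \<open>r\<close> of each other only for a set of parameters \<open>\<alpha> > \<alpha>\<^sub>0\<close> of measure at
most \<open>5 r / (\<alpha>\<^sub>0\<^sup>a \<beta>\<^sup>b)\<close> (\<open>transversality\<close>).  Fix a
typical sequence \<open>\<omega>\<close> and integrate over \<open>\<alpha>\<close> in \<open>(\<alpha>\<^sub>0, \<beta>)\<close> the mass of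
the sequences that leave \<open>\<omega>\<close> before time \<open>N\<close> but whose coded point lies within
\<open>exp (- N \<kappa>)\<close> of that of \<open>\<omega>\<close>, where \<open>\<kappa> > L(\<alpha>\<^sub>0)\<close>.  Since
\<open>H \<le> L\<close> (\<open>entropy_le_lyapunov\<close>), the result is \<open>O(N exp (- N h))\<close> for
\<open>h\<close> slightly below \<open>H\<close> (\<open>average_separated_mass\<close>,
\<open>AE_ball_mass_le_sequence\<close>), and summation over \<open>N\<close> shows that for almost every
\<open>\<alpha> > \<alpha>\<^sub>0\<close> the ball of radius \<open>exp (- N \<kappa>)\<close> eventually has mass at most
\<open>2 exp (- N h')\<close> for a given \<open>h' < h\<close>.  Letting \<open>\<alpha>\<^sub>0\<close> run through the
rationals below \<open>\<alpha>\<close> and using the continuity of \<open>L\<close> gives the matching bound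
\<open>H / L(\<alpha>)\<close>.\<close>

section \<open>Coding by blocks, and transversality in the first ratio\<close>

locale two_ratios =
  fixes \<beta> \<gamma> :: real
  assumes \<beta>: "0 < \<beta>" "\<beta> < 1 / 9" and \<gamma>: "0 < \<gamma>" "\<gamma> < 1 / 9"
begin

text \<open>A block \<open>(a, b)\<close> stands for all the words of \<open>a\<close> letters 1 and \<open>b\<close> letters 2,
followed by a letter 3.\<close>

definition block_ratio :: "real \<Rightarrow> nat \<times> nat \<Rightarrow> real" where
  "block_ratio \<alpha> x = \<alpha> ^ fst x * \<beta> ^ snd x"

definition cylinder_ratio :: "real \<Rightarrow> (nat \<Rightarrow> nat \<times> nat) \<Rightarrow> nat \<Rightarrow> real" where
  "cylinder_ratio \<alpha> \<omega> n = (\<Prod>i<n. \<gamma> * block_ratio \<alpha> (\<omega> i))"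

text \<open>The fixed-point expansion of the infinite composition of the block maps
\<open>x \<mapsto> c\<^sub>n (\<gamma> x + 1 - \<gamma>)\<close>, where \<open>c\<^sub>n\<close> is the ratio of the
\<open>n\<close>-th block.\<close>

definition coding :: "real \<Rightarrow> (nat \<Rightarrow> nat \<times> nat) \<Rightarrow> real" where
  "coding \<alpha> \<omega> = (\<Sum>n. cylinder_ratio \<alpha> \<omega> n * block_ratio \<alpha> (\<omega> n) * (1 - \<gamma>))"

lemma block_ratio_pos: "0 < \<alpha> \<Longrightarrow> 0 < block_ratio \<alpha> x"
  using \<beta> by (simp add: block_ratio_def)

lemma block_ratio_nonneg: "0 < \<alpha> \<Longrightarrow> 0 \<le> block_ratio \<alpha> x"
  using block_ratio_pos[of \<alpha> x] by simp

lemma block_ratio_le_1: "0 < \<alpha> \<Longrightarrow> \<alpha> < 1 / 9 \<Longrightarrow> block_ratio \<alpha> x \<le> 1"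
  using \<beta> by (simp add: block_ratio_def mult_le_one power_le_one)

lemma block_ratio_mono: "0 < \<alpha> \<Longrightarrow> \<alpha> \<le> \<alpha>' \<Longrightarrow> block_ratio \<alpha> x \<le> block_ratio \<alpha>' x"
  using \<beta> by (simp add: block_ratio_def power_mono)

lemma ln_block_ratio:
  "0 < \<alpha> \<Longrightarrow> ln (block_ratio \<alpha> x) = real (fst x) * ln \<alpha> + real (snd x) * ln \<beta>"
  using \<beta> by (simp add: block_ratio_def ln_mult ln_realpow)

lemma cylinder_ratio_Suc_shift:
  "cylinder_ratio \<alpha> \<omega> (Suc n) = \<gamma> * block_ratio \<alpha> (\<omega> 0) * cylinder_ratio \<alpha> (\<lambda>i. \<omega> (Suc i)) n"
  unfolding cylinder_ratio_def prod.lessThan_Suc_shift by simp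

lemma cylinder_ratio_Suc:
  "cylinder_ratio \<alpha> \<omega> (Suc n) = cylinder_ratio \<alpha> \<omega> n * (\<gamma> * block_ratio \<alpha> (\<omega> n))"
  unfolding cylinder_ratio_def by simp

lemma cylinder_ratio_pos: "0 < \<alpha> \<Longrightarrow> 0 < cylinder_ratio \<alpha> \<omega> n"
  using \<gamma> block_ratio_pos unfolding cylinder_ratio_def by (simp add: prod_pos)

lemma cylinder_ratio_le:
  assumes "0 < \<alpha>" "\<alpha> < 1 / 9"
  shows "cylinder_ratio \<alpha> \<omega> n \<le> \<gamma> ^ n"
proof -
  have "cylinder_ratio \<alpha> \<omega> n \<le> (\<Prod>i<n. \<gamma>)"
    unfolding cylinder_ratio_def
  proof (intro prod_mono conjI)
    fix i
    show "0 \<le> \<gamma> * block_ratio \<alpha> (\<omega> i)" using assms \<gamma> by (intro mult_nonneg_nonneg block_ratio_nonneg) auto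
    show "\<gamma> * block_ratio \<alpha> (\<omega> i) \<le> \<gamma>" using \<gamma> block_ratio_le_1[OF assms] by (intro mult_left_le) auto
  qed
  then show ?thesis by simp
qed

lemma cylinder_ratio_mono:
  assumes "0 < \<alpha>" "\<alpha> \<le> \<alpha>'"
  shows "cylinder_ratio \<alpha> \<omega> n \<le> cylinder_ratio \<alpha>' \<omega> n"
  unfolding cylinder_ratio_def using assms \<gamma> block_ratio_mono
  by (intro prod_mono conjI mult_left_mono mult_nonneg_nonneg block_ratio_nonneg) auto

lemma coding_term_le:
  assumes "0 < \<alpha>" "\<alpha> < 1 / 9"
  shows "cylinder_ratio \<alpha> \<omega> n * block_ratio \<alpha> (\<omega> n) * (1 - \<gamma>) \<le> \<gamma> ^ n * (1 - \<gamma>)"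
    "0 \<le> cylinder_ratio \<alpha> \<omega> n * block_ratio \<alpha> (\<omega> n) * (1 - \<gamma>)"
proof -
  have "cylinder_ratio \<alpha> \<omega> n * block_ratio \<alpha> (\<omega> n) \<le> \<gamma> ^ n * 1"
    using assms \<gamma> by (intro mult_mono cylinder_ratio_le block_ratio_le_1 block_ratio_nonneg) auto
  then show "cylinder_ratio \<alpha> \<omega> n * block_ratio \<alpha> (\<omega> n) * (1 - \<gamma>) \<le> \<gamma> ^ n * (1 - \<gamma>)"
    using \<gamma> by (intro mult_right_mono) auto
  show "0 \<le> cylinder_ratio \<alpha> \<omega> n * block_ratio \<alpha> (\<omega> n) * (1 - \<gamma>)"
    using assms(1) \<gamma> cylinder_ratio_pos[OF assms(1), of \<omega> n]
    by (intro mult_nonneg_nonneg block_ratio_nonneg) auto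
qed

lemma sums_geometric_\<gamma>: "(\<lambda>n. \<gamma> ^ n * (1 - \<gamma>)) sums 1"
  using sums_mult2[OF geometric_sums[of \<gamma>], of "1 - \<gamma>"] \<gamma> by simp

lemma summable_coding:
  assumes "0 < \<alpha>" "\<alpha> < 1 / 9"
  shows "summable (\<lambda>n. cylinder_ratio \<alpha> \<omega> n * block_ratio \<alpha> (\<omega> n) * (1 - \<gamma>))"
proof (rule summable_comparison_test')
  show "summable (\<lambda>n. \<gamma> ^ n * (1 - \<gamma>))" using sums_geometric_\<gamma> by (rule sums_summable)
  show "norm (cylinder_ratio \<alpha> \<omega> n * block_ratio \<alpha> (\<omega> n) * (1 - \<gamma>)) \<le> \<gamma> ^ n * (1 - \<gamma>)"
    if "0 \<le> n" for n
    using coding_term_le[OF assms, of \<omega> n] by (simp only: real_norm_def abs_of_nonneg)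
qed

lemma coding_nonneg: "0 < \<alpha> \<Longrightarrow> \<alpha> < 1 / 9 \<Longrightarrow> 0 \<le> coding \<alpha> \<omega>"
  unfolding coding_def by (intro suminf_nonneg summable_coding coding_term_le)

lemma coding_le_1:
  assumes "0 < \<alpha>" "\<alpha> < 1 / 9"
  shows "coding \<alpha> \<omega> \<le> 1"
proof -
  have "coding \<alpha> \<omega> \<le> (\<Sum>n. \<gamma> ^ n * (1 - \<gamma>))"
    unfolding coding_def using sums_geometric_\<gamma>
    by (intro suminf_le summable_coding coding_term_le assms) (rule sums_summable)
  also have "\<dots> = 1" using sums_geometric_\<gamma> by (rule sums_unique[symmetric])
  finally show ?thesis .
qed

lemma coding_Suc:
  assumes "0 < \<alpha>" "\<alpha> < 1 / 9"
  shows "coding \<alpha> \<omega> =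
    block_ratio \<alpha> (\<omega> 0) * (\<gamma> * coding \<alpha> (\<lambda>i. \<omega> (Suc i)) + 1 - \<gamma>)"
proof -
  let ?f = "\<lambda>\<omega> n. cylinder_ratio \<alpha> \<omega> n * block_ratio \<alpha> (\<omega> n) * (1 - \<gamma>)"
  have "coding \<alpha> \<omega> = (\<Sum>n. ?f \<omega> (Suc n)) + ?f \<omega> 0"
    unfolding coding_def using suminf_split_head[OF summable_coding[OF assms, of \<omega>]] by linarith
  also have "(\<Sum>n. ?f \<omega> (Suc n)) =
      (\<Sum>n. \<gamma> * block_ratio \<alpha> (\<omega> 0) * ?f (\<lambda>i. \<omega> (Suc i)) n)"
    by (simp add: cylinder_ratio_Suc_shift mult_ac)
  also have "\<dots> = \<gamma> * block_ratio \<alpha> (\<omega> 0) * coding \<alpha> (\<lambda>i. \<omega> (Suc i))"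
    unfolding coding_def using summable_coding[OF assms] by (rule suminf_mult)
  finally have "coding \<alpha> \<omega> =
      \<gamma> * block_ratio \<alpha> (\<omega> 0) * coding \<alpha> (\<lambda>i. \<omega> (Suc i)) + ?f \<omega> 0" .
  moreover have "?f \<omega> 0 = block_ratio \<alpha> (\<omega> 0) * (1 - \<gamma>)"
    by (simp add: cylinder_ratio_def)
  moreover have "\<gamma> * c * x + c * (1 - \<gamma>) = c * (\<gamma> * x + 1 - \<gamma>)" for c x
    by (simp add: algebra_simps)
  ultimately show ?thesis by (simp only:)
qed

lemma coding_diff_common_prefix:
  assumes "0 < \<alpha>" "\<alpha> < 1 / 9" "\<And>i. i < n \<Longrightarrow> \<omega> i = \<tau> i"
  shows "coding \<alpha> \<omega> - coding \<alpha> \<tau> =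
    cylinder_ratio \<alpha> \<omega> n * (coding \<alpha> (\<lambda>i. \<omega> (n + i)) - coding \<alpha> (\<lambda>i. \<tau> (n + i)))"
  using assms(3)
proof (induction n arbitrary: \<omega> \<tau>)
  case 0
  then show ?case by (simp add: cylinder_ratio_def)
next
  case (Suc n)
  have "coding \<alpha> \<omega> - coding \<alpha> \<tau> = \<gamma> * block_ratio \<alpha> (\<omega> 0) *
      (coding \<alpha> (\<lambda>i. \<omega> (Suc i)) - coding \<alpha> (\<lambda>i. \<tau> (Suc i)))"
    using coding_Suc[OF assms(1,2), of \<omega>] coding_Suc[OF assms(1,2), of \<tau>] Suc.prems[of 0]
    by (simp add: algebra_simps)
  also have "coding \<alpha> (\<lambda>i. \<omega> (Suc i)) - coding \<alpha> (\<lambda>i. \<tau> (Suc i)) =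
      cylinder_ratio \<alpha> (\<lambda>i. \<omega> (Suc i)) n *
      (coding \<alpha> (\<lambda>i. \<omega> (Suc (n + i))) - coding \<alpha> (\<lambda>i. \<tau> (Suc (n + i))))"
    using Suc.IH[of "\<lambda>i. \<omega> (Suc i)" "\<lambda>i. \<tau> (Suc i)"] Suc.prems by simp
  finally show ?case by (simp add: cylinder_ratio_Suc_shift mult_ac)
qed

text \<open>The derivative \<open>n x\<^sup>n\<^sup>-\<^sup>1\<close> of a power stays at most 1 on \<open>(0, 1/9)\<close>.\<close>

lemma power_diff_le_small:
  fixes x y :: real
  assumes "0 < x" "x < 1 / 9" "0 < y" "y < 1 / 9"
  shows "\<bar>x ^ n - y ^ n\<bar> \<le> \<bar>x - y\<bar>"
proof -
  have "\<bar>x ^ n - y ^ n\<bar> \<le> \<bar>x - y\<bar> \<and> \<bar>x ^ n\<bar> \<le> 1"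
  proof (induction n)
    case (Suc n)
    have "x ^ Suc n - y ^ Suc n = (x - y) * x ^ n + y * (x ^ n - y ^ n)"
      by (simp add: algebra_simps)
    show ?case
    proof (cases n)
      case (Suc k)
      have xn: "x ^ n \<le> x" using assms Suc by (simp add: power_le_one mult_left_le)
      have "\<bar>x ^ Suc n - y ^ Suc n\<bar> \<le> \<bar>(x - y) * x ^ n\<bar> + \<bar>y * (x ^ n - y ^ n)\<bar>"
        by (simp only: \<open>x ^ Suc n - y ^ Suc n = _\<close> abs_triangle_ineq)
      also have "\<dots> \<le> \<bar>x - y\<bar> * (1 / 9) + (1 / 9) * \<bar>x - y\<bar>"
        unfolding abs_mult using assms xn Suc.IH by (intro add_mono mult_mono) auto
      also have "\<dots> \<le> \<bar>x - y\<bar>" by simp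
      finally show ?thesis using assms power_le_one[of x "Suc n"] by (simp only:) simp
    qed (use assms in auto)
  qed simp
  then show ?thesis by simp
qed

text \<open>The recursion for the coded point gives \<open>D \<le> 1 + D / 9\<close> for the Lipschitz constant
\<open>D\<close>, hence \<open>9/8\<close>.  As a finite \<open>D\<close> is not known in advance, the recursion is
iterated from the trivial bound 1 on the difference.\<close>

lemma coding_lipschitz:
  assumes "0 < \<alpha>" "\<alpha> < 1 / 9" "0 < \<alpha>'" "\<alpha>' < 1 / 9"
  shows "\<bar>coding \<alpha> \<omega> - coding \<alpha>' \<omega>\<bar> \<le> 9 / 8 * \<bar>\<alpha> - \<alpha>'\<bar>"
proof -
  have approx: "\<bar>coding \<alpha> \<omega> - coding \<alpha>' \<omega>\<bar> \<le> 9 / 8 * \<bar>\<alpha> - \<alpha>'\<bar> + (1 / 9) ^ n" for n \<omega>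
  proof (induction n arbitrary: \<omega>)
    case 0
    have "\<bar>coding \<alpha> \<omega> - coding \<alpha>' \<omega>\<bar> \<le> 1"
      using coding_nonneg[of \<alpha> \<omega>] coding_nonneg[of \<alpha>' \<omega>] coding_le_1[of \<alpha> \<omega>] coding_le_1[of \<alpha>' \<omega>] assms
      by linarith
    moreover have "0 \<le> 9 / 8 * \<bar>\<alpha> - \<alpha>'\<bar>" by simp
    ultimately show ?case unfolding power_0 by linarith
  next
    case (Suc n)
    let ?x = "coding \<alpha> (\<lambda>i. \<omega> (Suc i))" and ?x' = "coding \<alpha>' (\<lambda>i. \<omega> (Suc i))"
    let ?c = "block_ratio \<alpha> (\<omega> 0)" and ?c' = "block_ratio \<alpha>' (\<omega> 0)"
    have x: "0 \<le> ?x" "?x \<le> 1" using coding_nonneg coding_le_1 assms by auto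
    have y: "0 \<le> \<gamma> * ?x + 1 - \<gamma>" "\<gamma> * ?x + 1 - \<gamma> \<le> 1"
      using x \<gamma> mult_left_mono[OF x(2), of \<gamma>] mult_nonneg_nonneg[of \<gamma> ?x] by linarith+
    have c: "\<bar>?c - ?c'\<bar> \<le> \<bar>\<alpha> - \<alpha>'\<bar>"
    proof -
      have "\<bar>?c - ?c'\<bar> = \<bar>\<alpha> ^ fst (\<omega> 0) - \<alpha>' ^ fst (\<omega> 0)\<bar> * \<beta> ^ snd (\<omega> 0)"
        using \<beta> by (simp add: block_ratio_def abs_mult left_diff_distrib[symmetric])
      also have "\<dots> \<le> \<bar>\<alpha> - \<alpha>'\<bar> * 1"
        using assms \<beta> by (intro mult_mono power_diff_le_small power_le_one) auto
      finally show ?thesis by simp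
    qed
    have "coding \<alpha> \<omega> - coding \<alpha>' \<omega> = (?c - ?c') * (\<gamma> * ?x + 1 - \<gamma>) + ?c' * \<gamma> * (?x - ?x')"
      using coding_Suc[of \<alpha> \<omega>] coding_Suc[of \<alpha>' \<omega>] assms by (simp add: algebra_simps)
    then have "\<bar>coding \<alpha> \<omega> - coding \<alpha>' \<omega>\<bar> \<le>
        \<bar>?c - ?c'\<bar> * \<bar>\<gamma> * ?x + 1 - \<gamma>\<bar> + \<bar>?c' * \<gamma>\<bar> * \<bar>?x - ?x'\<bar>"
      by (metis abs_mult abs_triangle_ineq)
    also have "\<dots> \<le> \<bar>\<alpha> - \<alpha>'\<bar> * 1 + (1 * (1 / 9)) * (9 / 8 * \<bar>\<alpha> - \<alpha>'\<bar> + (1 / 9) ^ n)"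
    proof (intro add_mono mult_mono c Suc.IH)
      have "?c' * \<gamma> \<le> 1 * (1 / 9)"
        using assms \<gamma> block_ratio_le_1[of \<alpha>' "\<omega> 0"] by (intro mult_mono) auto
      then show "\<bar>?c' * \<gamma>\<bar> \<le> 1 * (1 / 9)"
        using block_ratio_pos[of \<alpha>' "\<omega> 0"] assms \<gamma> by (simp add: abs_mult)
    qed (use y in auto)
    finally show ?case by (simp add: algebra_simps)
  qed
  have "(\<lambda>n. 9 / 8 * \<bar>\<alpha> - \<alpha>'\<bar> + (1 / 9 :: real) ^ n) \<longlonglongrightarrow> 9 / 8 * \<bar>\<alpha> - \<alpha>'\<bar> + 0"
    by (intro tendsto_intros LIMSEQ_realpow_zero) auto
  from LIMSEQ_le_const[OF this] approx show ?thesis by auto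
qed

lemma abs_ln_diff_le:
  fixes x y m :: real
  assumes "0 < m" "m \<le> x" "m \<le> y"
  shows "\<bar>ln x - ln y\<bar> \<le> \<bar>x - y\<bar> / m"
proof -
  have *: "\<bar>ln x - ln y\<bar> \<le> \<bar>x - y\<bar> / m" if "m \<le> y" "y \<le> x" for x y
  proof -
    have "ln x - ln y = ln (1 + (x - y) / y)"
      using that assms by (simp add: ln_divide_pos[symmetric] diff_divide_distrib)
    also have "\<dots> \<le> (x - y) / y" using that assms by (intro ln_add_one_self_le_self) auto
    also have "\<dots> \<le> (x - y) / m" using that assms by (intro divide_left_mono) auto
    finally show ?thesis using that assms by simp
  qed
  show ?thesis
    using *[of y x] *[of x y] assms by (cases "y \<le> x") (auto simp: abs_minus_commute)
qed

text \<open>The coded point is the ratio of the first block times this factor, which lies in \<open>(8/9, 1]\<close>.\<close>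

definition tail_factor :: "real \<Rightarrow> (nat \<Rightarrow> nat \<times> nat) \<Rightarrow> real" where
  "tail_factor \<alpha> \<omega> = \<gamma> * coding \<alpha> (\<lambda>i. \<omega> (Suc i)) + 1 - \<gamma>"

lemma ln_coding:
  assumes "0 < \<alpha>" "\<alpha> < 1 / 9"
  shows "8 / 9 < tail_factor \<alpha> \<omega>" "tail_factor \<alpha> \<omega> \<le> 1"
    "ln (coding \<alpha> \<omega>) = real (fst (\<omega> 0)) * ln \<alpha> + real (snd (\<omega> 0)) * ln \<beta> + ln (tail_factor \<alpha> \<omega>)"
proof -
  let ?x = "coding \<alpha> (\<lambda>i. \<omega> (Suc i))"
  have x: "0 \<le> ?x" "?x \<le> 1" using coding_nonneg coding_le_1 assms by auto
  show y: "8 / 9 < tail_factor \<alpha> \<omega>" "tail_factor \<alpha> \<omega> \<le> 1"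
    unfolding tail_factor_def using x \<gamma> mult_left_mono[OF x(2), of \<gamma>] mult_nonneg_nonneg[of \<gamma> ?x] by linarith+
  have "coding \<alpha> \<omega> = block_ratio \<alpha> (\<omega> 0) * tail_factor \<alpha> \<omega>"
    unfolding tail_factor_def by (rule coding_Suc[OF assms(1,2)])
  then show "ln (coding \<alpha> \<omega>) = real (fst (\<omega> 0)) * ln \<alpha> + real (snd (\<omega> 0)) * ln \<beta> + ln (tail_factor \<alpha> \<omega>)"
    using y block_ratio_pos[OF assms(1), of "\<omega> 0"] ln_block_ratio[OF assms(1)] by (simp add: ln_mult)
qed

text \<open>The main term of the difference of logarithms is \<open>(a - a') ln \<alpha>\<close>, which moves at speed at
least 9 because \<open>\<alpha> < 1/9\<close>; the logarithm of each tail factor moves at speed at most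
\<open>(1/9) (9/8) (9/8) = 9/64\<close>.\<close>

lemma ln_coding_diff_expanding:
  assumes "0 < \<alpha>" "\<alpha> < 1 / 9" "0 < \<alpha>'" "\<alpha>' < 1 / 9" "fst (\<omega> 0) \<noteq> fst (\<tau> 0)"
  defines "F \<equiv> \<lambda>\<alpha>. ln (coding \<alpha> \<omega>) - ln (coding \<alpha> \<tau>)"
  shows "8 * \<bar>\<alpha> - \<alpha>'\<bar> \<le> \<bar>F \<alpha> - F \<alpha>'\<bar>"
proof -
  note L = ln_coding
  have ly: "\<bar>ln (tail_factor \<alpha> \<rho>) - ln (tail_factor \<alpha>' \<rho>)\<bar> \<le> 9 / 64 * \<bar>\<alpha> - \<alpha>'\<bar>" for \<rho> :: "nat \<Rightarrow> nat \<times> nat"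
  proof -
    have "\<bar>ln (tail_factor \<alpha> \<rho>) - ln (tail_factor \<alpha>' \<rho>)\<bar> \<le> \<bar>tail_factor \<alpha> \<rho> - tail_factor \<alpha>' \<rho>\<bar> / (8 / 9)"
      using L(1)[of \<alpha> \<rho>] L(1)[of \<alpha>' \<rho>] assms by (intro abs_ln_diff_le) auto
    also have "\<bar>tail_factor \<alpha> \<rho> - tail_factor \<alpha>' \<rho>\<bar> = \<gamma> * \<bar>coding \<alpha> (\<lambda>i. \<rho> (Suc i)) - coding \<alpha>' (\<lambda>i. \<rho> (Suc i))\<bar>"
      using \<gamma> by (simp add: tail_factor_def abs_mult right_diff_distrib[symmetric])
    also have "\<dots> \<le> (1 / 9) * (9 / 8 * \<bar>\<alpha> - \<alpha>'\<bar>)"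
      using coding_lipschitz[of \<alpha> \<alpha>'] assms \<gamma> by (intro mult_mono) auto
    finally show ?thesis by simp
  qed
  define k where "k = real (fst (\<omega> 0)) - real (fst (\<tau> 0))"
  have k: "1 \<le> \<bar>k\<bar>" using assms(5) unfolding k_def by linarith
  have "\<bar>\<alpha> - \<alpha>'\<bar> * 9 \<le> \<bar>ln \<alpha> - ln \<alpha>'\<bar>"
  proof -
    have *: "(a - b) * 9 \<le> ln a - ln b" if "0 < b" "b \<le> a" "a < 1 / 9" for a b :: real
    proof -
      have "ln (b / a) \<le> b / a - 1" using that by (intro ln_le_minus_one) auto
      then have "(a - b) / a \<le> ln a - ln b"
        using that by (simp add: ln_div diff_divide_distrib)
      moreover have "(a - b) * 9 \<le> (a - b) / a"
        using that mult_left_mono[of 9 "1 / a" "a - b"] by (simp add: field_simps)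
      ultimately show ?thesis by linarith
    qed
    show ?thesis
    proof (cases "\<alpha>' \<le> \<alpha>")
      case True
      then show ?thesis using *[of \<alpha>' \<alpha>] assms by linarith
    next
      case False
      then have "(\<alpha>' - \<alpha>) * 9 \<le> ln \<alpha>' - ln \<alpha>" using * assms by auto
      then show ?thesis using False by simp
    qed
  qed
  also have "\<bar>ln \<alpha> - ln \<alpha>'\<bar> \<le> \<bar>k\<bar> * \<bar>ln \<alpha> - ln \<alpha>'\<bar>" using k by (simp add: mult_le_cancel_right1)
  also have "\<bar>k\<bar> * \<bar>ln \<alpha> - ln \<alpha>'\<bar> = \<bar>k * ln \<alpha> - k * ln \<alpha>'\<bar>"
    by (simp add: abs_mult right_diff_distrib[symmetric])
  also have "k * ln \<alpha> - k * ln \<alpha>' =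
      (F \<alpha> - F \<alpha>') - (ln (tail_factor \<alpha> \<omega>) - ln (tail_factor \<alpha>' \<omega>)) + (ln (tail_factor \<alpha> \<tau>) - ln (tail_factor \<alpha>' \<tau>))"
    unfolding F_def k_def using assms by (simp add: L(3) algebra_simps)
  finally show ?thesis using ly[of \<omega>] ly[of \<tau>] by linarith
qed

text \<open>With equally many letters 1, the ratios of the two first blocks differ by a factor of at least 9,
which the tail factors cannot compensate.\<close>

lemma ln_coding_diff_large:
  assumes "0 < \<alpha>" "\<alpha> < 1 / 9" "fst (\<omega> 0) = fst (\<tau> 0)" "snd (\<omega> 0) \<noteq> snd (\<tau> 0)"
  shows "1 \<le> \<bar>ln (coding \<alpha> \<omega>) - ln (coding \<alpha> \<tau>)\<bar>"
proof -
  note L = ln_coding[OF assms(1,2)]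
  define k where "k = real (snd (\<omega> 0)) - real (snd (\<tau> 0))"
  have k: "1 \<le> \<bar>k\<bar>" using assms(4) unfolding k_def by linarith
  have "ln (1 / 9) \<ge> ln \<beta>" using \<beta> by (intro ln_mono) auto
  moreover have "exp (2::real) \<le> 9"
    using exp_le power_mono[of "exp 1 :: real" 3 2] by (simp add: exp_of_nat_mult[of 2 1, simplified])
  then have "2 \<le> ln (9::real)" by (simp add: ln_ge_iff)
  ultimately have "2 \<le> \<bar>ln \<beta>\<bar>" by (simp add: ln_div)
  then have "2 \<le> \<bar>k * ln \<beta>\<bar>" using k mult_mono[of 1 "\<bar>k\<bar>" 2 "\<bar>ln \<beta>\<bar>"] by (simp add: abs_mult)
  moreover have ly: "\<bar>ln (tail_factor \<alpha> \<rho>)\<bar> \<le> 1 / 8" for \<rho>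
  proof -
    have "\<bar>ln (tail_factor \<alpha> \<rho>) - ln 1\<bar> \<le> \<bar>tail_factor \<alpha> \<rho> - 1\<bar> / (8 / 9)"
      using L(1,2)[of \<rho>] by (intro abs_ln_diff_le) auto
    then show ?thesis using L(1,2)[of \<rho>] by simp
  qed
  moreover have "ln (coding \<alpha> \<omega>) - ln (coding \<alpha> \<tau>) = k * ln \<beta> + ln (tail_factor \<alpha> \<omega>) - ln (tail_factor \<alpha> \<tau>)"
    unfolding k_def L(3) using assms(3) by (simp add: algebra_simps)
  ultimately show ?thesis using ly[of \<omega>] ly[of \<tau>] by linarith
qed

end

lemma emeasure_lborel_le_diameter:
  fixes A :: "real set"
  assumes "A \<in> sets borel" "\<And>x y. x \<in> A \<Longrightarrow> y \<in> A \<Longrightarrow> \<bar>x - y\<bar> \<le> d"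
  shows "emeasure lborel A \<le> ennreal (2 * d)"
proof (cases "A = {}")
  case False
  then obtain x where x: "x \<in> A" by auto
  then have d: "0 \<le> d" using assms(2)[of x x] by simp
  have "A \<subseteq> {x - d..x + d}" using assms(2)[OF x] by (force simp: abs_le_iff)
  then have "emeasure lborel A \<le> emeasure lborel {x - d..x + d}" by (intro emeasure_mono) auto
  also have "\<dots> = ennreal (2 * d)" using d by simp
  finally show ?thesis .
qed simp

context two_ratios
begin

text \<open>If \<open>r\<close> is not small compared with the ratio of the first block, the trivial bound 1 on the
length of the parameter interval suffices.  Otherwise closeness of the two points makes the difference
of their logarithms small, and that difference is an expanding function of \<open>\<alpha>\<close> or is never
small.\<close>

lemma transversality:
  assumes "0 < \<alpha>\<^sub>0" "\<alpha>\<^sub>0 < \<beta>" "\<omega> 0 \<noteq> \<tau> 0" "0 \<le> r"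
    and A: "A \<in> sets borel" "A \<subseteq> {\<alpha>\<^sub>0<..<\<beta>}" "\<And>\<alpha>. \<alpha> \<in> A \<Longrightarrow> \<bar>coding \<alpha> \<omega> - coding \<alpha> \<tau>\<bar> \<le> r"
  shows "emeasure lborel A \<le> ennreal (5 * r / block_ratio \<alpha>\<^sub>0 (\<omega> 0))"
proof -
  define c where "c = block_ratio \<alpha>\<^sub>0 (\<omega> 0)"
  \<comment> \<open>Both points are at least \<open>4c/9\<close> when they are close, so \<open>s\<close> bounds the difference of their logarithms.\<close>
  define s where "s = 9 / 4 * (r / c)"
  define F where "F = (\<lambda>\<alpha>. ln (coding \<alpha> \<omega>) - ln (coding \<alpha> \<tau>))"
  have c: "0 < c" unfolding c_def using assms by (intro block_ratio_pos)
  have s: "0 \<le> s" unfolding s_def using c assms by simp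
  have diam: "\<bar>a - b\<bar> \<le> 1 * min 1 s" if "a \<in> A" "b \<in> A" for a b
  proof (cases "1 \<le> s")
    case True
    moreover have "a \<in> {\<alpha>\<^sub>0<..<\<beta>}" "b \<in> {\<alpha>\<^sub>0<..<\<beta>}" using that A(2) by auto
    then have "\<bar>a - b\<bar> \<le> 1" using \<beta> assms(1) by (auto simp: abs_le_iff)
    ultimately show ?thesis by simp
  next
    case False
    then have r: "r < 4 / 9 * c" unfolding s_def using c by (simp add: field_simps)
    have rng: "0 < \<alpha>" "\<alpha> < 1 / 9" "\<alpha>\<^sub>0 < \<alpha>" if "\<alpha> \<in> A" for \<alpha>
      using that A(2) \<beta> assms(1) by (auto simp: subset_iff)
    have Fs: "\<bar>F \<alpha>\<bar> \<le> s" if "\<alpha> \<in> A" for \<alpha>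
    proof -
      have "c * (8 / 9) \<le> block_ratio \<alpha> (\<omega> 0) * tail_factor \<alpha> \<omega>"
        unfolding c_def using rng[OF that] ln_coding(1)[of \<alpha> \<omega>] assms(1)
          block_ratio_mono[of \<alpha>\<^sub>0 \<alpha> "\<omega> 0"] block_ratio_pos[of \<alpha> "\<omega> 0"]
        by (intro mult_mono) auto
      then have w: "c * (8 / 9) \<le> coding \<alpha> \<omega>" using coding_Suc[of \<alpha> \<omega>] rng[OF that] by (simp add: tail_factor_def)
      then have "c * (4 / 9) \<le> coding \<alpha> \<tau>" using A(3)[OF that] r by linarith
      then have "\<bar>F \<alpha>\<bar> \<le> \<bar>coding \<alpha> \<omega> - coding \<alpha> \<tau>\<bar> / (c * (4 / 9))"
        unfolding F_def using w c by (intro abs_ln_diff_le) auto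
      also have "\<dots> \<le> r / (c * (4 / 9))" using A(3)[OF that] c by (intro divide_right_mono) auto
      also have "\<dots> = s" by (simp add: s_def)
      finally show ?thesis .
    qed
    show ?thesis
    proof (cases "fst (\<omega> 0) = fst (\<tau> 0)")
      case True
      then have "snd (\<omega> 0) \<noteq> snd (\<tau> 0)" using assms(3) by (metis prod_eqI)
      then have "1 \<le> \<bar>F a\<bar>"
        unfolding F_def using True rng[OF that(1)] by (intro ln_coding_diff_large) auto
      then show ?thesis using Fs[OF that(1)] False by simp
    next
      case neq: False
      have "8 * \<bar>a - b\<bar> \<le> \<bar>F a - F b\<bar>"
        unfolding F_def using rng[OF that(1)] rng[OF that(2)] neq
        by (intro ln_coding_diff_expanding) auto
      moreover have "\<bar>F a - F b\<bar> \<le> \<bar>F a\<bar> + \<bar>F b\<bar>" by (rule abs_triangle_ineq4)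
      ultimately have "8 * \<bar>a - b\<bar> \<le> 2 * s" using Fs[OF that(1)] Fs[OF that(2)] by linarith
      then show ?thesis using s False by simp
    qed
  qed
  have "emeasure lborel A \<le> ennreal (2 * (1 * min 1 s))"
    by (rule emeasure_lborel_le_diameter[OF A(1) diam])
  also have "\<dots> \<le> ennreal (5 * r / c)"
    unfolding s_def using c assms(4) by (intro ennreal_leI) (simp add: min_def field_simps)
  finally show ?thesis by (simp add: c_def)
qed

end

section \<open>The distribution of a block\<close>

locale weights =
  fixes p1 p2 p3 :: real
  assumes p_pos: "0 < p1" "0 < p2" "0 < p3" and p_sum: "p1 + p2 + p3 = 1"
begin

text \<open>The number \<open>k\<close> of letters before the first letter 3 is geometric, and given \<open>k\<close> the
number of letters 1 among them is binomial.\<close>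

definition block_pmf :: "(nat \<times> nat) pmf" where
  "block_pmf = bind_pmf (geometric_pmf p3)
     (\<lambda>k. map_pmf (\<lambda>m. (m, k - m)) (binomial_pmf k (p1 / (p1 + p2))))"

lemma letter_one_probability: "0 < p1 / (p1 + p2)" "p1 / (p1 + p2) < 1" "1 - p1 / (p1 + p2) = p2 / (p1 + p2)"
  and letter_three_probability: "0 < p3" "p3 < 1" "1 - p3 = p1 + p2"
  using p_pos p_sum by (auto simp: field_simps)

lemma weight_regroup:
  assumes "m \<le> k"
  shows "(1 - p3) ^ k * p3 * (real (k choose m) * (p1 / (p1 + p2)) ^ m * (1 - p1 / (p1 + p2)) ^ (k - m))
    = real (k choose m) * p1 ^ m * p2 ^ (k - m) * p3"
proof -
  have "(p1 + p2) ^ k = (p1 + p2) ^ m * (p1 + p2) ^ (k - m)"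
    using assms by (simp add: power_add[symmetric])
  then show ?thesis
    using p_pos unfolding letter_one_probability(3) letter_three_probability(3) by (simp add: power_divide field_simps)
qed

lemma pmf_block:
  "pmf block_pmf (a, b) = real ((a + b) choose a) * p1 ^ a * p2 ^ b * p3"
proof -
  let ?\<theta> = "p1 / (p1 + p2)"
  have *: "pmf (map_pmf (\<lambda>m. (m, k - m)) (binomial_pmf k ?\<theta>)) (a, b) =
      pmf (binomial_pmf k ?\<theta>) a * indicator {a + b} k" for k
  proof (cases "k = a + b")
    case True
    have "pmf (map_pmf (\<lambda>m. (m, k - m)) (binomial_pmf k ?\<theta>)) ((\<lambda>m. (m, k - m)) a) =
        pmf (binomial_pmf k ?\<theta>) a"
      by (rule pmf_map_inj') (auto simp: inj_on_def)
    then show ?thesis using True by simp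
  next
    case False
    then show ?thesis
      using letter_one_probability by (auto intro!: pmf_map_outside)
  qed
  have "ennreal (pmf block_pmf (a, b)) =
      (\<integral>\<^sup>+k. ennreal (pmf (binomial_pmf k ?\<theta>) a) * indicator {a + b} k \<partial>geometric_pmf p3)"
    unfolding block_pmf_def ennreal_pmf_bind
    by (intro nn_integral_cong) (simp add: * indicator_def)
  also have "\<dots> = (\<integral>\<^sup>+k. ennreal (pmf (binomial_pmf (a + b) ?\<theta>) a) * indicator {a + b} k \<partial>geometric_pmf p3)"
    by (intro nn_integral_cong) (simp add: indicator_def)
  also have "\<dots> = ennreal (pmf (binomial_pmf (a + b) ?\<theta>) a) * ennreal (pmf (geometric_pmf p3) (a + b))"
    by (simp add: nn_integral_cmult_indicator emeasure_pmf_single)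
  also have "\<dots> = ennreal (real ((a + b) choose a) * p1 ^ a * p2 ^ b * p3)"
    using weight_regroup[of a "a + b"] letter_one_probability letter_three_probability
    by (simp add: ennreal_mult[symmetric] mult_ac)
  finally show ?thesis using p_pos by (subst (asm) ennreal_inj) auto
qed

lemma pmf_block_pos: "0 < pmf block_pmf x"
  using p_pos by (cases x) (simp add: pmf_block zero_less_binomial_iff)

text \<open>Conditioning on the first letter of the word: a letter 3 ends the block, and a letter 1 or 2 is
followed by a word with the same law.  For the binomial coefficients this is Pascal's rule.\<close>

lemma pmf_block_Pascal:
  "pmf block_pmf x = p3 * pmf (return_pmf (0, 0)) x
     + p1 * pmf (map_pmf (\<lambda>(a, b). (Suc a, b)) block_pmf) x
     + p2 * pmf (map_pmf (\<lambda>(a, b). (a, Suc b)) block_pmf) x"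
proof -
  obtain a b where x: "x = (a, b)" by (cases x)
  have l: "pmf (map_pmf (\<lambda>(a, b). (Suc a, b)) block_pmf) (a, b) =
      (case a of 0 \<Rightarrow> 0 | Suc a' \<Rightarrow> pmf block_pmf (a', b))"
  proof (cases a)
    case (Suc a')
    then show ?thesis
      using pmf_map_inj'[of "\<lambda>(a, b). (Suc a, b)" block_pmf "(a', b)"] by (auto simp: inj_on_def)
  qed (auto intro!: pmf_map_outside)
  have r: "pmf (map_pmf (\<lambda>(a, b). (a, Suc b)) block_pmf) (a, b) =
      (case b of 0 \<Rightarrow> 0 | Suc b' \<Rightarrow> pmf block_pmf (a, b'))"
  proof (cases b)
    case (Suc b')
    then show ?thesis
      using pmf_map_inj'[of "\<lambda>(a, b). (a, Suc b)" block_pmf "(a, b')"] by (auto simp: inj_on_def)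
  qed (auto intro!: pmf_map_outside)
  show ?thesis
    unfolding x l r
    by (cases a; cases b) (simp_all add: pmf_block pmf_return algebra_simps)
qed

lemma nn_integral_block_Pascal:
  "(\<integral>\<^sup>+x. G x \<partial>block_pmf) = ennreal p3 * G (0, 0)
     + ennreal p1 * (\<integral>\<^sup>+(a, b). G (Suc a, b) \<partial>block_pmf)
     + ennreal p2 * (\<integral>\<^sup>+(a, b). G (a, Suc b) \<partial>block_pmf)"
proof -
  let ?N = "\<lambda>p. \<integral>\<^sup>+x. ennreal (pmf p x) * G x \<partial>count_space UNIV"
  let ?l = "map_pmf (\<lambda>(a, b). (Suc a, b)) block_pmf" and ?r = "map_pmf (\<lambda>(a, b). (a, Suc b)) block_pmf"
  have "(\<integral>\<^sup>+x. G x \<partial>block_pmf) = (\<integral>\<^sup>+x. ennreal p3 * (ennreal (pmf (return_pmf (0, 0)) x) * G x)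
      + ennreal p1 * (ennreal (pmf ?l x) * G x) + ennreal p2 * (ennreal (pmf ?r x) * G x) \<partial>count_space UNIV)"
    unfolding nn_integral_measure_pmf
    using p_pos by (intro nn_integral_cong, subst pmf_block_Pascal)
      (simp add: ennreal_mult ennreal_plus pmf_nonneg distrib_right mult.assoc)
  also have "\<dots> = ennreal p3 * ?N (return_pmf (0, 0)) + ennreal p1 * ?N ?l + ennreal p2 * ?N ?r"
    by (simp add: nn_integral_add nn_integral_cmult)
  also have "\<dots> = ennreal p3 * (\<integral>\<^sup>+x. G x \<partial>return_pmf (0, 0)) + ennreal p1 * (\<integral>\<^sup>+x. G x \<partial>?l)
      + ennreal p2 * (\<integral>\<^sup>+x. G x \<partial>?r)"
    by (simp only: nn_integral_measure_pmf)
  finally show ?thesis by (simp add: nn_integral_return_pmf case_prod_unfold)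
qed

text \<open>All the observables of a block that occur below grow at most linearly in its length, and hence have
exponential moments.\<close>

definition linear_growth :: "(nat \<times> nat \<Rightarrow> real) \<Rightarrow> bool" where
  "linear_growth f \<longleftrightarrow> (\<exists>K. \<forall>x. \<bar>f x\<bar> \<le> K * (1 + real (fst x + snd x)))"

lemma nn_integral_block_length:
  "(\<integral>\<^sup>+x. g (fst x + snd x) \<partial>block_pmf) = (\<integral>\<^sup>+k. g k \<partial>geometric_pmf p3)"
proof -
  have "(\<integral>\<^sup>+m. g (m + (k - m)) \<partial>binomial_pmf k (p1 / (p1 + p2))) = (\<integral>\<^sup>+m. g k \<partial>binomial_pmf k (p1 / (p1 + p2)))" for k
    using letter_one_probability by (intro nn_integral_cong_AE) (auto simp: AE_measure_pmf_iff)
  then show ?thesis unfolding block_pmf_def by simp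
qed

lemma exponential_moment_block_length:
  "\<exists>s>0. integrable block_pmf (\<lambda>x. exp (s * (1 + real (fst x + snd x))))"
proof -
  obtain s where s: "0 < s" "exp s * (1 - p3) < 1"
  proof -
    have lim: "((\<lambda>s. exp s * (1 - p3)) \<longlongrightarrow> exp 0 * (1 - p3)) (at_right 0)"
      by (intro tendsto_intros)
    have "exp 0 * (1 - p3) < 1" using letter_three_probability(1) by simp
    from order_tendstoD(2)[OF lim this]
    have "eventually (\<lambda>s. exp s * (1 - p3) < 1) (at_right 0)" .
    then have "eventually (\<lambda>s. 0 < s \<and> exp s * (1 - p3) < 1) (at_right (0::real))"
      by (intro eventually_conj eventually_at_right_less)
    from eventually_happens'[OF trivial_limit_at_right_real this]
    obtain s :: real where "0 < s \<and> exp s * (1 - p3) < 1" by blast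
    then show thesis using that by blast
  qed
  have "(\<integral>\<^sup>+x. ennreal (exp (s * (1 + real (fst x + snd x)))) \<partial>block_pmf) =
      (\<integral>\<^sup>+k. ennreal (exp (s * (1 + real k))) \<partial>geometric_pmf p3)"
    by (rule nn_integral_block_length)
  also have "\<dots> = (\<Sum>k. ennreal (exp s * p3 * (exp s * (1 - p3)) ^ k))"
    unfolding nn_integral_measure_pmf nn_integral_count_space_nat
  proof (intro suminf_cong)
    fix k
    have "exp (s * (1 + real k)) = exp s * exp s ^ k"
      by (simp add: distrib_left exp_add exp_of_nat2_mult)
    then show "ennreal (pmf (geometric_pmf p3) k) * ennreal (exp (s * (1 + real k))) =
        ennreal (exp s * p3 * (exp s * (1 - p3)) ^ k)"
      using letter_three_probability(1,2) by (simp add: ennreal_mult[symmetric] power_mult_distrib mult_ac)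
  qed
  also have "\<dots> < \<infinity>"
  proof -
    have "summable (\<lambda>k. exp s * p3 * (exp s * (1 - p3)) ^ k)"
      using s letter_three_probability by (intro summable_mult summable_geometric) auto
    then have "(\<Sum>k. ennreal (exp s * p3 * (exp s * (1 - p3)) ^ k)) = ennreal (\<Sum>k. exp s * p3 * (exp s * (1 - p3)) ^ k)"
      using letter_three_probability by (intro suminf_ennreal2) auto
    then show ?thesis by simp
  qed
  finally have "integrable block_pmf (\<lambda>x. exp (s * (1 + real (fst x + snd x))))"
    by (intro integrableI_nonneg) auto
  then show ?thesis using s by blast
qed

lemma linear_growth_exponential_moment:
  assumes "linear_growth f"
  shows "\<exists>s>0. integrable block_pmf (\<lambda>x. exp (s * \<bar>f x\<bar>))"
proof -
  obtain K where K: "\<And>x. \<bar>f x\<bar> \<le> K * (1 + real (fst x + snd x))"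
    using assms unfolding linear_growth_def by blast
  define L where "L = max 1 K"
  have L: "\<bar>f x\<bar> \<le> L * (1 + real (fst x + snd x))" for x
    using K[of x] mult_right_mono[of K L "1 + real (fst x + snd x)"] unfolding L_def by linarith
  obtain s where s: "0 < s" "integrable block_pmf (\<lambda>x. exp (s * (1 + real (fst x + snd x))))"
    using exponential_moment_block_length by auto
  have "integrable block_pmf (\<lambda>x. exp (s / L * \<bar>f x\<bar>))"
  proof (rule Bochner_Integration.integrable_bound[OF s(2)])
    show "AE x in block_pmf. norm (exp (s / L * \<bar>f x\<bar>)) \<le> norm (exp (s * (1 + real (fst x + snd x))))"
    proof (rule AE_I2)
      fix x
      have "s / L * \<bar>f x\<bar> \<le> s / L * (L * (1 + real (fst x + snd x)))"
        using s L unfolding L_def by (intro mult_left_mono) auto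
      also have "\<dots> = s * (1 + real (fst x + snd x))" unfolding L_def by simp
      finally show "norm (exp (s / L * \<bar>f x\<bar>)) \<le> norm (exp (s * (1 + real (fst x + snd x))))" by simp
    qed
  qed simp
  moreover have "0 < s / L" using s unfolding L_def by simp
  ultimately show ?thesis by blast
qed

lemma linear_growth_integrable:
  assumes "linear_growth f"
  shows "integrable block_pmf f"
proof -
  obtain s where s: "0 < s" "integrable block_pmf (\<lambda>x. exp (s * \<bar>f x\<bar>))"
    using linear_growth_exponential_moment[OF assms] by auto
  show ?thesis
  proof (rule Bochner_Integration.integrable_bound)
    show "integrable block_pmf (\<lambda>x. exp (s * \<bar>f x\<bar>) / s)" using s by simp
    have "\<bar>f x\<bar> \<le> exp (s * \<bar>f x\<bar>) / s" for x
      using exp_ge_add_one_self[of "s * \<bar>f x\<bar>"] s(1) by (simp add: field_simps del: exp_ge_add_one_self)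
    then show "AE x in block_pmf. norm (f x) \<le> norm (exp (s * \<bar>f x\<bar>) / s)"
      using s(1) by (intro AE_I2) simp
  qed simp
qed

lemma linear_growth_affine:
  "linear_growth (\<lambda>x. u * real (fst x) + v * real (snd x) + w)"
  unfolding linear_growth_def
proof (intro exI allI)
  fix x :: "nat \<times> nat"
  have "\<bar>u * real (fst x) + v * real (snd x) + w\<bar> \<le> \<bar>u\<bar> * real (fst x) + \<bar>v\<bar> * real (snd x) + \<bar>w\<bar> * 1"
    using abs_triangle_ineq[of "u * real (fst x) + v * real (snd x)" w]
      abs_triangle_ineq[of "u * real (fst x)" "v * real (snd x)"] by (simp add: abs_mult)
  also have "\<dots> \<le> (\<bar>u\<bar> + \<bar>v\<bar> + \<bar>w\<bar>) * real (fst x) + (\<bar>u\<bar> + \<bar>v\<bar> + \<bar>w\<bar>) * real (snd x) + (\<bar>u\<bar> + \<bar>v\<bar> + \<bar>w\<bar>) * 1"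
    by (intro add_mono mult_right_mono) auto
  finally show "\<bar>u * real (fst x) + v * real (snd x) + w\<bar> \<le> (\<bar>u\<bar> + \<bar>v\<bar> + \<bar>w\<bar>) * (1 + real (fst x + snd x))"
    by (simp add: algebra_simps)
qed

lemma linear_growth_bounded_by:
  assumes "linear_growth g" "\<And>x. \<bar>f x\<bar> \<le> \<bar>g x\<bar>"
  shows "linear_growth f"
proof -
  obtain K where "\<And>x. \<bar>g x\<bar> \<le> K * (1 + real (fst x + snd x))"
    using assms(1) unfolding linear_growth_def by blast
  then have "\<And>x. \<bar>f x\<bar> \<le> K * (1 + real (fst x + snd x))"
    using assms(2) by (rule order_trans[rotated])
  then show ?thesis unfolding linear_growth_def by blast
qed

text \<open>The binomial coefficient is at least 1, so the information content of a block is at most that of one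
of its words.\<close>

lemma linear_growth_information: "linear_growth (\<lambda>x. - ln (pmf block_pmf x))"
proof (rule linear_growth_bounded_by)
  show "linear_growth (\<lambda>x. - ln p1 * real (fst x) + - ln p2 * real (snd x) + - ln p3)"
    by (rule linear_growth_affine)
  fix x :: "nat \<times> nat"
  obtain a b where x: "x = (a, b)" by (cases x)
  have "1 * (p1 ^ a * p2 ^ b * p3) \<le> real ((a + b) choose a) * (p1 ^ a * p2 ^ b * p3)"
    using p_pos by (intro mult_right_mono) (auto simp: Suc_le_eq zero_less_binomial_iff)
  then have "ln (p1 ^ a * p2 ^ b * p3) \<le> ln (pmf block_pmf x)"
    using p_pos by (simp add: x pmf_block mult_ac)
  moreover have "ln (p1 ^ a * p2 ^ b * p3) = real a * ln p1 + real b * ln p2 + ln p3"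
    using p_pos by (simp add: ln_mult ln_realpow)
  moreover have "ln (pmf block_pmf x) \<le> 0"
    using pmf_block_pos[of x] by (simp add: pmf_le_1)
  ultimately show "\<bar>- ln (pmf block_pmf x)\<bar> \<le> \<bar>- ln p1 * real (fst x) + - ln p2 * real (snd x) + - ln p3\<bar>"
    by (simp add: x algebra_simps)
qed

end

section \<open>Independent sequences and the strong law of large numbers\<close>

abbreviation iid :: "'a pmf \<Rightarrow> (nat \<Rightarrow> 'a) measure" where
  "iid q \<equiv> \<Pi>\<^sub>M i\<in>UNIV. measure_pmf q"

lemma sequence_space_pmf: "sequence_space (measure_pmf q)"
  by unfold_locales

lemma prob_space_iid: "prob_space (iid q)"
  by (intro prob_space_PiM measure_pmf.prob_space_axioms)

lemma space_iid [simp]: "space (iid q) = UNIV"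
  by (simp add: space_PiM)

lemma measurable_iid_component [measurable]: "(\<lambda>\<omega>. \<omega> i) \<in> measurable (iid q) (count_space UNIV)"
  using measurable_component_singleton[of i UNIV "\<lambda>_. measure_pmf q"]
  by (simp cong: measurable_cong_sets)

lemma borel_measurable_iid_component:
  "(\<lambda>\<omega>. f (\<omega> i)) \<in> borel_measurable (iid q)"
  by (rule measurable_compose[OF measurable_iid_component]) simp

text \<open>The first term and the shifted sequence are independent, and the shifted sequence has the law of the
whole sequence.\<close>

lemma nn_integral_iid_split:
  assumes [measurable]: "g \<in> borel_measurable (iid q)"
  shows "(\<integral>\<^sup>+\<omega>. g \<omega> \<partial>iid q) = (\<integral>\<^sup>+x. \<integral>\<^sup>+\<omega>. g (case_nat x \<omega>) \<partial>iid q \<partial>measure_pmf q)"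
proof -
  interpret sequence_space "measure_pmf q" by (rule sequence_space_pmf)
  interpret prob_space "iid q" by (rule prob_space_iid)
  have "(\<integral>\<^sup>+\<omega>. g \<omega> \<partial>iid q) =
      (\<integral>\<^sup>+\<omega>. g \<omega> \<partial>distr (measure_pmf q \<Otimes>\<^sub>M iid q) (iid q) (\<lambda>(s, \<omega>). case_nat s \<omega>))"
    by (simp only: PiM_iter)
  also have "\<dots> = (\<integral>\<^sup>+z. g (case_nat (fst z) (snd z)) \<partial>(measure_pmf q \<Otimes>\<^sub>M iid q))"
    by (subst nn_integral_distr) (auto simp: case_prod_unfold)
  also have "\<dots> = (\<integral>\<^sup>+x. \<integral>\<^sup>+\<omega>. g (case_nat x \<omega>) \<partial>iid q \<partial>measure_pmf q)"
    by (subst nn_integral_fst[symmetric]) auto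
  finally show ?thesis .
qed

lemma nn_integral_iid_prod:
  fixes h :: "nat \<Rightarrow> 'a \<Rightarrow> ennreal"
  shows "(\<integral>\<^sup>+\<omega>. (\<Prod>i<n. h i (\<omega> i)) \<partial>iid q) = (\<Prod>i<n. \<integral>\<^sup>+x. h i x \<partial>measure_pmf q)"
proof (induction n arbitrary: h)
  case 0
  show ?case using prob_space.emeasure_space_1[OF prob_space_iid, of q] by simp
next
  case (Suc n)
  have "(\<integral>\<^sup>+\<omega>. (\<Prod>i<Suc n. h i (\<omega> i)) \<partial>iid q) =
      (\<integral>\<^sup>+x. \<integral>\<^sup>+\<omega>. h 0 x * (\<Prod>i<n. h (Suc i) (\<omega> i)) \<partial>iid q \<partial>measure_pmf q)"
    by (subst nn_integral_iid_split)
      (auto intro!: borel_measurable_times_ennreal borel_measurable_prod_ennreal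
        borel_measurable_iid_component simp: prod.lessThan_Suc_shift simp del: prod.lessThan_Suc)
  also have "\<dots> = (\<integral>\<^sup>+x. h 0 x * (\<Prod>i<n. \<integral>\<^sup>+x. h (Suc i) x \<partial>measure_pmf q) \<partial>measure_pmf q)"
    by (intro nn_integral_cong, subst nn_integral_cmult)
      (auto intro!: borel_measurable_prod_ennreal borel_measurable_iid_component simp: Suc.IH[of "\<lambda>i. h (Suc i)"])
  also have "\<dots> = (\<Prod>i<Suc n. \<integral>\<^sup>+x. h i x \<partial>measure_pmf q)"
    by (simp only: prod.lessThan_Suc_shift) (simp add: nn_integral_multc)
  finally show ?case .
qed

lemma emeasure_iid_cylinder:
  "emeasure (iid q) {\<tau>. \<forall>i<n. \<tau> i = \<omega> i} = ennreal (\<Prod>i<n. pmf q (\<omega> i))"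
proof -
  have meas: "{\<tau>. \<forall>i<n. \<tau> i = \<omega> i} \<in> sets (iid q)"
  proof -
    have "{\<tau> \<in> space (iid q). \<forall>i<n. \<tau> i = \<omega> i} \<in> sets (iid q)" by measurable
    then show ?thesis by simp
  qed
  have "indicator {\<tau>. \<forall>i<n. \<tau> i = \<omega> i} \<tau> = (\<Prod>i<n. indicator {\<omega> i} (\<tau> i) :: ennreal)" for \<tau>
    by (induction n) (auto simp: indicator_def less_Suc_eq)
  then have "(\<integral>\<^sup>+\<tau>. (\<Prod>i<n. indicator {\<omega> i} (\<tau> i)) \<partial>iid q) =
      (\<integral>\<^sup>+\<tau>. indicator {\<tau>. \<forall>i<n. \<tau> i = \<omega> i} \<tau> \<partial>iid q)"
    by (intro nn_integral_cong) (simp only:)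
  then have "emeasure (iid q) {\<tau>. \<forall>i<n. \<tau> i = \<omega> i} =
      (\<integral>\<^sup>+\<tau>. (\<Prod>i<n. indicator {\<omega> i} (\<tau> i)) \<partial>iid q)"
    by (simp only: nn_integral_indicator[OF meas])
  also have "\<dots> = ennreal (\<Prod>i<n. pmf q (\<omega> i))"
    using nn_integral_iid_prod[where q = q and n = n and h = "\<lambda>i. indicator {\<omega> i}"]
    by (simp add: emeasure_pmf_single prod_ennreal)
  finally show ?thesis .
qed

lemma AE_tendsto_0_of_summable:
  fixes f :: "nat \<Rightarrow> 'a \<Rightarrow> real"
  assumes [measurable]: "\<And>n. f n \<in> borel_measurable M" and nonneg: "\<And>n x. 0 \<le> f n x"
    and le: "\<And>n. (\<integral>\<^sup>+x. f n x \<partial>M) \<le> ennreal (c n)" and c: "\<And>n. 0 \<le> c n" "summable c"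
  shows "AE x in M. (\<lambda>n. f n x) \<longlonglongrightarrow> 0"
proof -
  have "(\<integral>\<^sup>+x. (\<Sum>n. ennreal (f n x)) \<partial>M) = (\<Sum>n. \<integral>\<^sup>+x. f n x \<partial>M)"
    by (intro nn_integral_suminf) simp
  also have "\<dots> \<le> (\<Sum>n. ennreal (c n))" by (intro suminf_le le) auto
  also have "\<dots> < \<infinity>" using suminf_ennreal2[OF c] by simp
  finally have "AE x in M. (\<Sum>n. ennreal (f n x)) \<noteq> \<infinity>"
    by (intro nn_integral_noteq_infinite) auto
  then show ?thesis
    by eventually_elim (auto intro!: summable_LIMSEQ_zero summable_suminf_not_top nonneg)
qed

lemma exp_le_quadratic: "exp x \<le> 1 + x + x\<^sup>2 * exp \<bar>x\<bar>" for x :: real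
proof -
  obtain t where t: "\<bar>t\<bar> \<le> \<bar>x\<bar>" "exp x = (\<Sum>m<2. x ^ m / fact m) + exp t / fact 2 * x ^ 2"
    using Maclaurin_exp_le[of x 2] by blast
  have "exp t / fact 2 * x\<^sup>2 \<le> exp \<bar>x\<bar> * x\<^sup>2"
  proof (rule mult_right_mono)
    have "exp t \<le> exp \<bar>x\<bar>" using t(1) by simp
    moreover have "exp t / 2 \<le> exp t" by simp
    ultimately show "exp t / fact 2 \<le> exp \<bar>x\<bar>" unfolding fact_2 by linarith
  qed simp
  then show ?thesis using t(2) by (simp add: numeral_2_eq_2 mult.commute)
qed

text \<open>The moment generating function is 1 at 0 with derivative \<open>E g < 0\<close>; the quadratic error term
is controlled by the exponential moment.\<close>

lemma expectation_exp_less_1: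
  fixes g :: "'a \<Rightarrow> real"
  assumes s: "0 < s" "integrable (measure_pmf q) (\<lambda>x. exp (s * \<bar>g x\<bar>))"
    and g: "integrable (measure_pmf q) g" "measure_pmf.expectation q g < 0"
  shows "\<exists>t>0. (\<integral>\<^sup>+x. ennreal (exp (t * g x)) \<partial>measure_pmf q) < 1"
proof -
  \<comment> \<open>From \<open>u\<^sup>2 / 2 \<le> exp u\<close> at \<open>u = s \<bar>g\<bar> / 2\<close> one gets \<open>g\<^sup>2 \<le> (8 / s\<^sup>2) exp (s \<bar>g\<bar> / 2)\<close>.\<close>
  define C where "C = 8 / s\<^sup>2 * measure_pmf.expectation q (\<lambda>x. exp (s * \<bar>g x\<bar>))"
  define t where "t = min (s / 2) (- measure_pmf.expectation q g / (2 * (C + 1)))"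
  have C: "0 \<le> C" unfolding C_def by simp
  have t: "0 < t" "t \<le> s / 2"
    using s(1) g(2) C unfolding t_def by (simp add: divide_neg_pos, intro min.cobounded1)
  have "t * (C + 1) \<le> - measure_pmf.expectation q g / (2 * (C + 1)) * (C + 1)"
    unfolding t_def using C by (intro mult_right_mono) auto
  also have "\<dots> = - measure_pmf.expectation q g / 2" using C by (simp add: field_simps)
  finally have t3: "t * (C + 1) \<le> - measure_pmf.expectation q g / 2" .
  have pt: "exp (t * g x) \<le> 1 + t * g x + t\<^sup>2 * (8 / s\<^sup>2 * exp (s * \<bar>g x\<bar>))" for x
  proof -
    let ?u = "s / 2 * \<bar>g x\<bar>"
    have "?u\<^sup>2 / 2 \<le> exp ?u"
    proof -
      have "0 \<le> ?u" using s(1) by simp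
      with exp_lower_Taylor_quadratic[OF this] show ?thesis by linarith
    qed
    then have sq: "(g x)\<^sup>2 \<le> 8 / s\<^sup>2 * exp ?u"
      using s(1) by (simp add: power_mult_distrib power_divide field_simps)
    have "exp \<bar>t * g x\<bar> \<le> exp ?u" using t using mult_right_mono[of t "s / 2" "\<bar>g x\<bar>"]
      by (simp add: abs_mult)
    with sq have "(g x)\<^sup>2 * exp \<bar>t * g x\<bar> \<le> 8 / s\<^sup>2 * exp ?u * exp ?u"
      using s(1) by (intro mult_mono) auto
    also have "\<dots> = 8 / s\<^sup>2 * exp (s * \<bar>g x\<bar>)" by (simp add: exp_add[symmetric] mult.assoc)
    finally have "t\<^sup>2 * ((g x)\<^sup>2 * exp \<bar>t * g x\<bar>) \<le> t\<^sup>2 * (8 / s\<^sup>2 * exp (s * \<bar>g x\<bar>))"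
      by (intro mult_left_mono) auto
    then show ?thesis
      using exp_le_quadratic[of "t * g x"] by (simp add: power_mult_distrib mult.assoc)
  qed
  have int: "integrable (measure_pmf q) (\<lambda>x. 1 + t * g x + t\<^sup>2 * (8 / s\<^sup>2 * exp (s * \<bar>g x\<bar>)))"
    using s g by auto
  have "(\<integral>\<^sup>+x. ennreal (exp (t * g x)) \<partial>measure_pmf q) \<le>
      (\<integral>\<^sup>+x. ennreal (1 + t * g x + t\<^sup>2 * (8 / s\<^sup>2 * exp (s * \<bar>g x\<bar>))) \<partial>measure_pmf q)"
    by (intro nn_integral_mono ennreal_leI pt)
  also have "\<dots> = ennreal (measure_pmf.expectation q (\<lambda>x. 1 + t * g x + t\<^sup>2 * (8 / s\<^sup>2 * exp (s * \<bar>g x\<bar>))))"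
    using order_trans[OF less_imp_le[OF exp_gt_zero] pt] by (intro nn_integral_eq_integral int) auto
  also have "measure_pmf.expectation q (\<lambda>x. 1 + t * g x + t\<^sup>2 * (8 / s\<^sup>2 * exp (s * \<bar>g x\<bar>))) =
      1 + t * measure_pmf.expectation q g + t\<^sup>2 * C"
    using s g unfolding C_def by simp
  also have "ennreal (1 + t * measure_pmf.expectation q g + t\<^sup>2 * C) < ennreal 1"
  proof (rule ennreal_lessI)
    have "t * C \<le> t * (C + 1)" using t by (intro mult_left_mono) auto
    then have "measure_pmf.expectation q g + t * C < 0" using t3 g(2) by linarith
    then have "t * (measure_pmf.expectation q g + t * C) < 0" using t(1) by (intro mult_pos_neg)
    then show "1 + t * measure_pmf.expectation q g + t\<^sup>2 * C < 1"
      by (simp add: distrib_left power2_eq_square mult.assoc)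
  qed simp
  finally show ?thesis using t(1) by auto
qed

text \<open>Chernoff's bound: the expectation of \<open>exp (t S\<^sub>n)\<close> decays geometrically, hence
\<open>exp (t S\<^sub>n)\<close> tends to 0 almost surely.\<close>

lemma eventually_partial_sums_neg:
  fixes g :: "'a \<Rightarrow> real"
  assumes s: "0 < s" "integrable (measure_pmf q) (\<lambda>x. exp (s * \<bar>g x\<bar>))"
    and g: "integrable (measure_pmf q) g" "measure_pmf.expectation q g < 0"
  shows "AE \<omega> in iid q. eventually (\<lambda>n. (\<Sum>i<n. g (\<omega> i)) < 0) sequentially"
proof -
  obtain t where t: "0 < t" "(\<integral>\<^sup>+x. ennreal (exp (t * g x)) \<partial>measure_pmf q) < 1"
    using expectation_exp_less_1[OF assms] by blast
  then obtain c where c: "0 \<le> c" "c < 1" "(\<integral>\<^sup>+x. ennreal (exp (t * g x)) \<partial>measure_pmf q) = ennreal c"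
    by (cases "\<integral>\<^sup>+x. ennreal (exp (t * g x)) \<partial>measure_pmf q")
      (auto simp: ennreal_less_one_iff)
  have "AE \<omega> in iid q. (\<lambda>n. exp (t * (\<Sum>i<n. g (\<omega> i)))) \<longlonglongrightarrow> 0"
  proof (rule AE_tendsto_0_of_summable)
    show "(\<lambda>\<omega>. exp (t * (\<Sum>i<n. g (\<omega> i)))) \<in> borel_measurable (iid q)" for n
      using borel_measurable_iid_component[of g _ q] by measurable
    show "(\<integral>\<^sup>+\<omega>. exp (t * (\<Sum>i<n. g (\<omega> i))) \<partial>iid q) \<le> ennreal (c ^ n)" for n
    proof -
      have "(\<integral>\<^sup>+\<omega>. exp (t * (\<Sum>i<n. g (\<omega> i))) \<partial>iid q) =
          (\<integral>\<^sup>+\<omega>. (\<Prod>i<n. ennreal (exp (t * g (\<omega> i)))) \<partial>iid q)"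
        by (simp add: prod_ennreal exp_sum sum_distrib_left)
      also have "\<dots> = ennreal (c ^ n)"
        by (subst nn_integral_iid_prod) (simp add: c ennreal_power)
      finally show ?thesis by simp
    qed
    show "summable (\<lambda>n. c ^ n)" using c by (intro summable_geometric) auto
  qed (use c in auto)
  then show ?thesis
  proof eventually_elim
    case (elim \<omega>)
    then have "eventually (\<lambda>n. exp (t * (\<Sum>i<n. g (\<omega> i))) < 1) sequentially"
      by (rule order_tendstoD) simp
    then show ?case
      by (rule eventually_mono) (use t(1) in \<open>simp add: mult_less_0_iff\<close>)
  qed
qed

text \<open>Partial sums of \<open>f - E f - \<epsilon>\<close> and of \<open>E f - f - \<epsilon>\<close> are eventually negative, for all
\<open>\<epsilon> = 1 / (k + 1)\<close> at once.\<close>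

lemma strong_law:
  fixes f :: "'a \<Rightarrow> real"
  assumes s: "0 < s" "integrable (measure_pmf q) (\<lambda>x. exp (s * \<bar>f x\<bar>))"
    and f: "integrable (measure_pmf q) f"
  shows "AE \<omega> in iid q. (\<lambda>n. (\<Sum>i<n. f (\<omega> i)) / real n) \<longlonglongrightarrow> measure_pmf.expectation q f"
proof -
  let ?E = "measure_pmf.expectation q f"
  have int: "integrable (measure_pmf q) (\<lambda>x. exp (s * \<bar>\<sigma> * f x + c\<bar>))" if "\<bar>\<sigma>\<bar> = 1" for \<sigma> c
  proof (rule Bochner_Integration.integrable_bound)
    show "integrable (measure_pmf q) (\<lambda>x. exp (s * \<bar>c\<bar>) * exp (s * \<bar>f x\<bar>))"
      using s(2) by simp
    have "s * \<bar>\<sigma> * f x + c\<bar> \<le> s * \<bar>c\<bar> + s * \<bar>f x\<bar>" for x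
      using s(1) abs_triangle_ineq[of "\<sigma> * f x" c] that
      by (simp add: distrib_left[symmetric] abs_mult add.commute)
    then show "AE x in q. norm (exp (s * \<bar>\<sigma> * f x + c\<bar>)) \<le> norm (exp (s * \<bar>c\<bar>) * exp (s * \<bar>f x\<bar>))"
      by (simp add: exp_add[symmetric])
  qed simp
  have dev: "AE \<omega> in iid q. eventually (\<lambda>n. (\<Sum>i<n. \<sigma> * f (\<omega> i) + (- \<sigma> * ?E - 1 / real (Suc k))) < 0) sequentially"
    if "\<bar>\<sigma>\<bar> = 1" for \<sigma> k
  proof (rule eventually_partial_sums_neg[OF s(1) int[OF that]])
    show "measure_pmf.expectation q (\<lambda>x. \<sigma> * f x + (- \<sigma> * ?E - 1 / real (Suc k))) < 0"
      using f by simp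
  qed (use f in simp)
  have "AE \<omega> in iid q. \<forall>k. eventually (\<lambda>n. (\<Sum>i<n. 1 * f (\<omega> i) + (- 1 * ?E - 1 / real (Suc k))) < 0) sequentially"
    unfolding AE_all_countable using dev[of 1] by simp
  moreover have "AE \<omega> in iid q. \<forall>k. eventually (\<lambda>n. (\<Sum>i<n. - 1 * f (\<omega> i) + (- (- 1) * ?E - 1 / real (Suc k))) < 0) sequentially"
    unfolding AE_all_countable using dev[of "- 1"] by simp
  ultimately show ?thesis
  proof eventually_elim
    case (elim \<omega>)
    show ?case
    proof (rule tendstoI)
      fix e :: real assume "0 < e"
      then obtain k where k: "1 / real (Suc k) < e" using nat_approx_posE by blast
      show "eventually (\<lambda>n. dist ((\<Sum>i<n. f (\<omega> i)) / real n) ?E < e) sequentially"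
        using elim(1)[rule_format, of k] elim(2)[rule_format, of k] eventually_gt_at_top[of 0]
      proof eventually_elim
        case (elim n)
        define S where "S = (\<Sum>i<n. f (\<omega> i))"
        have "S < real n * (?E + 1 / real (Suc k))" "real n * (?E - 1 / real (Suc k)) < S"
          using elim(1,2) unfolding S_def by (simp_all add: sum.distrib sum_subtractf sum_negf algebra_simps)
        then have "S / real n < ?E + 1 / real (Suc k)" "?E - 1 / real (Suc k) < S / real n"
          using elim(3) by (simp_all add: pos_divide_less_eq pos_less_divide_eq mult.commute)
        then show ?case using k unfolding dist_real_def S_def by linarith
      qed
    qed
  qed
qed

section \<open>Uniqueness of self-similar measures, and a criterion for exact dimensionality\<close>

text \<open>Writing the self-similarity relation as an image of a product measure turns the relation between
measures of sets into one between integrals.\<close>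

lemma self_similar_measure_eq_distr:
  assumes ss: "is_self_similar_measure S p \<nu>"
    and S: "\<And>i. i < length S \<Longrightarrow> S ! i \<in> borel_measurable borel"
  shows "\<nu> = distr (point_measure {..<length S} (\<lambda>i. ennreal (p ! i)) \<Otimes>\<^sub>M \<nu>) borel (\<lambda>(i, x). (S ! i) x)"
    (is "\<nu> = distr (?P \<Otimes>\<^sub>M \<nu>) borel ?F")
    and "(\<lambda>(i, x). (S ! i) x) \<in> borel_measurable (point_measure {..<length S} (\<lambda>i. ennreal (p ! i)) \<Otimes>\<^sub>M \<nu>)"
proof -
  have sets: "sets \<nu> = sets borel" and "prob_space \<nu>"
    using ss unfolding is_self_similar_measure_def by auto
  interpret prob_space \<nu> by fact
  have [measurable_cong]: "sets \<nu> = sets borel" by fact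
  show F: "?F \<in> borel_measurable (?P \<Otimes>\<^sub>M \<nu>)"
  proof -
    have "sets ?P = sets (count_space {..<length S})" by (simp add: sets_point_measure)
    then have "sets (?P \<Otimes>\<^sub>M \<nu>) = sets (count_space {..<length S} \<Otimes>\<^sub>M \<nu>)"
      by (intro sets_pair_measure_cong) auto
    moreover have "?F \<in> borel_measurable (count_space {..<length S} \<Otimes>\<^sub>M \<nu>)"
      by (rule measurable_pair_measure_countable1) (auto simp: S measurable_cong_sets[OF sets refl])
    ultimately show ?thesis by (simp cong: measurable_cong_sets)
  qed
  show "\<nu> = distr (?P \<Otimes>\<^sub>M \<nu>) borel ?F"
  proof (rule measure_eqI)
    fix A assume "A \<in> sets \<nu>"
    then have A: "A \<in> sets borel" by (simp add: sets)
    have "emeasure (distr (?P \<Otimes>\<^sub>M \<nu>) borel ?F) A =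
        (\<integral>\<^sup>+i. emeasure \<nu> (Pair i -` (?F -` A \<inter> space (?P \<Otimes>\<^sub>M \<nu>))) \<partial>?P)"
      using F A by (simp add: emeasure_distr emeasure_pair_measure_alt)
    also have "\<dots> = (\<Sum>i<length S. ennreal (p ! i) * emeasure \<nu> (Pair i -` (?F -` A \<inter> space (?P \<Otimes>\<^sub>M \<nu>))))"
      by (subst nn_integral_point_measure_finite) auto
    also have "\<dots> = (\<Sum>i<length S. ennreal (p ! i) * emeasure (distr \<nu> borel (S ! i)) A)"
      using A S sets_eq_imp_space_eq[OF sets]
      by (intro sum.cong refl arg_cong2[where f = times])
        (auto simp: emeasure_distr space_pair_measure space_point_measure measurable_cong_sets[OF sets refl]
          intro!: arg_cong[where f = "emeasure \<nu>"])
    also have "\<dots> = emeasure \<nu> A"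
      using ss A unfolding is_self_similar_measure_def by simp
    finally show "emeasure \<nu> A = emeasure (distr (?P \<Otimes>\<^sub>M \<nu>) borel ?F) A" by simp
  qed (simp add: sets)
qed

lemma char_self_similar:
  assumes ss: "is_self_similar_measure S p \<nu>"
    and S: "\<And>i x. i < length S \<Longrightarrow> (S ! i) x = r i * x + b i"
    and p: "\<And>i. i < length S \<Longrightarrow> 0 \<le> p ! i"
  shows "char \<nu> t = (\<Sum>i<length S. (p ! i) *\<^sub>R (iexp (t * b i) * char \<nu> (r i * t)))"
proof -
  have S': "S ! i = (\<lambda>x. r i * x + b i)" if "i < length S" for i
    using S[OF that] by auto
  have Sm: "S ! i \<in> borel_measurable borel" if "i < length S" for i
    unfolding S'[OF that] by measurable
  let ?P = "point_measure {..<length S} (\<lambda>i. ennreal (p ! i))"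
  let ?F = "\<lambda>(i, x). (S ! i) x"
  note eq = self_similar_measure_eq_distr(1)[OF ss Sm] and Fm = self_similar_measure_eq_distr(2)[OF ss Sm]
  have sets: "sets \<nu> = sets borel" and "prob_space \<nu>"
    using ss unfolding is_self_similar_measure_def by auto
  interpret \<nu>: prob_space \<nu> by fact
  interpret P: finite_measure ?P
    by (rule finite_measureI) (simp add: space_point_measure emeasure_point_measure_finite)
  interpret pair_sigma_finite ?P \<nu> ..
  interpret PN: finite_measure "?P \<Otimes>\<^sub>M \<nu>"
    by (intro finite_measure_pair_measure P.finite_measure_axioms \<nu>.finite_measure_axioms)
  have "char \<nu> t = (CLINT x|distr (?P \<Otimes>\<^sub>M \<nu>) borel ?F. iexp (t * x))"
    unfolding char_def using eq by simp
  also have "\<dots> = (CLINT z|?P \<Otimes>\<^sub>M \<nu>. iexp (t * ?F z))"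
    by (subst integral_distr[OF Fm]) auto
  also have "\<dots> = (CLINT i|?P. CLINT x|\<nu>. iexp (t * (S ! i) x))"
  proof (subst integral_fst'[symmetric])
    show "integrable (?P \<Otimes>\<^sub>M \<nu>) (\<lambda>z. iexp (t * ?F z))"
      by (rule PN.integrable_const_bound[where B = 1]) (use Fm in \<open>auto simp: case_prod_unfold\<close>)
  qed simp
  also have "\<dots> = (\<Sum>i<length S. (p ! i) *\<^sub>R (CLINT x|\<nu>. iexp (t * (S ! i) x)))"
    by (subst lebesgue_integral_point_measure_finite) (auto simp: p)
  also have "\<dots> = (\<Sum>i<length S. (p ! i) *\<^sub>R (iexp (t * b i) * char \<nu> (r i * t)))"
  proof (intro sum.cong refl arg_cong2[where f = scaleR])
    fix i assume "i \<in> {..<length S}"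
    then have "(CLINT x|\<nu>. iexp (t * (S ! i) x)) = (CLINT x|\<nu>. iexp (t * b i) * iexp (r i * t * x))"
      by (simp add: S exp_add[symmetric] algebra_simps)
    then show "(CLINT x|\<nu>. iexp (t * (S ! i) x)) = iexp (t * b i) * char \<nu> (r i * t)"
      unfolding char_def by simp
  qed
  finally show ?thesis .
qed

text \<open>Let \<open>D t\<close> be the distance of the two characteristic functions at \<open>t\<close>.  Self-similarity
bounds \<open>D t\<close> by an average of the values \<open>D (r\<^sub>i t)\<close>.  Iterating pushes the arguments
to 0, where \<open>D\<close> is continuous and vanishes.\<close>

lemma self_similar_measure_unique:
  assumes \<mu>: "is_self_similar_measure S p \<mu>" and \<nu>: "is_self_similar_measure S p \<nu>"
    and S: "\<And>i x. i < length S \<Longrightarrow> (S ! i) x = r i * x + b i"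
    and p: "\<And>i. i < length S \<Longrightarrow> 0 \<le> p ! i" "(\<Sum>i<length S. p ! i) = 1"
    and r: "\<And>i. i < length S \<Longrightarrow> \<bar>r i\<bar> \<le> \<rho>" "0 \<le> \<rho>" "\<rho> < 1"
  shows "\<mu> = \<nu>"
proof (rule Levy_uniqueness)
  have "prob_space \<mu>" "prob_space \<nu>" and sets: "sets \<mu> = sets borel" "sets \<nu> = sets borel"
    using \<mu> \<nu> unfolding is_self_similar_measure_def by auto
  then show rd: "real_distribution \<mu>" "real_distribution \<nu>"
    unfolding real_distribution_def real_distribution_axioms_def
    by auto
  define D where "D = (\<lambda>t. norm (char \<mu> t - char \<nu> t))"
  have D_step: "D t \<le> (\<Sum>i<length S. p ! i * D (r i * t))" for t
  proof -
    have "char \<mu> t - char \<nu> t =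
        (\<Sum>i<length S. (p ! i) *\<^sub>R (iexp (t * b i) * (char \<mu> (r i * t) - char \<nu> (r i * t))))"
      by (simp only: char_self_similar[OF \<mu> S p(1), where t = t] char_self_similar[OF \<nu> S p(1), where t = t]
          sum_subtractf[symmetric] scaleR_diff_right[symmetric] right_diff_distrib[symmetric])
    then have "D t \<le> (\<Sum>i<length S. norm ((p ! i) *\<^sub>R (iexp (t * b i) * (char \<mu> (r i * t) - char \<nu> (r i * t)))))"
      unfolding D_def by (simp only: norm_sum)
    also have "\<dots> = (\<Sum>i<length S. p ! i * D (r i * t))"
      unfolding D_def by (intro sum.cong) (auto simp: norm_mult p)
    finally show ?thesis .
  qed
  have D0: "D t \<le> e" if "0 < e" for t e
  proof -
    have "isCont D 0"
      unfolding D_def using real_distribution.isCont_char[OF rd(1)] real_distribution.isCont_char[OF rd(2)]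
      by (intro continuous_intros)
    moreover have "D 0 = 0"
      unfolding D_def using real_distribution.char_zero[OF rd(1)] real_distribution.char_zero[OF rd(2)] by simp
    ultimately obtain d where d: "0 < d" "\<And>u. \<bar>u\<bar> < d \<Longrightarrow> D u < e"
      using \<open>0 < e\<close> unfolding continuous_at_eps_delta by (auto simp: D_def)
    have "D t \<le> e" if "\<rho> ^ n * \<bar>t\<bar> < d" for n t
      using that
    proof (induction n arbitrary: t)
      case 0
      then show ?case using d(2)[of t] by simp
    next
      case (Suc n)
      have "D (r i * t) \<le> e" if "i < length S" for i
      proof (rule Suc.IH)
        have "\<rho> ^ n * (\<bar>r i\<bar> * \<bar>t\<bar>) \<le> \<rho> ^ n * (\<rho> * \<bar>t\<bar>)"
          using r(1)[OF that] r(2) by (intro mult_left_mono mult_right_mono) auto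
        also have "\<dots> < d" using Suc.prems by (simp add: mult_ac)
        finally show "\<rho> ^ n * \<bar>r i * t\<bar> < d" by (simp add: abs_mult)
      qed
      then have "(\<Sum>i<length S. p ! i * D (r i * t)) \<le> (\<Sum>i<length S. p ! i * e)"
        using p(1) by (intro sum_mono mult_left_mono) auto
      also have "\<dots> = e" using p(2) by (simp add: sum_distrib_right[symmetric])
      finally show ?case using D_step[of t] by linarith
    qed
    moreover have "\<exists>n. \<rho> ^ n * \<bar>t\<bar> < d"
    proof -
      have "(\<lambda>n. \<rho> ^ n * \<bar>t\<bar>) \<longlonglongrightarrow> 0 * \<bar>t\<bar>"
        using r by (intro tendsto_intros LIMSEQ_realpow_zero) auto
      then have "eventually (\<lambda>n. \<rho> ^ n * \<bar>t\<bar> < d) sequentially"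
        using d(1) by (intro order_tendstoD(2)) auto
      then show ?thesis using eventually_happens'[OF sequentially_bot] by blast
    qed
    ultimately show ?thesis by blast
  qed
  have "D t = 0" for t
  proof (rule antisym[OF field_le_epsilon])
    show "D t \<le> 0 + e" if "0 < e" for e using D0[OF that] by simp
  qed (simp add: D_def)
  then show "char \<mu> = char \<nu>" by (auto simp: D_def)
qed

lemma has_exact_dim_imp_dim_H:
  assumes "prob_space \<mu>" "has_exact_dim \<mu> c"
  shows "dim_H \<mu> = c"
  unfolding dim_H_def
proof (rule the_equality)
  fix d assume "has_exact_dim \<mu> d"
  with assms(2) have "AE x in \<mu>. d = c"
    unfolding has_exact_dim_def by eventually_elim auto
  then show "d = c" using prob_space.AE_False[OF assms(1)] by (cases "d = c") auto
qed fact

text \<open>The mass of a ball is monotone in its radius, and consecutive radii \<open>exp (- n)\<close> have logarithms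
of asymptotic ratio 1, so this sequence of radii decides the limit.\<close>

lemma tendsto_log_ratio:
  fixes \<mu> :: "real measure"
  assumes fin: "finite_measure \<mu>" "sets \<mu> = sets borel" "measure \<mu> UNIV \<le> 1"
    and pos: "\<And>n. 0 < measure \<mu> (cball x (exp (- real n)))"
    and lim: "(\<lambda>n. - ln (measure \<mu> (cball x (exp (- real n)))) / real n) \<longlonglongrightarrow> c"
  shows "(log_ratio \<mu> x \<longlongrightarrow> ereal c) (at_right 0)"
proof -
  interpret finite_measure \<mu> by fact
  define m where "m = (\<lambda>r. measure \<mu> (cball x r))"
  define b where "b = (\<lambda>n. - ln (m (exp (- real n))))"
  define N where "N = (\<lambda>r::real. nat \<lfloor>- ln r\<rfloor>)"
  have mono: "m r \<le> m s" if "r \<le> s" for r s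
    unfolding m_def using that by (intro finite_measure_mono) (auto simp: fin)
  have m1: "m r \<le> 1" for r
    unfolding m_def by (rule order_trans[OF finite_measure_mono fin(3)]) (auto simp: fin)
  have m_pos: "0 < m (exp (- real n))" for n unfolding m_def by (rule pos)
  have b_nonneg: "0 \<le> b n" for n
    unfolding b_def using m_pos[of n] m1[of "exp (- real n)"] by simp
  have N_top: "filterlim N at_top (at_right 0)"
    unfolding N_def
    by (intro filterlim_compose[OF filterlim_nat_sequentially] filterlim_compose[OF filterlim_floor_sequentially]
        filterlim_compose[OF filterlim_uminus_at_top_at_bot] ln_at_0)
  have upper: "(\<lambda>n. b (Suc n) / real n) \<longlonglongrightarrow> c"
  proof -
    have "(\<lambda>n. b (Suc n) / real (Suc n) * (real (Suc n) / real n)) \<longlonglongrightarrow> c * 1"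
      using LIMSEQ_Suc[OF lim] LIMSEQ_Suc_n_over_n unfolding b_def m_def by (intro tendsto_mult)
    then show ?thesis by (simp del: of_nat_Suc)
  qed
  have lower: "(\<lambda>n. b n / real (Suc n)) \<longlonglongrightarrow> c"
  proof -
    have "(\<lambda>n. b n / real n * (real n / real (Suc n))) \<longlonglongrightarrow> c"
      using tendsto_mult[OF lim LIMSEQ_n_over_Suc_n] unfolding b_def m_def by (simp only: mult_1_right)
    then show ?thesis
      by (rule Lim_transform_eventually)
        (use eventually_gt_at_top[of 0] in eventually_elim, simp)
  qed
  have small: "eventually (\<lambda>r. 0 < r \<and> 1 \<le> N r) (at_right (0::real))"
    using N_top[unfolded filterlim_at_top, rule_format, of 1] eventually_at_right_less[of "0::real"]
    by eventually_elim auto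
  have bounds: "eventually (\<lambda>r. 0 < m r \<and> b (N r) / real (Suc (N r)) \<le> ln (m r) / ln r \<and>
      ln (m r) / ln r \<le> b (Suc (N r)) / real (N r)) (at_right 0)"
    using small
  proof eventually_elim
    case (elim r)
    have N: "real (N r) \<le> - ln r" "- ln r \<le> real (Suc (N r))" "0 < real (N r)"
      using elim unfolding N_def by linarith+
    have "exp (- real (Suc (N r))) \<le> exp (ln r)" "exp (ln r) \<le> exp (- real (N r))"
      using N(1,2) unfolding exp_le_cancel_iff by linarith+
    then have r: "exp (- real (Suc (N r))) \<le> r" "r \<le> exp (- real (N r))" using elim by simp_all
    have mr: "0 < m (exp (- real (Suc (N r))))" "m (exp (- real (Suc (N r)))) \<le> m r"
      "m r \<le> m (exp (- real (N r)))"
      using m_pos[of "Suc (N r)"] mono r by auto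
    then have lnm: "b (N r) \<le> - ln (m r)" "- ln (m r) \<le> b (Suc (N r))"
      unfolding b_def by simp_all
    have "ln (m r) / ln r = - ln (m r) / - ln r" by simp
    moreover have "b (N r) / real (Suc (N r)) \<le> - ln (m r) / - ln r"
      using N lnm b_nonneg[of "N r"] by (intro frac_le) auto
    moreover have "- ln (m r) / - ln r \<le> b (Suc (N r)) / real (N r)"
      using N lnm b_nonneg by (intro frac_le) auto
    ultimately show ?case using mr by linarith
  qed
  have "((\<lambda>r. ln (m r) / ln r) \<longlongrightarrow> c) (at_right 0)"
  proof (rule tendsto_sandwich)
    show "((\<lambda>r. b (N r) / real (Suc (N r))) \<longlongrightarrow> c) (at_right 0)"
      using filterlim_compose[OF lower N_top] .
    show "((\<lambda>r. b (Suc (N r)) / real (N r)) \<longlongrightarrow> c) (at_right 0)"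
      using filterlim_compose[OF upper N_top] .
  qed (use bounds in \<open>eventually_elim, simp\<close>)+
  then have "((\<lambda>r. ereal (ln (m r) / ln r)) \<longlongrightarrow> ereal c) (at_right 0)"
    by (rule tendsto_ereal)
  then show ?thesis
    by (rule Lim_transform_eventually)
      (use bounds in \<open>eventually_elim, simp add: log_ratio_def m_def\<close>)
qed

text \<open>Convergence along a sequence of radii is a measurable condition on the centre, so that it can be
transported from the sample space to the image measure.\<close>

lemma has_exact_dim_distrI:
  fixes f :: "'a \<Rightarrow> real"
  assumes "prob_space M" and f: "f \<in> borel_measurable M"
  defines "\<mu> \<equiv> distr M borel f"
  assumes AE: "AE \<omega> in M. (\<forall>n. 0 < measure \<mu> (cball (f \<omega>) (exp (- real n)))) \<and>
      (\<lambda>n. - ln (measure \<mu> (cball (f \<omega>) (exp (- real n)))) / real n) \<longlonglongrightarrow> c"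
  shows "has_exact_dim \<mu> c"
proof -
  interpret M: prob_space M by fact
  interpret \<mu>: prob_space \<mu> unfolding \<mu>_def by (rule M.prob_space_distr[OF f])
  have sets [measurable_cong]: "sets \<mu> = sets borel" by (simp add: \<mu>_def)
  define g where "g = (\<lambda>n x. - ln (measure \<mu> (cball x (exp (- real n)))) / real n)"
  have ball: "(\<lambda>x. measure \<mu> (cball x r)) \<in> borel_measurable borel" for r
  proof -
    have "{z \<in> space (borel \<Otimes>\<^sub>M \<mu>). dist (fst z) (snd z) \<le> r} \<in> sets (borel \<Otimes>\<^sub>M \<mu>)" by measurable
    from \<mu>.measurable_emeasure_Pair[OF this]
    have "(\<lambda>x. emeasure \<mu> (cball x r)) \<in> borel_measurable borel"
      by (simp add: space_pair_measure vimage_def cball_def sets_eq_imp_space_eq[OF sets])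
    then show ?thesis unfolding measure_def by measurable
  qed
  have [measurable]: "g n \<in> borel_measurable borel" for n unfolding g_def using ball by measurable
  let ?Q = "\<lambda>x. (\<forall>n. 0 < measure \<mu> (cball x (exp (- real n)))) \<and>
    (\<forall>k. eventually (\<lambda>n. dist (g n x) c < 1 / real (Suc k)) sequentially)"
  have Q: "(\<lambda>n. g n x) \<longlonglongrightarrow> c \<longleftrightarrow> (\<forall>k. eventually (\<lambda>n. dist (g n x) c < 1 / real (Suc k)) sequentially)" for x
  proof
    assume R: "\<forall>k. eventually (\<lambda>n. dist (g n x) c < 1 / real (Suc k)) sequentially"
    show "(\<lambda>n. g n x) \<longlonglongrightarrow> c"
    proof (rule tendstoI)
      fix e :: real assume "0 < e"
      then obtain k where "1 / real (Suc k) < e" using nat_approx_posE by blast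
      with R[rule_format, of k] show "eventually (\<lambda>n. dist (g n x) c < e) sequentially"
        by (auto elim: eventually_mono)
    qed
  next
    assume "(\<lambda>n. g n x) \<longlonglongrightarrow> c"
    then show "\<forall>k. eventually (\<lambda>n. dist (g n x) c < 1 / real (Suc k)) sequentially"
      by (intro allI tendstoD) auto
  qed
  have "{x \<in> space borel. ?Q x} \<in> sets borel"
  proof -
    define h where "h = (\<lambda>n x. measure \<mu> (cball x (exp (- real n))))"
    have [measurable]: "h n \<in> borel_measurable borel" for n unfolding h_def by (rule ball)
    have "{x \<in> space borel. 0 < h n x} \<in> sets borel" for n
      by (rule borel_measurable_less) simp_all
    moreover have "{x \<in> space borel. dist (g n x) c < 1 / real (Suc k)} \<in> sets borel" for n k
      by (rule borel_measurable_less) simp_all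
    ultimately have "{x \<in> space borel. (\<forall>n. 0 < h n x) \<and>
        (\<forall>k. eventually (\<lambda>n. dist (g n x) c < 1 / real (Suc k)) sequentially)} \<in> sets borel"
      by (intro sets.sets_Collect_conj sets.sets_Collect_countable_All sets_Collect_eventually_sequentially)
    then show ?thesis unfolding h_def .
  qed
  moreover have "AE \<omega> in M. ?Q (f \<omega>)"
    using AE unfolding Q[symmetric] unfolding g_def .
  ultimately have "AE x in distr M borel f. ?Q x"
    by (rule AE_distr_iff[OF f, THEN iffD2])
  then have "AE x in \<mu>. ?Q x" by (fold \<mu>_def)
  then show ?thesis
    unfolding has_exact_dim_def
  proof eventually_elim
    case (elim x)
    then have "(log_ratio \<mu> x \<longlongrightarrow> ereal c) (at_right 0)"
      using \<mu>.finite_measure_axioms sets \<mu>.prob_le_1[of UNIV]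
      unfolding Q[symmetric] unfolding g_def by (intro tendsto_log_ratio) auto
    then show ?case
      unfolding lower_local_dim_def upper_local_dim_def
      by (intro conjI lim_imp_Liminf lim_imp_Limsup trivial_limit_at_right_real)
  qed
qed

section \<open>Entropy and Lyapunov exponent of a block\<close>

context weights
begin

text \<open>Used with a coordinate \<open>f\<close>, this is a linear equation for the expectation of \<open>f\<close>.\<close>

lemma expectation_block_Pascal:
  assumes "linear_growth f" "\<And>x. 0 \<le> f x"
  shows "measure_pmf.expectation block_pmf f = p3 * f (0, 0)
     + p1 * measure_pmf.expectation block_pmf (\<lambda>(a, b). f (Suc a, b))
     + p2 * measure_pmf.expectation block_pmf (\<lambda>(a, b). f (a, Suc b))"
proof -
  obtain K where K: "\<And>x. \<bar>f x\<bar> \<le> K * (1 + real (fst x + snd x))"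
    using assms(1) unfolding linear_growth_def by blast
  have K0: "0 \<le> K" using K[of "(0, 0)"] by simp
  have step: "\<bar>f y\<bar> \<le> 2 * K * (1 + real (fst x + snd x))"
    if "fst y + snd y = Suc (fst x + snd x)" for x y
  proof -
    have "K * (1 + real (fst y + snd y)) \<le> K * (2 * (1 + real (fst x + snd x)))"
      using that K0 by (intro mult_left_mono) auto
    then show ?thesis using K[of y] by (simp add: algebra_simps)
  qed
  have l: "linear_growth (\<lambda>(a, b). f (Suc a, b))"
    unfolding linear_growth_def
  proof (intro exI allI)
    fix x :: "nat \<times> nat"
    show "\<bar>(\<lambda>(a, b). f (Suc a, b)) x\<bar> \<le> 2 * K * (1 + real (fst x + snd x))"
      using step[of "(Suc (fst x), snd x)" x] by (simp add: case_prod_unfold)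
  qed
  have r: "linear_growth (\<lambda>(a, b). f (a, Suc b))"
    unfolding linear_growth_def
  proof (intro exI allI)
    fix x :: "nat \<times> nat"
    show "\<bar>(\<lambda>(a, b). f (a, Suc b)) x\<bar> \<le> 2 * K * (1 + real (fst x + snd x))"
      using step[of "(fst x, Suc (snd x))" x] by (simp add: case_prod_unfold)
  qed
  have l0: "0 \<le> (\<lambda>(a, b). f (Suc a, b)) x" and r0: "0 \<le> (\<lambda>(a, b). f (a, Suc b)) x" for x
    using assms(2) by (simp_all add: case_prod_unfold)
  have nn: "(\<integral>\<^sup>+x. ennreal (g x) \<partial>block_pmf) = ennreal (measure_pmf.expectation block_pmf g)"
    if "linear_growth g" "\<And>x. 0 \<le> g x" for g
    using that by (intro nn_integral_eq_integral linear_growth_integrable) auto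
  have E_nonneg: "0 \<le> measure_pmf.expectation block_pmf g"
    if "linear_growth g" "\<And>x. 0 \<le> g x" for g
    using that(2) by (rule Bochner_Integration.integral_nonneg)
  have "ennreal (measure_pmf.expectation block_pmf f) = ennreal p3 * ennreal (f (0, 0))
     + ennreal p1 * (\<integral>\<^sup>+x. ennreal ((\<lambda>(a, b). f (Suc a, b)) x) \<partial>block_pmf)
     + ennreal p2 * (\<integral>\<^sup>+x. ennreal ((\<lambda>(a, b). f (a, Suc b)) x) \<partial>block_pmf)"
    unfolding nn[OF assms, symmetric]
    by (subst nn_integral_block_Pascal) (simp add: case_prod_unfold)
  also have "\<dots> = ennreal (p3 * f (0, 0)
     + p1 * measure_pmf.expectation block_pmf (\<lambda>(a, b). f (Suc a, b))
     + p2 * measure_pmf.expectation block_pmf (\<lambda>(a, b). f (a, Suc b)))"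
    using assms(2) p_pos E_nonneg[OF l l0] E_nonneg[OF r r0]
    by (simp add: nn[OF l l0] nn[OF r r0] ennreal_mult)
  finally show ?thesis
    using assms(2) p_pos E_nonneg[OF assms] E_nonneg[OF l l0] E_nonneg[OF r r0]
    by (subst (asm) ennreal_inj) auto
qed

lemma expectation_block_fst: "measure_pmf.expectation block_pmf (\<lambda>x. real (fst x)) = p1 / p3"
  and expectation_block_snd: "measure_pmf.expectation block_pmf (\<lambda>x. real (snd x)) = p2 / p3"
proof -
  have se: "linear_growth (\<lambda>x. real (fst x))" "linear_growth (\<lambda>x. real (snd x))"
    using linear_growth_affine[of 1 0 0] linear_growth_affine[of 0 1 0] by simp_all
  note int = se[THEN linear_growth_integrable]
  have p3: "p3 = 1 - p1 - p2" using p_sum by simp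
  show "measure_pmf.expectation block_pmf (\<lambda>x. real (fst x)) = p1 / p3"
    using expectation_block_Pascal[OF se(1)] int p_pos(3)
    by (simp add: case_prod_unfold field_simps p3)
  show "measure_pmf.expectation block_pmf (\<lambda>x. real (snd x)) = p2 / p3"
    using expectation_block_Pascal[OF se(2)] int p_pos(3)
    by (simp add: case_prod_unfold field_simps p3)
qed

text \<open>The contribution of the words of length \<open>k\<close> in the letters 1 and 2 to the expected logarithm of
the binomial coefficient, up to the factor \<open>p\<^sub>3\<close>.\<close>

definition log_binomial_sum :: "nat \<Rightarrow> real" where
  "log_binomial_sum k =
     (\<Sum>m\<le>k. real (k choose m) * p1 ^ m * p2 ^ (k - m) * ln (real (k choose m)))"

lemma ln_binomial_nonneg: "m \<le> k \<Longrightarrow> 0 \<le> ln (real (k choose m))"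
  by (simp add: Suc_le_eq zero_less_binomial_iff)

lemma log_binomial_sum_nonneg: "0 \<le> log_binomial_sum k"
  unfolding log_binomial_sum_def using p_pos ln_binomial_nonneg by (intro sum_nonneg) simp

lemma linear_growth_ln_binomial:
  "linear_growth (\<lambda>x. ln (real ((fst x + snd x) choose fst x)))"
proof (rule linear_growth_bounded_by)
  show "linear_growth (\<lambda>x. ln 2 * real (fst x) + ln 2 * real (snd x) + 0)"
    by (rule linear_growth_affine)
  fix x :: "nat \<times> nat"
  have "real ((fst x + snd x) choose fst x) \<le> real (2 ^ (fst x + snd x))"
    using binomial_le_pow2 of_nat_le_iff by blast
  then have "ln (real ((fst x + snd x) choose fst x)) \<le> ln (2 ^ (fst x + snd x))"
    by (subst ln_le_cancel_iff) (auto simp: zero_less_binomial_iff)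
  also have "\<dots> = ln 2 * real (fst x) + ln 2 * real (snd x) + 0"
    by (simp add: ln_realpow algebra_simps)
  finally show "\<bar>ln (real ((fst x + snd x) choose fst x))\<bar> \<le> \<bar>ln 2 * real (fst x) + ln 2 * real (snd x) + 0\<bar>"
    using ln_binomial_nonneg[of "fst x" "fst x + snd x"] by simp
qed

lemma expectation_ln_binomial:
  "(\<lambda>k. p3 * log_binomial_sum k) sums
     measure_pmf.expectation block_pmf (\<lambda>x. ln (real ((fst x + snd x) choose fst x)))"
proof -
  let ?\<theta> = "p1 / (p1 + p2)"
  have inner: "(\<integral>\<^sup>+m. ennreal (ln (real ((m + (k - m)) choose m))) \<partial>binomial_pmf k ?\<theta>) * ennreal ((1 - p3) ^ k * p3) =
      ennreal (p3 * log_binomial_sum k)" for k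
  proof -
    have "(\<integral>\<^sup>+m. ennreal (ln (real ((m + (k - m)) choose m))) \<partial>binomial_pmf k ?\<theta>) * ennreal ((1 - p3) ^ k * p3) =
        (\<Sum>m\<le>k. ennreal (ln (real (k choose m))) * ennreal (pmf (binomial_pmf k ?\<theta>) m)) * ennreal ((1 - p3) ^ k * p3)"
      using letter_one_probability by (subst nn_integral_measure_pmf_finite) (auto intro!: sum.cong)
    also have "\<dots> = (\<Sum>m\<le>k. ennreal (ln (real (k choose m)) * (p3 * (real (k choose m) * p1 ^ m * p2 ^ (k - m)))))"
      unfolding sum_distrib_right
    proof (intro sum.cong refl)
      fix m assume m: "m \<in> {..k}"
      have "ennreal (ln (real (k choose m))) * ennreal (pmf (binomial_pmf k ?\<theta>) m) * ennreal ((1 - p3) ^ k * p3) =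
          ennreal (ln (real (k choose m)) * ((1 - p3) ^ k * p3 * pmf (binomial_pmf k ?\<theta>) m))"
        using ln_binomial_nonneg[of m k] m letter_three_probability by (simp add: ennreal_mult[symmetric] mult_ac pmf_nonneg del: pmf_binomial)
      also have "(1 - p3) ^ k * p3 * pmf (binomial_pmf k ?\<theta>) m = p3 * (real (k choose m) * p1 ^ m * p2 ^ (k - m))"
        using weight_regroup[of m k] m letter_one_probability by (simp add: mult_ac)
      finally show "ennreal (ln (real (k choose m))) * ennreal (pmf (binomial_pmf k ?\<theta>) m) * ennreal ((1 - p3) ^ k * p3) =
          ennreal (ln (real (k choose m)) * (p3 * (real (k choose m) * p1 ^ m * p2 ^ (k - m))))" .
    qed
    also have "\<dots> = ennreal (\<Sum>m\<le>k. ln (real (k choose m)) * (p3 * (real (k choose m) * p1 ^ m * p2 ^ (k - m))))"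
      using p_pos ln_binomial_nonneg by (intro sum_ennreal mult_nonneg_nonneg) auto
    also have "\<dots> = ennreal (p3 * log_binomial_sum k)"
      unfolding log_binomial_sum_def sum_distrib_left by (simp add: mult_ac)
    finally show ?thesis .
  qed
  have "ennreal (measure_pmf.expectation block_pmf (\<lambda>x. ln (real ((fst x + snd x) choose fst x)))) =
      (\<integral>\<^sup>+x. ennreal (ln (real ((fst x + snd x) choose fst x))) \<partial>block_pmf)"
    using ln_binomial_nonneg
    by (intro nn_integral_eq_integral[symmetric] linear_growth_integrable linear_growth_ln_binomial) auto
  also have "\<dots> = (\<Sum>k. ennreal (pmf (geometric_pmf p3) k) *
      (\<integral>\<^sup>+m. ennreal (ln (real ((m + (k - m)) choose m))) \<partial>binomial_pmf k ?\<theta>))"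
    unfolding block_pmf_def by (simp add: nn_integral_measure_pmf[of "geometric_pmf p3"] nn_integral_count_space_nat)
  also have "\<dots> = (\<Sum>k. ennreal (p3 * log_binomial_sum k))"
    using letter_three_probability(1,2) by (intro suminf_cong) (simp add: inner[symmetric] mult.commute)
  finally have eq: "(\<Sum>k. ennreal (p3 * log_binomial_sum k)) =
      ennreal (measure_pmf.expectation block_pmf (\<lambda>x. ln (real ((fst x + snd x) choose fst x))))" by simp
  have nonneg: "0 \<le> p3 * log_binomial_sum k" for k using p_pos log_binomial_sum_nonneg by simp
  have sm: "summable (\<lambda>k. p3 * log_binomial_sum k)"
    by (rule summable_suminf_not_top[OF nonneg]) (simp add: eq)
  moreover have "(\<Sum>k. p3 * log_binomial_sum k) =
      measure_pmf.expectation block_pmf (\<lambda>x. ln (real ((fst x + snd x) choose fst x)))"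
    using eq unfolding suminf_ennreal2[OF nonneg sm]
    by (subst (asm) ennreal_inj)
      (auto intro!: suminf_nonneg sm nonneg Bochner_Integration.integral_nonneg ln_binomial_nonneg)
  ultimately show ?thesis by (simp add: sums_iff)
qed

text \<open>For \<open>k = j + 1\<close> and \<open>m = i + 1\<close>, the logarithm of \<open>m / k\<close> is the logarithm of
\<open>(j choose i)\<close> minus that of \<open>(k choose m)\<close>.  The first parts add up to
\<open>p\<^sub>1 + p\<^sub>2\<close> times the sum for \<open>j\<close>, and by Pascal's rule the second parts combine to
the sum for \<open>j + 1\<close>.\<close>

lemma log_binomial_sum_Suc:
  "(\<Sum>m=1..Suc j. real (j choose (m - 1)) * p3 * ln (real m / real (Suc j)) *
      (p1 ^ m * p2 ^ (Suc j - m) + p1 ^ (Suc j - m) * p2 ^ m))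
    = p3 * ((p1 + p2) * log_binomial_sum j - log_binomial_sum (Suc j))"
proof -
  let ?C = "\<lambda>n k. real (n choose k)"
  have lnq: "ln (real (Suc i) / real (Suc j)) = ln (?C j i) - ln (?C (Suc j) (Suc i))" if "i \<le> j" for i
  proof -
    have "real (Suc i) * ?C (Suc j) (Suc i) = real (Suc j) * ?C j i"
      using Suc_times_binomial[of i j] by (metis of_nat_mult)
    moreover have "0 < ?C j i" "0 < ?C (Suc j) (Suc i)" using that by (simp_all add: zero_less_binomial_iff del: binomial_Suc_Suc)
    ultimately have "real (Suc i) / real (Suc j) = ?C j i / ?C (Suc j) (Suc i)" by (simp add: field_simps del: of_nat_Suc binomial_Suc_Suc)
    then show ?thesis using \<open>0 < ?C j i\<close> \<open>0 < ?C (Suc j) (Suc i)\<close> by (simp only: ln_divide_pos)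
  qed
  let ?A = "\<Sum>i\<le>j. ?C j i * p1 ^ Suc i * p2 ^ (j - i) * ln (?C (Suc j) (Suc i))"
  let ?B = "\<Sum>i\<le>j. ?C j i * p1 ^ i * p2 ^ (Suc j - i) * ln (?C (Suc j) i)"
  have "(\<Sum>m=1..Suc j. ?C j (m - 1) * p3 * ln (real m / real (Suc j)) *
      (p1 ^ m * p2 ^ (Suc j - m) + p1 ^ (Suc j - m) * p2 ^ m))
    = (\<Sum>i\<le>j. ?C j i * p3 * ln (real (Suc i) / real (Suc j)) *
      (p1 ^ Suc i * p2 ^ (j - i) + p1 ^ (j - i) * p2 ^ Suc i))"
    using sum.shift_bounds_cl_Suc_ivl[of "\<lambda>m. ?C j (m - 1) * p3 * ln (real m / real (Suc j)) *
      (p1 ^ m * p2 ^ (Suc j - m) + p1 ^ (Suc j - m) * p2 ^ m)" 0 j]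
    by (simp add: atMost_atLeast0 del: of_nat_Suc power_Suc)
  also have "\<dots> = p3 * ((\<Sum>i\<le>j. ?C j i * ln (real (Suc i) / real (Suc j)) * p1 ^ Suc i * p2 ^ (j - i)) +
      (\<Sum>i\<le>j. ?C j i * ln (real (Suc i) / real (Suc j)) * p1 ^ (j - i) * p2 ^ Suc i))"
    unfolding sum.distrib[symmetric] sum_distrib_left
    by (intro sum.cong refl) (simp add: algebra_simps del: of_nat_Suc)
  also have "(\<Sum>i\<le>j. ?C j i * ln (real (Suc i) / real (Suc j)) * p1 ^ Suc i * p2 ^ (j - i)) =
      p1 * log_binomial_sum j - ?A"
    unfolding log_binomial_sum_def sum_distrib_left sum_subtractf[symmetric]
    by (intro sum.cong refl) (simp add: lnq algebra_simps del: of_nat_Suc binomial_Suc_Suc)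
  also have "(\<Sum>i\<le>j. ?C j i * ln (real (Suc i) / real (Suc j)) * p1 ^ (j - i) * p2 ^ Suc i) =
      (\<Sum>i\<le>j. ?C j (j - i) * ln (real (Suc (j - i)) / real (Suc j)) * p1 ^ i * p2 ^ (Suc (j - i)))"
    by (rule sum.reindex_bij_witness[of _ "\<lambda>i. j - i" "\<lambda>i. j - i"]) auto
  also have "\<dots> = p2 * log_binomial_sum j - ?B"
    unfolding log_binomial_sum_def sum_distrib_left sum_subtractf[symmetric]
  proof (intro sum.cong refl)
    fix i assume "i \<in> {..j}"
    then have i: "i \<le> j" by simp
    have "?C j (j - i) = ?C j i" "?C (Suc j) (Suc (j - i)) = ?C (Suc j) i"
      using binomial_symmetric[OF i] binomial_symmetric[of i "Suc j"] i by (simp_all add: Suc_diff_le)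
    then show "?C j (j - i) * ln (real (Suc (j - i)) / real (Suc j)) * p1 ^ i * p2 ^ (Suc (j - i)) =
        p2 * (?C j i * p1 ^ i * p2 ^ (j - i) * ln (?C j i)) - ?C j i * p1 ^ i * p2 ^ (Suc j - i) * ln (?C (Suc j) i)"
      using i by (simp add: lnq Suc_diff_le algebra_simps del: of_nat_Suc binomial_Suc_Suc)
  qed
  also have "p1 * log_binomial_sum j - ?A + (p2 * log_binomial_sum j - ?B) =
      (p1 + p2) * log_binomial_sum j - (?A + ?B)" by (simp add: algebra_simps)
  also have "?A + ?B = log_binomial_sum (Suc j)"
  proof -
    let ?g = "\<lambda>m. p1 ^ m * p2 ^ (Suc j - m) * ln (?C (Suc j) m)"
    have "?B = (\<Sum>m\<le>Suc j. ?C j m * ?g m)" by (simp add: mult.assoc)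
    also have "\<dots> = ?C j 0 * ?g 0 + (\<Sum>i\<le>j. ?C j (Suc i) * ?g (Suc i))"
      by (subst sum.atMost_Suc_shift) simp
    finally have B: "?B = ?C j 0 * ?g 0 + (\<Sum>i\<le>j. ?C j (Suc i) * ?g (Suc i))" .
    have "log_binomial_sum (Suc j) = (\<Sum>m\<le>Suc j. ?C (Suc j) m * ?g m)"
      unfolding log_binomial_sum_def by (simp add: mult.assoc)
    also have "\<dots> = ?C (Suc j) 0 * ?g 0 + (\<Sum>i\<le>j. ?C (Suc j) (Suc i) * ?g (Suc i))"
      by (subst sum.atMost_Suc_shift) simp
    also have "(\<Sum>i\<le>j. ?C (Suc j) (Suc i) * ?g (Suc i)) =
        ?A + (\<Sum>i\<le>j. ?C j (Suc i) * ?g (Suc i))"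
      unfolding sum.distrib[symmetric]
    proof (intro sum.cong refl)
      fix i
      show "?C (Suc j) (Suc i) * ?g (Suc i) =
          ?C j i * p1 ^ Suc i * p2 ^ (j - i) * ln (?C (Suc j) (Suc i)) + ?C j (Suc i) * ?g (Suc i)"
        by (subst binomial_Suc_Suc) (simp only: of_nat_add diff_Suc_Suc distrib_right mult.assoc)
    qed
    finally show ?thesis using B by simp
  qed
  finally show ?thesis .
qed

text \<open>Summing the previous identity over \<open>j\<close>, the factor \<open>p\<^sub>1 + p\<^sub>2 - 1 = - p\<^sub>3\<close>
remains.\<close>

lemma Phi_eq: "Phi p1 p2 p3 =
  - p3 * measure_pmf.expectation block_pmf (\<lambda>x. ln (real ((fst x + snd x) choose fst x)))"
proof -
  define E where "E = measure_pmf.expectation block_pmf (\<lambda>x. ln (real ((fst x + snd x) choose fst x)))"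
  let ?T = "\<lambda>k. \<Sum>m=1..k. real ((k - 1) choose (m - 1)) * p3 * ln (real m / real k) *
        (p1 ^ m * p2 ^ (k - m) + p1 ^ (k - m) * p2 ^ m)"
  have L: "(\<lambda>k. p3 * log_binomial_sum k) sums E"
    unfolding E_def by (rule expectation_ln_binomial)
  have L0: "log_binomial_sum 0 = 0" by (simp add: log_binomial_sum_def)
  have L': "(\<lambda>k. p3 * log_binomial_sum (Suc k)) sums E"
    using L by (subst sums_Suc_iff) (simp add: L0)
  have "(\<lambda>j. (p1 + p2) * (p3 * log_binomial_sum j) - p3 * log_binomial_sum (Suc j)) sums ((p1 + p2) * E - E)"
    by (intro sums_diff sums_mult L L')
  also have "(\<lambda>j. (p1 + p2) * (p3 * log_binomial_sum j) - p3 * log_binomial_sum (Suc j)) = (\<lambda>j. ?T (Suc j))"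
    by (rule ext, simp only: diff_Suc_1 log_binomial_sum_Suc) (simp add: algebra_simps)
  also have "(p1 + p2) * E - E = - p3 * E" 
  proof -
    have "p1 + p2 = 1 - p3" using p_sum by simp
    then show ?thesis by (simp only:) (simp add: algebra_simps)
  qed
  finally have "(\<lambda>j. ?T (Suc j)) sums (- p3 * E)" .
  then have "?T sums (- p3 * E)" by (subst (asm) sums_Suc_iff) simp
  then show ?thesis unfolding Phi_def E_def by (rule sums_unique[symmetric])
qed

definition block_entropy :: real where
  "block_entropy = measure_pmf.expectation block_pmf (\<lambda>x. - ln (pmf block_pmf x))"

lemma block_entropy_eq:
  "block_entropy = (- (p1 * ln p1 + p2 * ln p2 + p3 * ln p3) + Phi p1 p2 p3) / p3"
proof -
  let ?E = "measure_pmf.expectation block_pmf"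
  let ?l = "\<lambda>x. ln (real ((fst x + snd x) choose fst x))"
  have se: "linear_growth (\<lambda>x. real (fst x))" "linear_growth (\<lambda>x. real (snd x))"
    using linear_growth_affine[of 1 0 0] linear_growth_affine[of 0 1 0] by simp_all
  note int = se[THEN linear_growth_integrable] linear_growth_integrable[OF linear_growth_ln_binomial]
  have "- ln (pmf block_pmf x) = - ?l x - real (fst x) * ln p1 - real (snd x) * ln p2 - ln p3" for x
  proof -
    have "pmf block_pmf x = real ((fst x + snd x) choose fst x) * p1 ^ fst x * p2 ^ snd x * p3"
      using pmf_block[of "fst x" "snd x"] by simp
    moreover have "0 < real ((fst x + snd x) choose fst x)" by (simp add: zero_less_binomial_iff)
    ultimately show ?thesis using p_pos by (simp add: ln_mult ln_realpow)
  qed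
  then have "block_entropy = - ?E ?l - ?E (\<lambda>x. real (fst x)) * ln p1 - ?E (\<lambda>x. real (snd x)) * ln p2 - ln p3"
    unfolding block_entropy_def using int by simp
  also have "\<dots> = (- (p1 * ln p1 + p2 * ln p2 + p3 * ln p3) + Phi p1 p2 p3) / p3"
  proof -
    have "- e - p1 / p3 * x - p2 / p3 * y - z = (- (p1 * x + p2 * y + p3 * z) + - p3 * e) / p3" for e x y z
      using p_pos(3) by (simp add: field_simps)
    then show ?thesis unfolding expectation_block_fst expectation_block_snd Phi_eq .
  qed
  finally show ?thesis .
qed

lemma block_entropy_nonneg: "0 \<le> block_entropy"
proof -
  have "0 \<le> - ln (pmf block_pmf x)" for x using pmf_block_pos[of x] by (simp add: pmf_le_1)
  then show ?thesis unfolding block_entropy_def by (intro Bochner_Integration.integral_nonneg)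
qed

end

locale common_fixed_point = two_ratios \<beta> \<gamma> + weights p1 p2 p3 for \<beta> \<gamma> p1 p2 p3 :: real
begin

definition lyapunov :: "real \<Rightarrow> real" where
  "lyapunov \<alpha> = measure_pmf.expectation block_pmf (\<lambda>x. - ln (\<gamma> * block_ratio \<alpha> x))"

lemma ln_step_ratio:
  assumes "0 < \<alpha>"
  shows "- ln (\<gamma> * block_ratio \<alpha> x) = - ln \<alpha> * real (fst x) + - ln \<beta> * real (snd x) + - ln \<gamma>"
  using \<gamma> block_ratio_pos[OF assms, of x] ln_block_ratio[OF assms] by (simp add: ln_mult_pos)

lemma linear_growth_step_ratio:
  assumes "0 < \<alpha>"
  shows "linear_growth (\<lambda>x. - ln (\<gamma> * block_ratio \<alpha> x))"
  unfolding ln_step_ratio[OF assms] by (rule linear_growth_affine)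

lemma lyapunov_eq:
  assumes "0 < \<alpha>"
  shows "lyapunov \<alpha> = - (p1 * ln \<alpha> + p2 * ln \<beta> + p3 * ln \<gamma>) / p3"
proof -
  have se: "linear_growth (\<lambda>x. real (fst x))" "linear_growth (\<lambda>x. real (snd x))"
    using linear_growth_affine[of 1 0 0] linear_growth_affine[of 0 1 0] by simp_all
  note int = se[THEN linear_growth_integrable]
  have "lyapunov \<alpha> = - ln \<alpha> * (p1 / p3) + - ln \<beta> * (p2 / p3) + - ln \<gamma>"
    unfolding lyapunov_def ln_step_ratio[OF assms] expectation_block_fst[symmetric] expectation_block_snd[symmetric]
    using int by simp
  then show ?thesis using p_pos(3) by (simp add: field_simps)
qed

lemma lyapunov_pos:
  assumes "0 < \<alpha>" "\<alpha> < \<beta>"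
  shows "0 < lyapunov \<alpha>"
proof -
  have "p1 * ln \<alpha> < 0" "p2 * ln \<beta> < 0" "p3 * ln \<gamma> < 0"
    using assms \<beta> \<gamma> p_pos by (auto intro!: mult_pos_neg)
  then show ?thesis unfolding lyapunov_eq[OF assms(1)] using p_pos by (intro divide_pos_pos) linarith+
qed

lemma suminf_ennreal_geometric:
  assumes "0 \<le> x" "x < 1"
  shows "(\<Sum>n. ennreal (x ^ n)) = ennreal (1 / (1 - x))"
  using assms by (subst suminf_ennreal2) (auto simp: suminf_geometric summable_geometric)

text \<open>Gibbs' inequality: the contraction ratios of the block maps sum to
\<open>\<gamma> / ((1 - \<alpha>) (1 - \<beta>)) \<le> 1\<close>.\<close>

lemma entropy_le_lyapunov:
  assumes "0 < \<alpha>" "\<alpha> < \<beta>"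
  shows "block_entropy \<le> lyapunov \<alpha>"
proof -
  let ?w = "\<lambda>x. \<gamma> * block_ratio \<alpha> x"
  let ?d = "\<lambda>x. - ln (pmf block_pmf x) - - ln (?w x)"
  note int = linear_growth_integrable[OF linear_growth_information]
    linear_growth_integrable[OF linear_growth_step_ratio[OF assms(1)]]
  have w: "0 < ?w x" for x using \<gamma> block_ratio_pos[OF assms(1)] by simp
  have "(\<integral>\<^sup>+x. ennreal (1 + ?d x) \<partial>block_pmf) \<le> (\<integral>\<^sup>+x. ennreal (?w x / pmf block_pmf x) \<partial>block_pmf)"
  proof (intro nn_integral_mono ennreal_leI)
    fix x
    have "ln (?w x / pmf block_pmf x) \<le> ?w x / pmf block_pmf x - 1"
      using w pmf_block_pos by (intro ln_le_minus_one divide_pos_pos)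
    then show "1 + ?d x \<le> ?w x / pmf block_pmf x"
      using ln_divide_pos[OF w pmf_block_pos, of x x] by linarith
  qed
  also have "\<dots> = (\<integral>\<^sup>+x. ennreal (?w x) \<partial>count_space UNIV)"
    unfolding nn_integral_measure_pmf
    using w pmf_block_pos by (intro nn_integral_cong) (simp add: ennreal_mult[symmetric] less_imp_le less_imp_neq[symmetric] order.strict_implies_not_eq)
  also have "\<dots> = (\<integral>\<^sup>+a. \<integral>\<^sup>+b. ennreal (\<gamma> * \<alpha> ^ a) * ennreal (\<beta> ^ b) \<partial>count_space UNIV \<partial>count_space UNIV)"
    by (subst nn_integral_fst_count_space[symmetric])
      (use assms \<gamma> \<beta> in \<open>simp add: block_ratio_def ennreal_mult[symmetric] mult.assoc\<close>)
  also have "\<dots> = ennreal (\<gamma> * (1 / (1 - \<alpha>)) * (1 / (1 - \<beta>)))"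
  proof -
    have geo: "(\<integral>\<^sup>+n. ennreal (x ^ n) \<partial>count_space UNIV) = ennreal (1 / (1 - x))"
      if "0 < x" "x < 1" for x :: real
      unfolding nn_integral_count_space_nat using that by (intro suminf_ennreal_geometric) auto
    have "(\<integral>\<^sup>+a. \<integral>\<^sup>+b. ennreal (\<gamma> * \<alpha> ^ a) * ennreal (\<beta> ^ b) \<partial>count_space UNIV \<partial>count_space UNIV) =
        ennreal \<gamma> * ennreal (1 / (1 - \<alpha>)) * ennreal (1 / (1 - \<beta>))"
      using assms \<gamma> \<beta> by (simp add: nn_integral_cmult nn_integral_multc geo ennreal_mult)
    then show ?thesis using assms \<gamma> \<beta> by (simp add: ennreal_mult[symmetric])
  qed
  also have "\<dots> \<le> ennreal 1"
  proof (rule ennreal_leI)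
    have "1 / (1 - \<alpha>) \<le> 9 / 8" "1 / (1 - \<beta>) \<le> 9 / 8"
      using assms \<beta> by (simp_all add: field_simps)
    then have "\<gamma> * (1 / (1 - \<alpha>)) * (1 / (1 - \<beta>)) \<le> 1 / 9 * (9 / 8) * (9 / 8)"
      using assms \<gamma> \<beta> by (intro mult_mono mult_nonneg_nonneg) auto
    also have "1 / 9 * (9 / 8) * (9 / 8) \<le> (1 :: real)" by simp
    finally show "\<gamma> * (1 / (1 - \<alpha>)) * (1 / (1 - \<beta>)) \<le> 1" .
  qed
  finally have nn: "(\<integral>\<^sup>+x. ennreal (1 + ?d x) \<partial>block_pmf) \<le> ennreal 1" .
  have "measure_pmf.expectation block_pmf (\<lambda>x. 1 + ?d x) \<le> 1"
  proof -
    have i: "integrable block_pmf (\<lambda>x. 1 + ?d x)" using int by auto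
    have "measure_pmf.expectation block_pmf (\<lambda>x. 1 + ?d x) \<le> enn2real (\<integral>\<^sup>+x. ennreal (1 + ?d x) \<partial>block_pmf)"
      unfolding real_lebesgue_integral_def[OF i] by simp
    also have "\<dots> \<le> 1" using enn2real_mono[OF nn] by simp
    finally show ?thesis .
  qed
  moreover have "measure_pmf.expectation block_pmf (\<lambda>x. 1 + ?d x) = 1 + block_entropy - lyapunov \<alpha>"
    unfolding block_entropy_def lyapunov_def using int by simp
  ultimately show ?thesis by linarith
qed

end

section \<open>Limits of real sequences\<close>

lemma eventually_le_imp_le_multiple:
  fixes f g :: "nat \<Rightarrow> real"
  assumes "eventually (\<lambda>n. f n \<le> g n) sequentially" "\<And>n. 0 < g n"
  obtains C where "1 \<le> C" "\<And>n. f n \<le> C * g n"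
proof -
  obtain m where m: "\<And>n. m \<le> n \<Longrightarrow> f n \<le> g n"
    using assms(1) unfolding eventually_sequentially by blast
  define C where "C = 1 + (\<Sum>n<m. \<bar>f n\<bar> / g n)"
  have terms: "0 \<le> \<bar>f n\<bar> / g n" for n using assms(2)[of n] by simp
  then have C1: "1 \<le> C" unfolding C_def by (simp add: sum_nonneg)
  moreover have "f n \<le> C * g n" for n
  proof (cases "m \<le> n")
    case True
    have "1 * g n \<le> C * g n" using C1 assms(2)[of n] by (intro mult_right_mono) auto
    then show ?thesis using m[OF True] by simp
  next
    case False
    then have "\<bar>f n\<bar> / g n \<le> (\<Sum>n<m. \<bar>f n\<bar> / g n)"
      using terms by (intro member_le_sum) auto
    then have "\<bar>f n\<bar> / g n \<le> C" unfolding C_def by simp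
    then show ?thesis using assms(2)[of n] by (simp add: pos_divide_le_eq)
  qed
  ultimately show thesis by (rule that)
qed

lemma summable_mult_power:
  fixes x :: real
  assumes "0 < x" "x < 1"
  shows "summable (\<lambda>n. real n * x ^ n)"
proof (rule summable_comparison_test')
  show "summable (\<lambda>n. of_nat (Suc n) * x ^ n)"
    using geometric_deriv_sums[of x] assms by (intro sums_summable) auto
  show "norm (real n * x ^ n) \<le> of_nat (Suc n) * x ^ n" if "0 \<le> n" for n
    using assms by (simp add: mult_right_mono)
qed

lemma eventually_less_linear:
  fixes z d :: real
  assumes "0 < d"
  shows "eventually (\<lambda>n. z < d * real n) sequentially"
proof -
  have "eventually (\<lambda>n. z / d < real n) sequentially"
    using filterlim_real_sequentially unfolding filterlim_at_top_dense by blast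
  then show ?thesis by eventually_elim (use assms in \<open>simp add: pos_divide_less_eq mult.commute\<close>)
qed

text \<open>With \<open>\<phi> t\<close> the negative logarithm of the mass of a ball of radius \<open>exp (- t)\<close>, this
combines an upper bound along the lengths of cylinders and a lower bound along arithmetic progressions
of slope close to \<open>L\<close> to the limit of \<open>\<phi> n / n\<close>.\<close>

lemma tendsto_exponent_quotient:
  fixes \<phi> :: "real \<Rightarrow> real" and A B :: "nat \<Rightarrow> real"
  assumes mono: "\<And>s t. s \<le> t \<Longrightarrow> \<phi> s \<le> \<phi> t"
    and A: "(\<lambda>n. A n / real n) \<longlonglongrightarrow> H" and B: "(\<lambda>n. B n / real n) \<longlonglongrightarrow> L"
    and H: "0 \<le> H" and L: "0 < L"
    and upper: "\<And>n. \<phi> (B n) \<le> A n"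
    and lower: "\<And>e. 0 < e \<Longrightarrow> eventually (\<lambda>n. real n * (H - e) - c \<le> \<phi> (real n * (L + e))) sequentially"
  shows "(\<lambda>n. \<phi> (real n) / real n) \<longlonglongrightarrow> H / L"
proof (rule order_tendstoI)
  fix u assume u: "H / L < u"
  have u0: "0 < u" using le_less_trans[OF divide_nonneg_pos[OF H L] u] .
  define w where "w = H / u"
  \<comment> \<open>Any slope between \<open>H / u\<close> and \<open>L\<close> works: cylinders of about \<open>n / l\<close> blocks are eventually shorter than \<open>exp (- n)\<close>.\<close>
  define l where "l = (L + w) / 2"
  have "w < L" unfolding w_def using u u0 L by (simp add: field_simps)
  moreover have "0 \<le> w" unfolding w_def using H u0 by simp
  ultimately have l: "0 < l" "l < L" "w < l" unfolding l_def using L by simp_all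
  define ul where "ul = u * l"
  define v where "v = (H + ul) / 2"
  have "H < ul" using l(3) u0 unfolding w_def ul_def by (simp add: pos_divide_less_eq mult.commute)
  then have v: "0 < v" "H < v" "v < ul" unfolding v_def using H by simp_all
  define N where "N = (\<lambda>n. nat \<lceil>real n / l\<rceil>)"
  have N: "real n \<le> real (N n) * l" "real (N n) \<le> real n / l + 1" for n
  proof -
    have "0 \<le> real n / l" using l by simp
    then have *: "real n / l \<le> real (N n)" "real (N n) \<le> real n / l + 1" unfolding N_def by linarith+
    then show "real n \<le> real (N n) * l" "real (N n) \<le> real n / l + 1"
      using l(1) by (simp_all add: pos_divide_le_eq)
  qed
  have N_top: "filterlim N sequentially sequentially"
    unfolding filterlim_at_top
  proof
    fix Z :: nat
    have "0 < 1 / l" using l(1) by simp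
    from eventually_less_linear[OF this, of "real Z"] show "eventually (\<lambda>n. Z \<le> N n) sequentially"
    proof eventually_elim
      case (elim n)
      have "real n / l \<le> real (N n)" using N(1)[of n] l(1) by (simp add: pos_divide_le_eq)
      then show ?case using elim by simp
    qed
  qed
  have "eventually (\<lambda>n. l < B n / real n) sequentially" using order_tendstoD(1)[OF B l(2)] .
  then have evB: "eventually (\<lambda>n. l < B (N n) / real (N n)) sequentially"
    using N_top by (rule eventually_compose_filterlim)
  have "eventually (\<lambda>n. A n / real n < v) sequentially" using order_tendstoD(2)[OF A v(2)] .
  then have evA: "eventually (\<lambda>n. A (N n) / real (N n) < v) sequentially"
    using N_top by (rule eventually_compose_filterlim)
  have d: "0 < u - v / l" using v(3) l(1) unfolding ul_def by (simp add: pos_divide_less_eq)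
  show "eventually (\<lambda>n. \<phi> (real n) / real n < u) sequentially"
    using evA evB eventually_less_linear[OF d, of v] eventually_gt_at_top[of 0]
  proof eventually_elim
    case (elim n)
    have Npos: "0 < real (N n)" using N(1)[of n] elim(4) by (cases "N n = 0") auto
    have "real n \<le> B (N n)"
      using elim(2) Npos N(1)[of n] by (simp add: pos_less_divide_eq mult.commute)
    then have "\<phi> (real n) \<le> A (N n)" using mono[of "real n" "B (N n)"] upper[of "N n"] by linarith
    also have "A (N n) < v * real (N n)" using elim(1) Npos by (simp add: pos_divide_less_eq)
    also have "\<dots> \<le> v * (real n / l + 1)" using N(2) v(1) by (intro mult_left_mono) auto
    also have "\<dots> < u * real n" using elim(3) by (simp add: algebra_simps)
    finally show ?case using elim(4) by (simp add: pos_divide_less_eq)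
  qed
next
  fix u assume u: "u < H / L"
  \<comment> \<open>Chosen such that \<open>u < (H - e) / (L + e)\<close>.\<close>
  define e where "e = (H - u * L) / (2 * (\<bar>u\<bar> + 1))"
  have pos: "0 < H - u * L" using u L by (simp add: pos_less_divide_eq)
  then have e: "0 < e" unfolding e_def by simp
  have "e * (u + 1) \<le> e * (\<bar>u\<bar> + 1)" using e by (intro mult_left_mono) auto
  also have "\<dots> = (H - u * L) / 2" unfolding e_def by (simp add: field_simps)
  finally have "u * (L + e) < H - e" using pos by (simp add: algebra_simps)
  then have d: "0 < (H - e) / (L + e) - u" using e L by (simp add: pos_less_divide_eq)
  define N where "N = (\<lambda>n. nat \<lfloor>real n / (L + e)\<rfloor>)"
  have N: "real (N n) \<le> real n / (L + e)" "real n / (L + e) - 1 \<le> real (N n)" for n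
  proof -
    have "0 \<le> real n / (L + e)" using e L by simp
    then show "real (N n) \<le> real n / (L + e)" "real n / (L + e) - 1 \<le> real (N n)"
      unfolding N_def by linarith+
  qed
  have N_top: "filterlim N sequentially sequentially"
    unfolding filterlim_at_top
  proof
    fix Z :: nat
    have "0 < 1 / (L + e)" using e L by simp
    from eventually_less_linear[OF this, of "real Z + 1"] show "eventually (\<lambda>n. Z \<le> N n) sequentially"
    proof eventually_elim
      case (elim n)
      then show ?case using N(2)[of n] by simp
    qed
  qed
  have ev: "eventually (\<lambda>n. real (N n) * (H - e) - c \<le> \<phi> (real (N n) * (L + e))) sequentially"
    using lower[OF e] N_top by (rule eventually_compose_filterlim)
  show "eventually (\<lambda>n. u < \<phi> (real n) / real n) sequentially"
    using ev eventually_less_linear[OF d, of "\<bar>H - e\<bar> + c"] eventually_gt_at_top[of 0]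
  proof eventually_elim
    case (elim n)
    have "\<bar>(real (N n) - real n / (L + e)) * (H - e)\<bar> \<le> 1 * \<bar>H - e\<bar>"
      unfolding abs_mult using N[of n] by (intro mult_right_mono) auto
    then have "real n / (L + e) * (H - e) - \<bar>H - e\<bar> \<le> real (N n) * (H - e)"
      by (simp add: left_diff_distrib abs_le_iff)
    moreover have "real (N n) * (L + e) \<le> real n"
      using N(1)[of n] e L by (simp add: pos_le_divide_eq)
    then have "\<phi> (real (N n) * (L + e)) \<le> \<phi> (real n)" by (rule mono)
    moreover have "real n / (L + e) * (H - e) - u * real n = ((H - e) / (L + e) - u) * real n"
      by (simp add: left_diff_distrib right_diff_distrib mult.commute)
    ultimately have "u * real n < \<phi> (real n)" using elim(1,2) by linarith
    then show ?case using elim(3) by (simp add: pos_less_divide_eq)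
  qed
qed

section \<open>The law of the coding map\<close>

context two_ratios
begin

lemma measurable_coding:
  fixes q :: "(nat \<times> nat) pmf"
  assumes f: "f \<in> borel_measurable M" and g: "g \<in> measurable M (iid q)"
  shows "(\<lambda>x. coding (f x) (g x)) \<in> borel_measurable M"
proof -
  have comp: "(\<lambda>x. g x i) \<in> measurable M (count_space UNIV)" for i
    by (rule measurable_compose[OF g measurable_iid_component])
  have "(\<lambda>x. block_ratio (f x) y) \<in> borel_measurable M" for y
    unfolding block_ratio_def by (intro borel_measurable_times borel_measurable_power f borel_measurable_const)
  then have "(\<lambda>x. block_ratio (f x) (g x i)) \<in> borel_measurable M" for i
    by (rule measurable_compose_countable[OF _ comp])
  then show ?thesis
    unfolding coding_def cylinder_ratio_def
    by (intro borel_measurable_suminf borel_measurable_times borel_measurable_prod borel_measurable_const)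
qed

end

context common_fixed_point
begin

lemma AE_averages:
  assumes "0 < \<alpha>"
  shows "AE \<omega> in iid block_pmf. (\<lambda>n. - ln (\<Prod>i<n. pmf block_pmf (\<omega> i)) / real n) \<longlonglongrightarrow> block_entropy"
    "AE \<omega> in iid block_pmf. (\<lambda>n. - ln (cylinder_ratio \<alpha> \<omega> n) / real n) \<longlonglongrightarrow> lyapunov \<alpha>"
proof -
  have slln: "AE \<omega> in iid block_pmf. (\<lambda>n. (\<Sum>i<n. f (\<omega> i)) / real n) \<longlonglongrightarrow> measure_pmf.expectation block_pmf f"
    if f: "linear_growth f" for f
  proof -
    obtain s where "0 < s" "integrable block_pmf (\<lambda>x. exp (s * \<bar>f x\<bar>))"
      using linear_growth_exponential_moment[OF f] by blast
    then show ?thesis using linear_growth_integrable[OF f] by (rule strong_law)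
  qed
  have "- ln (\<Prod>i<n. pmf block_pmf (\<omega> i)) = (\<Sum>i<n. - ln (pmf block_pmf (\<omega> i)))" for n :: nat and \<omega>
    using ln_prod[of "{..<n}" "\<lambda>i. pmf block_pmf (\<omega> i)"] pmf_block_pos by (simp add: sum_negf less_imp_neq[symmetric])
  then show "AE \<omega> in iid block_pmf. (\<lambda>n. - ln (\<Prod>i<n. pmf block_pmf (\<omega> i)) / real n) \<longlonglongrightarrow> block_entropy"
    using slln[OF linear_growth_information] unfolding block_entropy_def by simp
  have "- ln (cylinder_ratio \<alpha> \<omega> n) = (\<Sum>i<n. - ln (\<gamma> * block_ratio \<alpha> (\<omega> i)))" for n :: nat and \<omega>
    unfolding cylinder_ratio_def using \<gamma>(1) block_ratio_pos[OF assms]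
      ln_prod[of "{..<n}" "\<lambda>i. \<gamma> * block_ratio \<alpha> (\<omega> i)"] by (simp add: sum_negf less_imp_neq[symmetric])
  then show "AE \<omega> in iid block_pmf. (\<lambda>n. - ln (cylinder_ratio \<alpha> \<omega> n) / real n) \<longlonglongrightarrow> lyapunov \<alpha>"
    using slln[OF linear_growth_step_ratio[OF assms]] unfolding lyapunov_def by simp
qed

text \<open>The law of the coding map is the mixture, over the first block, of the images of \<open>(S\<^sub>3)\<^sub>* \<nu>\<close>
under multiplication by \<open>\<alpha>\<^sup>a \<beta>\<^sup>b\<close>.  The Pascal recursion splits it into the contribution of
the empty block, which is \<open>p\<^sub>3 (S\<^sub>3)\<^sub>* \<nu>\<close>, and two mixtures in which a factor
\<open>\<alpha>\<close> or \<open>\<beta>\<close> has been split off.\<close>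

lemma self_similar_coding:
  assumes \<alpha>: "0 < \<alpha>" "\<alpha> < \<beta>"
  shows "is_self_similar_measure (ifs \<alpha> \<beta> \<gamma>) [p1, p2, p3] (distr (iid block_pmf) borel (coding \<alpha>))"
proof -
  let ?\<nu> = "distr (iid block_pmf) borel (coding \<alpha>)"
  have \<alpha>': "\<alpha> < 1 / 9" using \<alpha> \<beta> by simp
  have cm: "coding \<alpha> \<in> borel_measurable (iid block_pmf)"
    using measurable_coding[OF borel_measurable_const measurable_ident_sets[OF refl]] by simp
  have emb: "emeasure (distr ?\<nu> borel S) A = (\<integral>\<^sup>+\<omega>. indicator A (S (coding \<alpha> \<omega>)) \<partial>iid block_pmf)"
    if S: "S \<in> borel_measurable borel" and A: "A \<in> sets borel" for S :: "real \<Rightarrow> real" and A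
  proof -
    have ind: "(indicator A :: real \<Rightarrow> ennreal) \<in> borel_measurable borel"
      by (rule borel_measurable_indicator[OF A])
    have S\<nu>: "S \<in> borel_measurable ?\<nu>" using S by simp
    have "emeasure (distr ?\<nu> borel S) A = (\<integral>\<^sup>+x. indicator A x \<partial>distr ?\<nu> borel S)"
      by (rule nn_integral_indicator[symmetric]) (use A in simp)
    also have "\<dots> = (\<integral>\<^sup>+x. indicator A (S x) \<partial>?\<nu>)"
      by (rule nn_integral_distr[OF S\<nu>], unfold measurable_distr_eq1, rule ind)
    also have "\<dots> = (\<integral>\<^sup>+\<omega>. indicator A (S (coding \<alpha> \<omega>)) \<partial>iid block_pmf)"
      by (rule nn_integral_distr[OF cm], unfold measurable_distr_eq1, rule measurable_compose[OF S ind])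
    finally show ?thesis .
  qed
  have shift: "coding \<alpha> (case_nat x \<omega>) = block_ratio \<alpha> x * (\<gamma> * coding \<alpha> \<omega> + 1 - \<gamma>)" for x \<omega>
    using coding_Suc[OF \<alpha>(1) \<alpha>', of "case_nat x \<omega>"] by simp
  have split: "(\<integral>\<^sup>+\<omega>. indicator A (S (coding \<alpha> \<omega>)) \<partial>iid block_pmf) =
      (\<integral>\<^sup>+x. \<integral>\<^sup>+\<omega>. indicator A (S (block_ratio \<alpha> x * (\<gamma> * coding \<alpha> \<omega> + 1 - \<gamma>))) \<partial>iid block_pmf \<partial>block_pmf)"
    if S: "S \<in> borel_measurable borel" and A: "A \<in> sets borel" for S :: "real \<Rightarrow> real" and A
    using nn_integral_iid_split[OF measurable_compose[OF measurable_compose[OF cm S]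
          borel_measurable_indicator[OF A]]]
    by (simp only: shift)
  have identity: "emeasure ?\<nu> A = ennreal p1 * emeasure (distr ?\<nu> borel (\<lambda>x. \<alpha> * x)) A
      + ennreal p2 * emeasure (distr ?\<nu> borel (\<lambda>x. \<beta> * x)) A
      + ennreal p3 * emeasure (distr ?\<nu> borel (\<lambda>x. \<gamma> * x + 1 - \<gamma>)) A" if A: "A \<in> sets borel" for A
  proof -
    define G where "G = (\<lambda>x. \<integral>\<^sup>+\<omega>. indicator A (block_ratio \<alpha> x * (\<gamma> * coding \<alpha> \<omega> + 1 - \<gamma>)) \<partial>iid block_pmf)"
    have id_meas: "(\<lambda>x::real. x) \<in> borel_measurable borel" by simp
    have "emeasure ?\<nu> A = emeasure (distr ?\<nu> borel (\<lambda>x. x)) A"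
      by (simp add: distr_id2)
    also have "\<dots> = (\<integral>\<^sup>+x. G x \<partial>block_pmf)"
      unfolding G_def using emb[OF id_meas A] split[OF id_meas A] by (simp only:)
    also have "\<dots> = ennreal p3 * G (0, 0) + ennreal p1 * (\<integral>\<^sup>+(a, b). G (Suc a, b) \<partial>block_pmf)
        + ennreal p2 * (\<integral>\<^sup>+(a, b). G (a, Suc b) \<partial>block_pmf)"
      by (rule nn_integral_block_Pascal)
    also have "G (0, 0) = emeasure (distr ?\<nu> borel (\<lambda>x. \<gamma> * x + 1 - \<gamma>)) A"
      using emb[of "\<lambda>x. \<gamma> * x + 1 - \<gamma>" A] A by (simp add: G_def block_ratio_def)
    also have "(\<integral>\<^sup>+(a, b). G (Suc a, b) \<partial>block_pmf) = emeasure (distr ?\<nu> borel (\<lambda>x. \<alpha> * x)) A"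
      using emb[of "\<lambda>x. \<alpha> * x" A] split[of "\<lambda>x. \<alpha> * x" A] A
      by (simp add: G_def block_ratio_def case_prod_unfold mult.assoc)
    also have "(\<integral>\<^sup>+(a, b). G (a, Suc b) \<partial>block_pmf) = emeasure (distr ?\<nu> borel (\<lambda>x. \<beta> * x)) A"
      using emb[of "\<lambda>x. \<beta> * x" A] split[of "\<lambda>x. \<beta> * x" A] A
      by (simp add: G_def block_ratio_def case_prod_unfold mult_ac)
    finally show ?thesis by (simp add: add_ac)
  qed
  show ?thesis
    unfolding is_self_similar_measure_def
  proof (intro conjI ballI)
    show "prob_space ?\<nu>" by (rule prob_space.prob_space_distr[OF prob_space_iid cm])
    show "sets ?\<nu> = sets borel" by simp
    have "emeasure ?\<nu> (- {0..1}) = emeasure (iid block_pmf) (coding \<alpha> -` (- {0..1}) \<inter> space (iid block_pmf))"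
      by (rule emeasure_distr[OF cm]) simp
    also have "coding \<alpha> -` (- {0..1}) = {}"
      using coding_nonneg[OF \<alpha>(1) \<alpha>'] coding_le_1[OF \<alpha>(1) \<alpha>'] by auto
    finally have "emeasure ?\<nu> (- {0..1}) = 0" by simp
    then show "\<exists>K. compact K \<and> emeasure ?\<nu> (- K) = 0" using compact_Icc by blast
    show "emeasure ?\<nu> A = (\<Sum>i<length (ifs \<alpha> \<beta> \<gamma>). ennreal ([p1, p2, p3] ! i) * emeasure (distr ?\<nu> borel (ifs \<alpha> \<beta> \<gamma> ! i)) A)"
      if "A \<in> sets borel" for A
      using identity[OF that] by (simp add: ifs_def eval_nat_numeral lessThan_Suc add_ac)
  qed
qed

lemma nu_eq_distr_coding:
  assumes \<alpha>: "0 < \<alpha>" "\<alpha> < \<beta>"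
  shows "nu p1 p2 p3 \<alpha> \<beta> \<gamma> = distr (iid block_pmf) borel (coding \<alpha>)"
  unfolding nu_def self_similar_measure_def
proof (rule the_equality)
  show "is_self_similar_measure (ifs \<alpha> \<beta> \<gamma>) [p1, p2, p3] (distr (iid block_pmf) borel (coding \<alpha>))"
    by (rule self_similar_coding[OF assms])
  fix \<mu> assume \<mu>: "is_self_similar_measure (ifs \<alpha> \<beta> \<gamma>) [p1, p2, p3] \<mu>"
  have idx: "i = 0 \<or> i = 1 \<or> i = 2" if "i < length (ifs \<alpha> \<beta> \<gamma>)" for i
    using that by (auto simp: ifs_def)
  show "\<mu> = distr (iid block_pmf) borel (coding \<alpha>)"
  proof (rule self_similar_measure_unique[OF \<mu> self_similar_coding[OF assms]])
    show "(ifs \<alpha> \<beta> \<gamma> ! i) x = [\<alpha>, \<beta>, \<gamma>] ! i * x + [0, 0, 1 - \<gamma>] ! i" if "i < length (ifs \<alpha> \<beta> \<gamma>)" for i x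
      using idx[OF that] by (auto simp: ifs_def)
    show "0 \<le> [p1, p2, p3] ! i" if "i < length (ifs \<alpha> \<beta> \<gamma>)" for i
      using idx[OF that] p_pos by auto
    show "\<bar>[\<alpha>, \<beta>, \<gamma>] ! i\<bar> \<le> 1 / 9" if "i < length (ifs \<alpha> \<beta> \<gamma>)" for i
      using idx[OF that] \<alpha> \<beta> \<gamma> by auto
    show "(\<Sum>i<length (ifs \<alpha> \<beta> \<gamma>). [p1, p2, p3] ! i) = 1"
      using p_sum by (simp add: ifs_def eval_nat_numeral lessThan_Suc add_ac)
  qed auto
qed

end

section \<open>Masses of balls\<close>

context common_fixed_point
begin

definition ball_mass :: "real \<Rightarrow> real \<Rightarrow> (nat \<Rightarrow> nat \<times> nat) \<Rightarrow> real" where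
  "ball_mass \<alpha> r \<omega> = measure (iid block_pmf) {\<tau>. dist (coding \<alpha> \<omega>) (coding \<alpha> \<tau>) \<le> r}"

lemma coding_measurable: "coding \<alpha> \<in> borel_measurable (iid block_pmf)"
  using measurable_coding[OF borel_measurable_const measurable_ident_sets[OF refl]] by simp

lemma sets_near: "{\<tau>. dist x (coding \<alpha> \<tau>) \<le> r} \<in> sets (iid block_pmf)"
proof -
  have "{\<tau> \<in> space (iid block_pmf). dist x (coding \<alpha> \<tau>) \<le> r} \<in> sets (iid block_pmf)"
    by (intro borel_measurable_le borel_measurable_dist borel_measurable_const coding_measurable)
  then show ?thesis by simp
qed

lemma measure_distr_coding_cball:
  "measure (distr (iid block_pmf) borel (coding \<alpha>)) (cball (coding \<alpha> \<omega>) r) = ball_mass \<alpha> r \<omega>"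
proof -
  have "measure (distr (iid block_pmf) borel (coding \<alpha>)) (cball (coding \<alpha> \<omega>) r) =
      measure (iid block_pmf) (coding \<alpha> -` cball (coding \<alpha> \<omega>) r \<inter> space (iid block_pmf))"
    by (rule measure_distr[OF coding_measurable]) simp
  also have "coding \<alpha> -` cball (coding \<alpha> \<omega>) r \<inter> space (iid block_pmf) =
      {\<tau>. dist (coding \<alpha> \<omega>) (coding \<alpha> \<tau>) \<le> r}" by auto
  finally show ?thesis unfolding ball_mass_def .
qed

lemma ball_mass_mono:
  assumes "r \<le> s"
  shows "ball_mass \<alpha> r \<omega> \<le> ball_mass \<alpha> s \<omega>"
proof -
  interpret prob_space "iid block_pmf" by (rule prob_space_iid)
  show ?thesis
    unfolding ball_mass_def using assms by (intro finite_measure_mono sets_near) auto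
qed

lemma sets_agree: "{\<tau>. \<forall>i<n. \<tau> i = \<omega> i} \<in> sets (iid block_pmf)"
proof -
  have "{\<tau> \<in> space (iid block_pmf). \<forall>i<n. \<tau> i = \<omega> i} \<in> sets (iid block_pmf)" by measurable
  then show ?thesis by simp
qed

lemma measure_cylinder:
  "measure (iid block_pmf) {\<tau>. \<forall>i<n. \<tau> i = \<omega> i} = (\<Prod>i<n. pmf block_pmf (\<omega> i))"
  using emeasure_iid_cylinder[of block_pmf n \<omega>] by (simp add: measure_def prod_nonneg)

lemma cylinder_mass_le_ball_mass:
  assumes \<alpha>: "0 < \<alpha>" "\<alpha> < \<beta>" and r: "cylinder_ratio \<alpha> \<omega> n \<le> r"
  shows "(\<Prod>i<n. pmf block_pmf (\<omega> i)) \<le> ball_mass \<alpha> r \<omega>"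
proof -
  interpret prob_space "iid block_pmf" by (rule prob_space_iid)
  have \<alpha>': "\<alpha> < 1 / 9" using \<alpha> \<beta> by simp
  have "{\<tau>. \<forall>i<n. \<tau> i = \<omega> i} \<subseteq> {\<tau>. dist (coding \<alpha> \<omega>) (coding \<alpha> \<tau>) \<le> r}"
  proof
    fix \<tau> assume "\<tau> \<in> {\<tau>. \<forall>i<n. \<tau> i = \<omega> i}"
    then have "coding \<alpha> \<omega> - coding \<alpha> \<tau> =
        cylinder_ratio \<alpha> \<omega> n * (coding \<alpha> (\<lambda>i. \<omega> (n + i)) - coding \<alpha> (\<lambda>i. \<tau> (n + i)))"
      by (intro coding_diff_common_prefix[OF \<alpha>(1) \<alpha>']) simp
    then have "dist (coding \<alpha> \<omega>) (coding \<alpha> \<tau>) =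
        cylinder_ratio \<alpha> \<omega> n * \<bar>coding \<alpha> (\<lambda>i. \<omega> (n + i)) - coding \<alpha> (\<lambda>i. \<tau> (n + i))\<bar>"
      using cylinder_ratio_pos[OF \<alpha>(1), of \<omega> n] by (simp add: dist_real_def abs_mult)
    also have "\<dots> \<le> cylinder_ratio \<alpha> \<omega> n * 1"
    proof (rule mult_left_mono)
      show "\<bar>coding \<alpha> (\<lambda>i. \<omega> (n + i)) - coding \<alpha> (\<lambda>i. \<tau> (n + i))\<bar> \<le> 1"
        using coding_nonneg[OF \<alpha>(1) \<alpha>', of "\<lambda>i. \<omega> (n + i)"] coding_le_1[OF \<alpha>(1) \<alpha>', of "\<lambda>i. \<omega> (n + i)"]
          coding_nonneg[OF \<alpha>(1) \<alpha>', of "\<lambda>i. \<tau> (n + i)"] coding_le_1[OF \<alpha>(1) \<alpha>', of "\<lambda>i. \<tau> (n + i)"]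
        by (simp add: abs_le_iff)
    qed (use cylinder_ratio_pos[OF \<alpha>(1), of \<omega> n] in simp)
    finally show "\<tau> \<in> {\<tau>. dist (coding \<alpha> \<omega>) (coding \<alpha> \<tau>) \<le> r}" using r by simp
  qed
  then show ?thesis
    unfolding ball_mass_def measure_cylinder[symmetric] by (rule finite_measure_mono[OF _ sets_near])
qed

lemma ball_mass_pos:
  assumes \<alpha>: "0 < \<alpha>" "\<alpha> < \<beta>" and r: "0 < r"
  shows "0 < ball_mass \<alpha> r \<omega>"
proof -
  have "(\<lambda>n. \<gamma> ^ n) \<longlonglongrightarrow> 0" using \<gamma> by (intro LIMSEQ_realpow_zero) auto
  then have "eventually (\<lambda>n. \<gamma> ^ n < r) sequentially" using r by (rule order_tendstoD(2))
  then obtain n where n: "\<gamma> ^ n < r" using eventually_happens'[OF sequentially_bot] by blast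
  have "cylinder_ratio \<alpha> \<omega> n \<le> r" using cylinder_ratio_le[of \<alpha> \<omega> n] \<alpha> \<beta> n by simp
  have "0 < (\<Prod>i<n. pmf block_pmf (\<omega> i))" using pmf_block_pos by (intro prod_pos) simp
  also have "\<dots> \<le> ball_mass \<alpha> r \<omega>" by (rule cylinder_mass_le_ball_mass[OF \<alpha>]) fact
  finally show ?thesis .
qed

lemma measurable_ball_mass:
  "(\<lambda>z. ball_mass (fst z) r (snd z)) \<in> borel_measurable (lborel \<Otimes>\<^sub>M iid block_pmf)"
proof -
  interpret prob_space "iid block_pmf" by (rule prob_space_iid)
  let ?M = "(lborel :: real measure) \<Otimes>\<^sub>M iid block_pmf"
  have f: "(\<lambda>z. fst (fst z)) \<in> borel_measurable (?M \<Otimes>\<^sub>M iid block_pmf)"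
    using measurable_compose[OF measurable_fst measurable_fst, of lborel "iid block_pmf" "iid block_pmf"] by simp
  have g: "(\<lambda>z. snd (fst z)) \<in> measurable (?M \<Otimes>\<^sub>M iid block_pmf) (iid block_pmf)"
    by (rule measurable_compose[OF measurable_fst measurable_snd])
  let ?Q = "{z \<in> space (?M \<Otimes>\<^sub>M iid block_pmf).
    dist (coding (fst (fst z)) (snd (fst z))) (coding (fst (fst z)) (snd z)) \<le> r}"
  have Q: "?Q \<in> sets (?M \<Otimes>\<^sub>M iid block_pmf)"
    by (intro borel_measurable_le borel_measurable_dist borel_measurable_const
        measurable_coding[OF f g] measurable_coding[OF f measurable_snd])
  have "Pair z -` ?Q = {\<tau>. dist (coding (fst z) (snd z)) (coding (fst z) \<tau>) \<le> r}" for z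
    by (auto simp: space_pair_measure)
  with measurable_emeasure_Pair[OF Q]
  have "(\<lambda>z. emeasure (iid block_pmf) {\<tau>. dist (coding (fst z) (snd z)) (coding (fst z) \<tau>) \<le> r}) \<in> borel_measurable ?M"
    by (simp only:)
  then show ?thesis
    unfolding ball_mass_def measure_def by (rule borel_measurable_enn2real)
qed

text \<open>Transversality applied to the sequences without their common prefix.  The prefix contracts distances
by a ratio that increases with the parameter, so its value at \<open>\<alpha>\<^sub>0\<close> gives a uniform bound.\<close>

lemma overlap_parameter_measure:
  assumes \<alpha>\<^sub>0: "0 < \<alpha>\<^sub>0" "\<alpha>\<^sub>0 < \<beta>" and r: "0 \<le> r"
    and n: "\<And>i. i < n \<Longrightarrow> \<omega> i = \<tau> i" "\<omega> n \<noteq> \<tau> n"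
  shows "emeasure lborel {\<alpha> \<in> {\<alpha>\<^sub>0<..<\<beta>}. dist (coding \<alpha> \<omega>) (coding \<alpha> \<tau>) \<le> r}
    \<le> ennreal (5 * r / cylinder_ratio \<alpha>\<^sub>0 \<omega> (Suc n))"
proof -
  let ?A = "{\<alpha> \<in> {\<alpha>\<^sub>0<..<\<beta>}. dist (coding \<alpha> \<omega>) (coding \<alpha> \<tau>) \<le> r}"
  let ?R = "cylinder_ratio \<alpha>\<^sub>0 \<omega> n"
  have R: "0 < ?R" using \<alpha>\<^sub>0 by (intro cylinder_ratio_pos)
  have c: "0 < block_ratio \<alpha>\<^sub>0 (\<omega> n)" using \<alpha>\<^sub>0 by (intro block_ratio_pos)
  have coding_borel: "(\<lambda>\<alpha>. coding \<alpha> \<rho>) \<in> borel_measurable borel" for \<rho>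
    using measurable_coding[where M = borel and f = "\<lambda>x. x" and g = "\<lambda>x. \<rho>" and q = block_pmf] by simp
  have "{\<alpha> \<in> space borel. dist (coding \<alpha> \<omega>) (coding \<alpha> \<tau>) \<le> r} \<in> sets borel"
    by (intro borel_measurable_le borel_measurable_dist borel_measurable_const coding_borel)
  from sets.Int[OF borel_open[OF open_greaterThanLessThan] this]
  have "{\<alpha>\<^sub>0<..<\<beta>} \<inter> {\<alpha> \<in> space borel. dist (coding \<alpha> \<omega>) (coding \<alpha> \<tau>) \<le> r} \<in> sets borel"
    .
  also have "{\<alpha>\<^sub>0<..<\<beta>} \<inter> {\<alpha> \<in> space borel. dist (coding \<alpha> \<omega>) (coding \<alpha> \<tau>) \<le> r} = ?A" by auto
  finally have A: "?A \<in> sets borel" .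
  have "emeasure lborel ?A \<le> ennreal (5 * (r / ?R) / block_ratio \<alpha>\<^sub>0 (\<omega> (n + 0)))"
  proof (rule transversality[where \<omega> = "\<lambda>i. \<omega> (n + i)" and \<tau> = "\<lambda>i. \<tau> (n + i)"])
    fix \<alpha> assume "\<alpha> \<in> ?A"
    then have \<alpha>: "\<alpha>\<^sub>0 < \<alpha>" "0 < \<alpha>" "\<alpha> < 1 / 9" and d: "\<bar>coding \<alpha> \<omega> - coding \<alpha> \<tau>\<bar> \<le> r"
      using \<alpha>\<^sub>0 \<beta> by (auto simp: dist_real_def)
    let ?D = "\<bar>coding \<alpha> (\<lambda>i. \<omega> (n + i)) - coding \<alpha> (\<lambda>i. \<tau> (n + i))\<bar>"
    have "?R * ?D \<le> cylinder_ratio \<alpha> \<omega> n * ?D"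
      using \<alpha>\<^sub>0 \<alpha> by (intro mult_right_mono cylinder_ratio_mono) auto
    also have "\<dots> = \<bar>coding \<alpha> \<omega> - coding \<alpha> \<tau>\<bar>"
      using coding_diff_common_prefix[OF \<alpha>(2,3), of n \<omega> \<tau>] n(1) cylinder_ratio_pos[OF \<alpha>(2), of \<omega> n]
      by (simp add: abs_mult)
    finally show "?D \<le> r / ?R" using d R by (simp add: pos_le_divide_eq mult.commute)
  next
    show "\<omega> (n + 0) \<noteq> \<tau> (n + 0)" using n(2) by simp
    show "0 \<le> r / ?R" using r R by simp
    show "?A \<subseteq> {\<alpha>\<^sub>0<..<\<beta>}" by blast
  qed (rule \<alpha>\<^sub>0 A)+
  also have "\<dots> \<le> ennreal (5 * r / cylinder_ratio \<alpha>\<^sub>0 \<omega> (Suc n))"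
  proof (rule ennreal_leI)
    have "?R * (\<gamma> * block_ratio \<alpha>\<^sub>0 (\<omega> n)) \<le> ?R * (1 * block_ratio \<alpha>\<^sub>0 (\<omega> n))"
      using R c \<gamma> by (intro mult_left_mono mult_right_mono) auto
    then have "5 * r / (?R * block_ratio \<alpha>\<^sub>0 (\<omega> n)) \<le> 5 * r / (?R * (\<gamma> * block_ratio \<alpha>\<^sub>0 (\<omega> n)))"
      using R c \<gamma> r by (intro divide_left_mono mult_pos_pos) auto
    then show "5 * (r / ?R) / block_ratio \<alpha>\<^sub>0 (\<omega> (n + 0)) \<le> 5 * r / cylinder_ratio \<alpha>\<^sub>0 \<omega> (Suc n)"
      by (simp add: cylinder_ratio_Suc)
  qed
  finally show ?thesis .
qed

definition separated_mass :: "nat \<Rightarrow> real \<Rightarrow> real \<Rightarrow> (nat \<Rightarrow> nat \<times> nat) \<Rightarrow> real" where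
  "separated_mass N r \<alpha> \<omega> = measure (iid block_pmf)
     {\<tau>. (\<exists>i<N. \<tau> i \<noteq> \<omega> i) \<and> dist (coding \<alpha> \<omega>) (coding \<alpha> \<tau>) \<le> r}"

lemma sets_separated:
  "{z \<in> space (lborel \<Otimes>\<^sub>M iid block_pmf). (\<exists>i<N. snd z i \<noteq> \<omega> i) \<and>
      dist (coding (fst z) \<omega>) (coding (fst z) (snd z)) \<le> r} \<in> sets (lborel \<Otimes>\<^sub>M iid block_pmf)"
proof -
  let ?M = "(lborel :: real measure) \<Otimes>\<^sub>M iid block_pmf"
  have f: "fst \<in> borel_measurable ?M" using measurable_fst[of lborel "iid block_pmf"] by simp
  have "{z \<in> space ?M. dist (coding (fst z) \<omega>) (coding (fst z) (snd z)) \<le> r} \<in> sets ?M"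
    using measurable_coding[OF f, of "\<lambda>_. \<omega>" block_pmf] measurable_coding[OF f measurable_snd]
    by (intro borel_measurable_le borel_measurable_dist borel_measurable_const) auto
  moreover have "{z \<in> space ?M. \<exists>i<N. snd z i \<noteq> \<omega> i} \<in> sets ?M"
  proof -
    have "snd -` (- {\<tau>. \<forall>i<N. \<tau> i = \<omega> i}) \<inter> space ?M \<in> sets ?M"
      using sets.compl_sets[OF sets_agree] by (intro measurable_sets[OF measurable_snd]) (simp add: Compl_eq_Diff_UNIV)
    also have "snd -` (- {\<tau>. \<forall>i<N. \<tau> i = \<omega> i}) \<inter> space ?M = {z \<in> space ?M. \<exists>i<N. snd z i \<noteq> \<omega> i}" by auto
    finally show ?thesis .
  qed
  ultimately show ?thesis by (intro sets.sets_Collect_conj)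
qed

lemma separated_mass_measurable:
  "(\<lambda>\<alpha>. separated_mass N r \<alpha> \<omega>) \<in> borel_measurable lborel"
proof -
  interpret prob_space "iid block_pmf" by (rule prob_space_iid)
  have "Pair \<alpha> -` {z \<in> space (lborel \<Otimes>\<^sub>M iid block_pmf). (\<exists>i<N. snd z i \<noteq> \<omega> i) \<and>
      dist (coding (fst z) \<omega>) (coding (fst z) (snd z)) \<le> r} =
      {\<tau>. (\<exists>i<N. \<tau> i \<noteq> \<omega> i) \<and> dist (coding \<alpha> \<omega>) (coding \<alpha> \<tau>) \<le> r}" for \<alpha>
    by (auto simp: space_pair_measure)
  with measurable_emeasure_Pair[OF sets_separated[of N \<omega> r]]
  have "(\<lambda>\<alpha>. emeasure (iid block_pmf) {\<tau>. (\<exists>i<N. \<tau> i \<noteq> \<omega> i) \<and> dist (coding \<alpha> \<omega>) (coding \<alpha> \<tau>) \<le> r})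
      \<in> borel_measurable lborel"
    by (simp only:)
  then show ?thesis
    unfolding separated_mass_def measure_def by (rule borel_measurable_enn2real)
qed

text \<open>By Fubini the integral is the expectation, over the second sequence, of the measure of the parameters
with a close encounter; the second sequence is classified by the first time at which it leaves
\<open>\<omega>\<close>.\<close>

lemma average_separated_mass:
  assumes \<alpha>\<^sub>0: "0 < \<alpha>\<^sub>0" "\<alpha>\<^sub>0 < \<beta>" and r: "0 \<le> r"
  shows "(\<integral>\<^sup>+\<alpha>. ennreal (indicator {\<alpha>\<^sub>0<..<\<beta>} \<alpha> * separated_mass N r \<alpha> \<omega>) \<partial>lborel)
    \<le> ennreal (\<Sum>n<N. (\<Prod>i<n. pmf block_pmf (\<omega> i)) * (5 * r / cylinder_ratio \<alpha>\<^sub>0 \<omega> (Suc n)))"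
proof -
  interpret \<Omega>: prob_space "iid block_pmf" by (rule prob_space_iid)
  interpret pair_sigma_finite "lborel :: real measure" "iid block_pmf" ..
  let ?M = "(lborel :: real measure) \<Otimes>\<^sub>M iid block_pmf"
  define Q where "Q = {z \<in> space ?M. (\<exists>i<N. snd z i \<noteq> \<omega> i) \<and>
      dist (coding (fst z) \<omega>) (coding (fst z) (snd z)) \<le> r} \<inter> {\<alpha>\<^sub>0<..<\<beta>} \<times> UNIV"
  have Q: "Q \<in> sets ?M"
    unfolding Q_def using sets.top[of "iid block_pmf"] by (intro sets.Int sets_separated pair_measureI) auto
  have K: "0 \<le> 5 * r / cylinder_ratio \<alpha>\<^sub>0 \<omega> (Suc n)" for n
    using r cylinder_ratio_pos[OF \<alpha>\<^sub>0(1), of \<omega> "Suc n"] by simp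
  have inner: "ennreal (indicator {\<alpha>\<^sub>0<..<\<beta>} \<alpha> * separated_mass N r \<alpha> \<omega>) =
      (\<integral>\<^sup>+\<tau>. indicator Q (\<alpha>, \<tau>) \<partial>iid block_pmf)" for \<alpha>
  proof -
    have "(\<integral>\<^sup>+\<tau>. indicator Q (\<alpha>, \<tau>) \<partial>iid block_pmf) = (\<integral>\<^sup>+\<tau>. indicator (Pair \<alpha> -` Q) \<tau> \<partial>iid block_pmf)"
      by (simp add: indicator_def)
    also have "\<dots> = emeasure (iid block_pmf) (Pair \<alpha> -` Q)"
      using sets_Pair1[OF Q] by (rule nn_integral_indicator)
    also have "Pair \<alpha> -` Q = (if \<alpha> \<in> {\<alpha>\<^sub>0<..<\<beta>} then
        {\<tau>. (\<exists>i<N. \<tau> i \<noteq> \<omega> i) \<and> dist (coding \<alpha> \<omega>) (coding \<alpha> \<tau>) \<le> r} else {})"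
      by (auto simp: Q_def space_pair_measure)
    finally show ?thesis
      by (simp add: separated_mass_def \<Omega>.emeasure_eq_measure)
  qed
  have outer: "(\<integral>\<^sup>+\<alpha>. indicator Q (\<alpha>, \<tau>) \<partial>lborel) \<le>
      (\<Sum>n<N. ennreal (5 * r / cylinder_ratio \<alpha>\<^sub>0 \<omega> (Suc n)) * indicator {\<tau>. \<forall>i<n. \<tau> i = \<omega> i} \<tau>)" for \<tau>
  proof (cases "\<exists>i<N. \<tau> i \<noteq> \<omega> i")
    case True
    define n where "n = (LEAST i. \<tau> i \<noteq> \<omega> i)"
    have n: "\<tau> n \<noteq> \<omega> n" unfolding n_def using True by (metis (mono_tags, lifting) LeastI_ex)
    have n_less: "\<tau> i = \<omega> i" if "i < n" for i using that unfolding n_def by (metis (mono_tags, lifting) not_less_Least)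
    have nN: "n < N" using True unfolding n_def by (meson Least_le le_less_trans)
    have "(\<integral>\<^sup>+\<alpha>. indicator Q (\<alpha>, \<tau>) \<partial>lborel) = (\<integral>\<^sup>+\<alpha>. indicator ((\<lambda>\<alpha>. (\<alpha>, \<tau>)) -` Q) \<alpha> \<partial>lborel)"
      by (simp add: indicator_def)
    also have "\<dots> = emeasure lborel ((\<lambda>\<alpha>. (\<alpha>, \<tau>)) -` Q)"
      using sets_Pair2[OF Q] by (rule nn_integral_indicator)
    also have "(\<lambda>\<alpha>. (\<alpha>, \<tau>)) -` Q = {\<alpha> \<in> {\<alpha>\<^sub>0<..<\<beta>}. dist (coding \<alpha> \<omega>) (coding \<alpha> \<tau>) \<le> r}"
      using True by (auto simp: Q_def space_pair_measure)
    also have "emeasure lborel \<dots> \<le> ennreal (5 * r / cylinder_ratio \<alpha>\<^sub>0 \<omega> (Suc n))"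
      using n n_less by (intro overlap_parameter_measure \<alpha>\<^sub>0 r) auto
    also have "\<dots> = ennreal (5 * r / cylinder_ratio \<alpha>\<^sub>0 \<omega> (Suc n)) * indicator {\<tau>. \<forall>i<n. \<tau> i = \<omega> i} \<tau>"
      using n_less by (simp add: indicator_def)
    also have "\<dots> \<le> (\<Sum>n<N. ennreal (5 * r / cylinder_ratio \<alpha>\<^sub>0 \<omega> (Suc n)) * indicator {\<tau>. \<forall>i<n. \<tau> i = \<omega> i} \<tau>)"
      using nN by (intro member_le_sum) auto
    finally show ?thesis .
  next
    case False
    then have "indicator Q (\<alpha>, \<tau>) = (0 :: ennreal)" for \<alpha> by (simp add: Q_def)
    then show ?thesis by simp
  qed
  have "(\<integral>\<^sup>+\<alpha>. ennreal (indicator {\<alpha>\<^sub>0<..<\<beta>} \<alpha> * separated_mass N r \<alpha> \<omega>) \<partial>lborel) =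
      (\<integral>\<^sup>+\<alpha>. \<integral>\<^sup>+\<tau>. indicator Q (\<alpha>, \<tau>) \<partial>iid block_pmf \<partial>lborel)"
    by (simp only: inner)
  also have "\<dots> = (\<integral>\<^sup>+\<tau>. \<integral>\<^sup>+\<alpha>. indicator Q (\<alpha>, \<tau>) \<partial>lborel \<partial>iid block_pmf)"
    using Fubini[OF borel_measurable_indicator[OF Q]] by (rule sym)
  also have "\<dots> \<le> (\<integral>\<^sup>+\<tau>. (\<Sum>n<N. ennreal (5 * r / cylinder_ratio \<alpha>\<^sub>0 \<omega> (Suc n)) * indicator {\<tau>. \<forall>i<n. \<tau> i = \<omega> i} \<tau>) \<partial>iid block_pmf)"
    by (intro nn_integral_mono outer)
  also have "\<dots> = (\<Sum>n<N. \<integral>\<^sup>+\<tau>. ennreal (5 * r / cylinder_ratio \<alpha>\<^sub>0 \<omega> (Suc n)) * indicator {\<tau>. \<forall>i<n. \<tau> i = \<omega> i} \<tau> \<partial>iid block_pmf)"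
    by (intro nn_integral_sum borel_measurable_times_ennreal borel_measurable_const borel_measurable_indicator sets_agree)
  also have "\<dots> = (\<Sum>n<N. ennreal (5 * r / cylinder_ratio \<alpha>\<^sub>0 \<omega> (Suc n)) * ennreal (\<Prod>i<n. pmf block_pmf (\<omega> i)))"
    by (simp only: nn_integral_cmult_indicator[OF sets_agree] emeasure_iid_cylinder)
  also have "\<dots> = (\<Sum>n<N. ennreal ((\<Prod>i<n. pmf block_pmf (\<omega> i)) * (5 * r / cylinder_ratio \<alpha>\<^sub>0 \<omega> (Suc n))))"
    by (intro sum.cong refl, subst ennreal_mult[OF prod_nonneg K]) (simp_all only: mult.commute pmf_nonneg)
  also have "\<dots> = ennreal (\<Sum>n<N. (\<Prod>i<n. pmf block_pmf (\<omega> i)) * (5 * r / cylinder_ratio \<alpha>\<^sub>0 \<omega> (Suc n)))"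
    using K by (intro sum_ennreal mult_nonneg_nonneg prod_nonneg) auto
  finally show ?thesis .
qed

text \<open>The ball splits into the cylinder of \<open>N\<close> blocks about \<open>\<omega>\<close>, whose mass is given by the
strong law, and the sequences separated from \<open>\<omega>\<close> before time \<open>N\<close>.  Integrated over the
parameters, the mass of the latter is at most a constant times \<open>N exp (- N h)\<close>, because
\<open>h \<le> \<kappa>\<close> makes the last separation times dominate.  After multiplication by
\<open>exp (N h')\<close> this is still summable in \<open>N\<close>.\<close>

lemma AE_ball_mass_le_sequence:
  assumes \<alpha>\<^sub>0: "0 < \<alpha>\<^sub>0" "\<alpha>\<^sub>0 < \<beta>" and \<delta>: "0 < \<delta>"
    and P: "(\<lambda>n. - ln (\<Prod>i<n. pmf block_pmf (\<omega> i)) / real n) \<longlonglongrightarrow> block_entropy"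
    and R: "(\<lambda>n. - ln (cylinder_ratio \<alpha>\<^sub>0 \<omega> n) / real n) \<longlonglongrightarrow> lyapunov \<alpha>\<^sub>0"
  shows "AE \<alpha> in lborel. \<alpha> \<in> {\<alpha>\<^sub>0<..<\<beta>} \<longrightarrow> eventually (\<lambda>N.
      ball_mass \<alpha> (exp (- (real N * (lyapunov \<alpha>\<^sub>0 + \<delta>)))) \<omega>
        \<le> 2 * exp (- (real N * (block_entropy - \<delta>)))) sequentially"
proof -
  define \<kappa> where "\<kappa> = lyapunov \<alpha>\<^sub>0 + \<delta>"
  define h where "h = block_entropy - \<delta> / 2"
  define h' where "h' = block_entropy - \<delta>"
  define r where "r = (\<lambda>N. exp (- (real N * \<kappa>)))"
  define p where "p = (\<lambda>n. \<Prod>i<n. pmf block_pmf (\<omega> i))"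
  define \<rho> where "\<rho> = cylinder_ratio \<alpha>\<^sub>0 \<omega>"
  have p_pos: "0 < p n" for n unfolding p_def using pmf_block_pos by (intro prod_pos) simp
  have \<rho>_pos: "0 < \<rho> n" for n unfolding \<rho>_def using \<alpha>\<^sub>0 by (intro cylinder_ratio_pos)
  have h\<kappa>: "h \<le> \<kappa>" "h' < h"
    using entropy_le_lyapunov[OF \<alpha>\<^sub>0] \<delta> unfolding h_def \<kappa>_def h'_def by simp_all
  have "eventually (\<lambda>n. h < - ln (p n) / real n) sequentially"
    using P \<delta> unfolding p_def by (intro order_tendstoD(1)) (auto simp: h_def)
  then have p_ev: "eventually (\<lambda>n. p n \<le> exp (- (real n * h))) sequentially"
    using eventually_gt_at_top[of 0]
  proof eventually_elim
    case (elim n)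
    then have "h * real n < - ln (p n)" using pos_less_divide_eq[of "real n" h "- ln (p n)"] by simp
    then have "exp (ln (p n)) \<le> exp (- (real n * h))" by (simp add: mult.commute)
    then show ?case using p_pos[of n] by simp
  qed
  have "eventually (\<lambda>n. - ln (\<rho> n) / real n < \<kappa>) sequentially"
    using R \<delta> unfolding \<rho>_def by (intro order_tendstoD(2)) (auto simp: \<kappa>_def)
  then have "eventually (\<lambda>n. 1 / \<rho> n \<le> exp (real n * \<kappa>)) sequentially"
    using eventually_gt_at_top[of 0]
  proof eventually_elim
    case (elim n)
    then have "- ln (\<rho> n) < \<kappa> * real n" using pos_divide_less_eq[of "real n" "- ln (\<rho> n)" \<kappa>] by simp
    then have "- ln (\<rho> n) \<le> real n * \<kappa>" by (simp add: mult.commute)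
    then have "exp (- ln (\<rho> n)) \<le> exp (real n * \<kappa>)" by simp
    then show ?case using \<rho>_pos[of n] by (simp add: exp_minus inverse_eq_divide)
  qed
  then obtain D where D: "1 \<le> D" "\<And>n. 1 / \<rho> n \<le> D * exp (real n * \<kappa>)"
    by (rule eventually_le_imp_le_multiple) auto
  obtain C where C: "1 \<le> C" "\<And>n. p n \<le> C * exp (- (real n * h))"
    using p_ev by (rule eventually_le_imp_le_multiple) auto
  define B where "B = 5 * C * D * exp \<kappa>"
  have B: "0 \<le> B" unfolding B_def using C(1) D(1) by simp
  have summand: "p n * (5 * r N / \<rho> (Suc n)) \<le> B * exp (- (real N * h))" if "n < N" for n N
  proof -
    have "p n * (1 / \<rho> (Suc n)) \<le> (C * exp (- (real n * h))) * (D * exp (real (Suc n) * \<kappa>))"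
      using C(1) \<rho>_pos[of "Suc n"] by (intro mult_mono C(2) D(2)) auto
    then have "5 * r N * (p n * (1 / \<rho> (Suc n))) \<le>
        5 * r N * ((C * exp (- (real n * h))) * (D * exp (real (Suc n) * \<kappa>)))"
      by (intro mult_left_mono) (auto simp: r_def)
    also have "\<dots> = 5 * C * D * exp (- (real N * \<kappa>) - real n * h + real (Suc n) * \<kappa>)"
      unfolding r_def by (simp add: exp_add exp_diff exp_minus divide_inverse mult_ac)
    also have "\<dots> \<le> 5 * C * D * exp (\<kappa> - real N * h)"
    proof -
      have "real n * (\<kappa> - h) \<le> real N * (\<kappa> - h)" using that h\<kappa> by (intro mult_right_mono) auto
      then have "- (real N * \<kappa>) - real n * h + real (Suc n) * \<kappa> \<le> \<kappa> - real N * h"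
        by (simp add: algebra_simps)
      then show ?thesis using C(1) D(1) by (intro mult_left_mono) auto
    qed
    also have "\<dots> = B * exp (- (real N * h))"
      unfolding B_def by (simp add: exp_diff exp_minus divide_inverse)
    finally show ?thesis by (simp add: mult_ac)
  qed
  let ?f = "\<lambda>N \<alpha>. exp (real N * h') * (indicator {\<alpha>\<^sub>0<..<\<beta>} \<alpha> * separated_mass N (r N) \<alpha> \<omega>)"
  have "AE \<alpha> in lborel. (\<lambda>N. ?f N \<alpha>) \<longlonglongrightarrow> 0"
  proof (rule AE_tendsto_0_of_summable)
    have ind: "indicator {\<alpha>\<^sub>0<..<\<beta>} \<in> borel_measurable (lborel :: real measure)" by simp
    show "?f N \<in> borel_measurable lborel" for N
      by (intro borel_measurable_times borel_measurable_const separated_mass_measurable ind)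
    show "0 \<le> ?f N \<alpha>" for N \<alpha>
      unfolding separated_mass_def by (intro mult_nonneg_nonneg) simp_all
    show "(\<integral>\<^sup>+\<alpha>. ennreal (?f N \<alpha>) \<partial>lborel) \<le> ennreal (B * (real N * exp (h' - h) ^ N))" for N
    proof -
      have "(\<integral>\<^sup>+\<alpha>. ennreal (?f N \<alpha>) \<partial>lborel) = (\<integral>\<^sup>+\<alpha>. ennreal (exp (real N * h')) *
          ennreal (indicator {\<alpha>\<^sub>0<..<\<beta>} \<alpha> * separated_mass N (r N) \<alpha> \<omega>) \<partial>lborel)"
        by (intro nn_integral_cong ennreal_mult') simp
      also have "\<dots> = ennreal (exp (real N * h')) *
          (\<integral>\<^sup>+\<alpha>. ennreal (indicator {\<alpha>\<^sub>0<..<\<beta>} \<alpha> * separated_mass N (r N) \<alpha> \<omega>) \<partial>lborel)"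
        by (intro nn_integral_cmult measurable_compose[OF _ measurable_ennreal] borel_measurable_times separated_mass_measurable ind)
      also have "\<dots> \<le> ennreal (exp (real N * h')) * ennreal (\<Sum>n<N. p n * (5 * r N / \<rho> (Suc n)))"
        unfolding p_def \<rho>_def
        by (intro mult_left_mono average_separated_mass \<alpha>\<^sub>0) (simp_all add: r_def)
      also have "\<dots> \<le> ennreal (exp (real N * h')) * ennreal (\<Sum>n<N. B * exp (- (real N * h)))"
        by (intro mult_left_mono ennreal_leI sum_mono summand) simp_all
      also have "\<dots> = ennreal (exp (real N * h') * (real N * (B * exp (- (real N * h)))))"
        using B by (simp add: ennreal_mult)
      also have "exp (real N * h') * (real N * (B * exp (- (real N * h)))) = B * (real N * exp (real N * h' - real N * h))"
        by (simp add: exp_diff exp_minus divide_inverse mult_ac)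
      also have "exp (real N * h' - real N * h) = exp (h' - h) ^ N"
        by (simp add: exp_of_nat_mult[symmetric] right_diff_distrib)
      finally show ?thesis .
    qed
    show "0 \<le> B * (real N * exp (h' - h) ^ N)" for N using B by simp
    show "summable (\<lambda>N. B * (real N * exp (h' - h) ^ N))"
      using h\<kappa>(2) by (intro summable_mult summable_mult_power) auto
  qed
  then show ?thesis
  proof eventually_elim
    case (elim \<alpha>)
    show ?case
    proof
      assume \<alpha>: "\<alpha> \<in> {\<alpha>\<^sub>0<..<\<beta>}"
      interpret prob_space "iid block_pmf" by (rule prob_space_iid)
      have "eventually (\<lambda>N. ?f N \<alpha> < 1) sequentially" using elim by (rule order_tendstoD(2)) simp
      then show "eventually (\<lambda>N. ball_mass \<alpha> (exp (- (real N * (lyapunov \<alpha>\<^sub>0 + \<delta>)))) \<omega>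
        \<le> 2 * exp (- (real N * (block_entropy - \<delta>)))) sequentially"
        using p_ev unfolding \<kappa>_def[symmetric] h'_def[symmetric] r_def[symmetric]
      proof eventually_elim
        case (elim N)
        let ?S = "{\<tau>. (\<exists>i<N. \<tau> i \<noteq> \<omega> i) \<and> dist (coding \<alpha> \<omega>) (coding \<alpha> \<tau>) \<le> r N}"
        have "?S = {\<tau>. dist (coding \<alpha> \<omega>) (coding \<alpha> \<tau>) \<le> r N} - {\<tau>. \<forall>i<N. \<tau> i = \<omega> i}" by auto
        then have S: "?S \<in> sets (iid block_pmf)" using sets_near sets_agree by (simp only: sets.Diff)
        have "ball_mass \<alpha> (r N) \<omega> \<le> measure (iid block_pmf) (?S \<union> {\<tau>. \<forall>i<N. \<tau> i = \<omega> i})"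
          unfolding ball_mass_def by (rule finite_measure_mono[OF _ sets.Un[OF S sets_agree]]) auto
        also have "\<dots> \<le> measure (iid block_pmf) ?S + measure (iid block_pmf) {\<tau>. \<forall>i<N. \<tau> i = \<omega> i}"
          by (rule measure_Un_le[OF S sets_agree])
        also have "measure (iid block_pmf) ?S = separated_mass N (r N) \<alpha> \<omega>" by (simp add: separated_mass_def)
        also have "\<dots> \<le> exp (- (real N * h'))"
          using elim(1) \<alpha> by (simp add: exp_minus field_simps)
        also have "measure (iid block_pmf) {\<tau>. \<forall>i<N. \<tau> i = \<omega> i} = p N"
          unfolding p_def by (rule measure_cylinder)
        also have "p N \<le> exp (- (real N * h))" by (rule elim(2))
        also have "\<dots> \<le> exp (- (real N * h'))" using h\<kappa>(2) by (simp add: mult_left_mono)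
        finally show ?case by (simp add: r_def)
      qed
    qed
  qed
qed

text \<open>The sequence has been fixed first and the exceptional parameters depend on it; measurability of the
condition in both variables permits the exchange of the quantifiers.\<close>

lemma AE_ball_mass_le:
  assumes \<alpha>\<^sub>0: "0 < \<alpha>\<^sub>0" "\<alpha>\<^sub>0 < \<beta>" and \<delta>: "0 < \<delta>"
  shows "AE \<alpha> in lborel. AE \<omega> in iid block_pmf. \<alpha> \<in> {\<alpha>\<^sub>0<..<\<beta>} \<longrightarrow> eventually (\<lambda>N.
      ball_mass \<alpha> (exp (- (real N * (lyapunov \<alpha>\<^sub>0 + \<delta>)))) \<omega>
        \<le> 2 * exp (- (real N * (block_entropy - \<delta>)))) sequentially"
proof -
  interpret \<Omega>: prob_space "iid block_pmf" by (rule prob_space_iid)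
  interpret pair_sigma_finite "lborel :: real measure" "iid block_pmf" ..
  let ?M = "(lborel :: real measure) \<Otimes>\<^sub>M iid block_pmf"
  let ?P = "\<lambda>\<alpha> \<omega>. \<alpha> \<in> {\<alpha>\<^sub>0<..<\<beta>} \<longrightarrow> eventually (\<lambda>N.
      ball_mass \<alpha> (exp (- (real N * (lyapunov \<alpha>\<^sub>0 + \<delta>)))) \<omega>
        \<le> 2 * exp (- (real N * (block_entropy - \<delta>)))) sequentially"
  have "AE \<omega> in iid block_pmf. AE \<alpha> in lborel. ?P \<alpha> \<omega>"
    using AE_averages[OF \<alpha>\<^sub>0(1)]
  proof eventually_elim
    case (elim \<omega>)
    show ?case by (rule AE_ball_mass_le_sequence[OF \<alpha>\<^sub>0 \<delta> elim])
  qed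
  moreover have "{z \<in> space ?M. ?P (fst z) (snd z)} \<in> sets ?M"
  proof -
    have "fst -` {\<alpha>\<^sub>0<..<\<beta>} \<inter> space ?M \<in> sets ?M"
      by (rule measurable_sets[OF measurable_fst]) simp
    also have "fst -` {\<alpha>\<^sub>0<..<\<beta>} \<inter> space ?M = {z \<in> space ?M. fst z \<in> {\<alpha>\<^sub>0<..<\<beta>}}" by auto
    finally show ?thesis
      by (intro sets.sets_Collect_imp sets_Collect_eventually_sequentially borel_measurable_le
          measurable_ball_mass borel_measurable_const)
  qed
  ultimately show ?thesis using AE_commute[of ?P] by blast
qed

lemma lyapunov_approx:
  assumes "0 < \<alpha>" "0 < e"
  obtains q :: rat where "0 < real_of_rat q" "real_of_rat q < \<alpha>" "lyapunov (real_of_rat q) < lyapunov \<alpha> + e"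
proof -
  have "\<alpha> * exp (- (e * p3 / p1)) < \<alpha>" using assms p_pos by simp
  then obtain q :: rat where q: "\<alpha> * exp (- (e * p3 / p1)) < real_of_rat q" "real_of_rat q < \<alpha>"
    using of_rat_dense by blast
  have q0: "0 < real_of_rat q" using q(1) assms by (meson exp_gt_zero less_trans mult_pos_pos)
  have "ln (\<alpha> * exp (- (e * p3 / p1))) < ln (real_of_rat q)" using q(1) assms q0 by simp
  then have "ln \<alpha> - e * p3 / p1 < ln (real_of_rat q)" using assms by (simp add: ln_mult)
  then have "ln \<alpha> - ln (real_of_rat q) < e * p3 / p1" by simp
  then have "(ln \<alpha> - ln (real_of_rat q)) * p1 < e * p3" using p_pos by (simp only: pos_less_divide_eq)
  then have "lyapunov (real_of_rat q) < lyapunov \<alpha> + e"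
    unfolding lyapunov_eq[OF assms(1)] lyapunov_eq[OF q0] using p_pos by (simp add: field_simps)
  then show thesis by (rule that[OF q0 q(2)])
qed

text \<open>The hypothesis involves countably many exceptional sets, so almost every \<open>\<omega>\<close> satisfies all the
bounds, and the continuity of the Lyapunov exponent lets \<open>q\<close> tend to \<open>\<alpha>\<close>.\<close>

lemma has_exact_dim_coding:
  assumes \<alpha>: "0 < \<alpha>" "\<alpha> < \<beta>"
    and AE: "\<And>(q :: rat) k. 0 < real_of_rat q \<Longrightarrow> real_of_rat q < \<alpha> \<Longrightarrow>
      AE \<omega> in iid block_pmf. eventually (\<lambda>N.
        ball_mass \<alpha> (exp (- (real N * (lyapunov (real_of_rat q) + 1 / real (Suc k))))) \<omega>
          \<le> 2 * exp (- (real N * (block_entropy - 1 / real (Suc k))))) sequentially"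
  shows "has_exact_dim (distr (iid block_pmf) borel (coding \<alpha>)) (block_entropy / lyapunov \<alpha>)"
proof (rule has_exact_dim_distrI[OF prob_space_iid coding_measurable])
  have "AE \<omega> in iid block_pmf. \<forall>(q :: rat) k. 0 < real_of_rat q \<and> real_of_rat q < \<alpha> \<longrightarrow> eventually (\<lambda>N.
        ball_mass \<alpha> (exp (- (real N * (lyapunov (real_of_rat q) + 1 / real (Suc k))))) \<omega>
          \<le> 2 * exp (- (real N * (block_entropy - 1 / real (Suc k))))) sequentially"
    unfolding AE_all_countable
  proof (intro allI)
    fix q :: rat and k
    show "AE \<omega> in iid block_pmf. 0 < real_of_rat q \<and> real_of_rat q < \<alpha> \<longrightarrow> eventually (\<lambda>N.
        ball_mass \<alpha> (exp (- (real N * (lyapunov (real_of_rat q) + 1 / real (Suc k))))) \<omega>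
          \<le> 2 * exp (- (real N * (block_entropy - 1 / real (Suc k))))) sequentially"
      using AE[of q k] by (cases "0 < real_of_rat q \<and> real_of_rat q < \<alpha>") auto
  qed
  then show "AE \<omega> in iid block_pmf.
      (\<forall>n. 0 < measure (distr (iid block_pmf) borel (coding \<alpha>)) (cball (coding \<alpha> \<omega>) (exp (- real n)))) \<and>
      (\<lambda>n. - ln (measure (distr (iid block_pmf) borel (coding \<alpha>)) (cball (coding \<alpha> \<omega>) (exp (- real n)))) / real n)
        \<longlonglongrightarrow> block_entropy / lyapunov \<alpha>"
    using AE_averages[OF \<alpha>(1)] unfolding measure_distr_coding_cball
  proof eventually_elim
    case (elim \<omega>)
    define \<phi> where "\<phi> = (\<lambda>t. - ln (ball_mass \<alpha> (exp (- t)) \<omega>))"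
    have pos: "0 < ball_mass \<alpha> (exp t) \<omega>" for t by (rule ball_mass_pos[OF \<alpha>]) simp
    have \<phi>_mono: "\<phi> s \<le> \<phi> t" if "s \<le> t" for s t
      unfolding \<phi>_def using pos ball_mass_mono[of "exp (- t)" "exp (- s)" \<alpha> \<omega>] that by simp
    have "(\<lambda>n. \<phi> (real n) / real n) \<longlonglongrightarrow> block_entropy / lyapunov \<alpha>"
    proof (rule tendsto_exponent_quotient[OF _ elim(2,3) block_entropy_nonneg lyapunov_pos[OF \<alpha>], where c = "ln 2"])
      show "\<phi> s \<le> \<phi> t" if "s \<le> t" for s t using that by (rule \<phi>_mono)
      show "\<phi> (- ln (cylinder_ratio \<alpha> \<omega> n)) \<le> - ln (\<Prod>i<n. pmf block_pmf (\<omega> i))" for n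
      proof -
        have "0 < (\<Prod>i<n. pmf block_pmf (\<omega> i))" using pmf_block_pos by (intro prod_pos) simp
        moreover have "(\<Prod>i<n. pmf block_pmf (\<omega> i)) \<le> ball_mass \<alpha> (cylinder_ratio \<alpha> \<omega> n) \<omega>"
          by (rule cylinder_mass_le_ball_mass[OF \<alpha> order_refl])
        ultimately show ?thesis
          unfolding \<phi>_def using cylinder_ratio_pos[OF \<alpha>(1), of \<omega> n] by simp
      qed
      fix e :: real assume e: "0 < e"
      obtain k where k: "1 / real (Suc k) < e / 2" using nat_approx_posE[of "e / 2"] e by auto
      obtain q :: rat where q: "0 < real_of_rat q" "real_of_rat q < \<alpha>"
        "lyapunov (real_of_rat q) < lyapunov \<alpha> + e / 2"
        using lyapunov_approx[OF \<alpha>(1), of "e / 2"] e by auto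
      from elim(1) q have "eventually (\<lambda>N.
        ball_mass \<alpha> (exp (- (real N * (lyapunov (real_of_rat q) + 1 / real (Suc k))))) \<omega>
          \<le> 2 * exp (- (real N * (block_entropy - 1 / real (Suc k))))) sequentially" by blast
      then show "eventually (\<lambda>n. real n * (block_entropy - e) - ln 2 \<le> \<phi> (real n * (lyapunov \<alpha> + e))) sequentially"
      proof eventually_elim
        case (elim N)
        define t where "t = real N * (lyapunov (real_of_rat q) + 1 / real (Suc k))"
        have "ln (ball_mass \<alpha> (exp (- t)) \<omega>) \<le> ln (2 * exp (- (real N * (block_entropy - 1 / real (Suc k)))))"
          using elim pos[of "- t"] unfolding t_def[symmetric] by simp
        also have "\<dots> = ln 2 - real N * (block_entropy - 1 / real (Suc k))" by (simp add: ln_mult)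
        finally have "real N * (block_entropy - 1 / real (Suc k)) - ln 2 \<le> \<phi> t" unfolding \<phi>_def by linarith
        moreover have "\<phi> t \<le> \<phi> (real N * (lyapunov \<alpha> + e))"
          unfolding t_def using k q(3) by (intro \<phi>_mono mult_left_mono) linarith+
        moreover have "real N * (block_entropy - e) \<le> real N * (block_entropy - 1 / real (Suc k))"
          using k e by (intro mult_left_mono) linarith+
        ultimately show ?case by linarith
      qed
    qed
    then show ?case unfolding \<phi>_def using pos by simp
  qed
qed

end

theorem theorem1p2:
  fixes p1 p2 p3 \<beta> \<gamma> :: real
  assumes "p1 > 0" "p2 > 0" "p3 > 0" "p1 + p2 + p3 = 1"
    and "0 < \<beta>" "\<beta> < 1 / 9" "0 < \<gamma>" "\<gamma> < 1 / 9"
  shows "AE \<alpha> in lebesgue. \<alpha> \<in> {0<..<\<beta>} \<longrightarrow>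
    exact_dimensional (nu p1 p2 p3 \<alpha> \<beta> \<gamma>) \<and>
    dim_H (nu p1 p2 p3 \<alpha> \<beta> \<gamma>) =
      (- (p1 * ln p1 + p2 * ln p2 + p3 * ln p3) + Phi p1 p2 p3) /
      (- (p1 * ln \<alpha> + p2 * ln \<beta> + p3 * ln \<gamma>))"
proof -
  interpret common_fixed_point \<beta> \<gamma> p1 p2 p3
    using assms by unfold_locales
  have "AE \<alpha> in lborel. \<forall>(q :: rat) k. 0 < real_of_rat q \<and> real_of_rat q < \<beta> \<longrightarrow>
      (AE \<omega> in iid block_pmf. \<alpha> \<in> {real_of_rat q<..<\<beta>} \<longrightarrow> eventually (\<lambda>N.
        ball_mass \<alpha> (exp (- (real N * (lyapunov (real_of_rat q) + 1 / real (Suc k))))) \<omega>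
          \<le> 2 * exp (- (real N * (block_entropy - 1 / real (Suc k))))) sequentially)"
    unfolding AE_all_countable
  proof (intro allI)
    fix q :: rat and k
    show "AE \<alpha> in lborel. 0 < real_of_rat q \<and> real_of_rat q < \<beta> \<longrightarrow>
      (AE \<omega> in iid block_pmf. \<alpha> \<in> {real_of_rat q<..<\<beta>} \<longrightarrow> eventually (\<lambda>N.
        ball_mass \<alpha> (exp (- (real N * (lyapunov (real_of_rat q) + 1 / real (Suc k))))) \<omega>
          \<le> 2 * exp (- (real N * (block_entropy - 1 / real (Suc k))))) sequentially)"
    proof (cases "0 < real_of_rat q \<and> real_of_rat q < \<beta>")
      case True
      then have "0 < real_of_rat q" "real_of_rat q < \<beta>" "0 < 1 / real (Suc k)" by auto
      from AE_ball_mass_le[OF this] show ?thesis by eventually_elim blast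
    next
      case False
      then show ?thesis by (intro AE_I2) blast
    qed
  qed
  then have "AE \<alpha> in lborel. \<alpha> \<in> {0<..<\<beta>} \<longrightarrow>
    exact_dimensional (nu p1 p2 p3 \<alpha> \<beta> \<gamma>) \<and>
    dim_H (nu p1 p2 p3 \<alpha> \<beta> \<gamma>) =
      (- (p1 * ln p1 + p2 * ln p2 + p3 * ln p3) + Phi p1 p2 p3) /
      (- (p1 * ln \<alpha> + p2 * ln \<beta> + p3 * ln \<gamma>))"
  proof eventually_elim
    case (elim \<alpha>)
    show ?case
    proof
      assume "\<alpha> \<in> {0<..<\<beta>}"
      then have \<alpha>: "0 < \<alpha>" "\<alpha> < \<beta>" by auto
      have dim: "has_exact_dim (nu p1 p2 p3 \<alpha> \<beta> \<gamma>) (block_entropy / lyapunov \<alpha>)"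
        unfolding nu_eq_distr_coding[OF \<alpha>]
      proof (rule has_exact_dim_coding[OF \<alpha>])
        fix q :: rat and k
        assume q: "0 < real_of_rat q" "real_of_rat q < \<alpha>"
        then have mem: "\<alpha> \<in> {real_of_rat q<..<\<beta>}" and q\<beta>: "real_of_rat q < \<beta>" using \<alpha> by auto
        from elim[rule_format, OF conjI[OF q(1) q\<beta>], of k]
        show "AE \<omega> in iid block_pmf. eventually (\<lambda>N.
          ball_mass \<alpha> (exp (- (real N * (lyapunov (real_of_rat q) + 1 / real (Suc k))))) \<omega>
            \<le> 2 * exp (- (real N * (block_entropy - 1 / real (Suc k))))) sequentially"
          by eventually_elim (use mem in blast)
      qed
      have "prob_space (nu p1 p2 p3 \<alpha> \<beta> \<gamma>)"
        unfolding nu_eq_distr_coding[OF \<alpha>] by (rule prob_space.prob_space_distr[OF prob_space_iid coding_measurable])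
      then have "dim_H (nu p1 p2 p3 \<alpha> \<beta> \<gamma>) = block_entropy / lyapunov \<alpha>"
        using dim by (rule has_exact_dim_imp_dim_H)
      also have "\<dots> = (- (p1 * ln p1 + p2 * ln p2 + p3 * ln p3) + Phi p1 p2 p3) /
          (- (p1 * ln \<alpha> + p2 * ln \<beta> + p3 * ln \<gamma>))"
        unfolding block_entropy_eq lyapunov_eq[OF \<alpha>(1)] using assms(3) by simp
      finally show "exact_dimensional (nu p1 p2 p3 \<alpha> \<beta> \<gamma>) \<and>
        dim_H (nu p1 p2 p3 \<alpha> \<beta> \<gamma>) =
          (- (p1 * ln p1 + p2 * ln p2 + p3 * ln p3) + Phi p1 p2 p3) /
          (- (p1 * ln \<alpha> + p2 * ln \<beta> + p3 * ln \<gamma>))"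
        using dim unfolding exact_dimensional_def by blast
    qed
  qed
  then show ?thesis by (rule AE_completion)
qed

end
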